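(* Let $\mu$ be a PW-sampling measure, let $r\ge0$, and let $\mu_r=\mu+r\pi\delta_0$, where $\delta_0$ is the unit point mass at $0$. Then for a.e. $t>0$, $$h^{\mu_r}(t)=\frac{h^\mu(t)}{\Big(1+r\int_0^th^\mu(s)\,ds\Big)^2}.$$
   Context: $\mathrm{PW}_t$: entire functions of exponential type at most $t$ in $L^2(\mathbb R)$, with the $L^2(\mathbb R)$ norm. A positive measure $\nu$ on $\mathbb R$ is PW-sampling if for every $a>0$ there is $C>0$ with $C^{-1}\|f\|_{L^2(\mathbb R)}\le\|f\|_{L^2(\nu)}\le C\|f\|_{L^2(\mathbb R)}$ for all $f\in\mathrm{PW}_a$ (if $\mu$ is PW-sampling so is $\mu_r$). $\mathrm{PW}_t(\nu)$ denotes $\mathrm{PW}_t$ with the $L^2(\nu)$ inner product, $k^\nu_t$ its reproducing kernel at $0$ (i.e. $f(0)=\int f\,\overline{k^\nu_t}\,d\nu$ for $f\in\mathrm{PW}_t$), and $h^\nu(t)=\pi\frac{d}{dt}k^\nu_t(0)$. *)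

theory Defs
  imports "HOL-Analysis.Analysis"
begin

definition exp_type_le :: "real \<Rightarrow> (complex \<Rightarrow> complex) \<Rightarrow> bool" where
  "exp_type_le t f \<longleftrightarrow>
     (\<forall>\<epsilon>>0. \<exists>C. \<forall>z. norm (f z) \<le> C * exp ((t + \<epsilon>) * norm z))"

definition L2sq :: "real measure \<Rightarrow> (complex \<Rightarrow> complex) \<Rightarrow> ennreal" where
  "L2sq \<nu> f = (\<integral>\<^sup>+ x. ennreal ((norm (f (complex_of_real x)))\<^sup>2) \<partial>\<nu>)"

definition PW :: "real \<Rightarrow> (complex \<Rightarrow> complex) set" where
  "PW t = {f. f holomorphic_on UNIV \<and> exp_type_le t f \<and>
              (\<lambda>x. f (complex_of_real x)) \<in> borel_measurable lborel \<and>
              L2sq lborel f < \<infinity>}"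

definition PW_sampling :: "real measure \<Rightarrow> bool" where
  "PW_sampling \<nu> \<longleftrightarrow> sets \<nu> = sets borel \<and>
     (\<forall>a>0. \<exists>C>0. \<forall>f\<in>PW a.
        ennreal (inverse (C\<^sup>2)) * L2sq lborel f \<le> L2sq \<nu> f \<and>
        L2sq \<nu> f \<le> ennreal (C\<^sup>2) * L2sq lborel f)"

definition PW_kernel :: "real measure \<Rightarrow> real \<Rightarrow> complex \<Rightarrow> complex" where
  "PW_kernel \<nu> t = (THE k. k \<in> PW t \<and>
      (\<forall>f\<in>PW t. f 0 = (\<integral>x. f (complex_of_real x) * cnj (k (complex_of_real x)) \<partial>\<nu>)))"

text \<open>h^nu(t) = pi * d/dt k^nu_t(0)  (k^nu_t(0) is real, equal to the squared norm of k^nu_t).\<close>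
definition h_fun :: "real measure \<Rightarrow> real \<Rightarrow> real" where
  "h_fun \<nu> t = pi * deriv (\<lambda>s. Re (PW_kernel \<nu> s 0)) t"

definition add_point_mass :: "real measure \<Rightarrow> real \<Rightarrow> real measure" where
  "add_point_mass \<nu> c = measure_of UNIV (sets borel)
      (\<lambda>A. emeasure \<nu> A + ennreal c * indicator A 0)"

end

theory Submission
  imports Defs "HOL-Complex_Analysis.Complex_Analysis"
begin

text \<open>
  Let \<open>K t\<close> be the value at \<open>0\<close> of the reproducing kernel for \<open>\<mu>\<close>. Adding the mass \<open>c = r\<pi>\<close> at \<open>0\<close>
  divides the kernel by \<open>1 + c K t\<close>, so the formula follows once \<open>K\<close> is absolutely continuous with
  \<open>K(0+) = 0\<close>.

  For absolute continuity translate the spectra to \<open>[0,2t]\<close>, so that the backward shift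
  \<open>jF = (F - F 0)/(iz)\<close> acts on the spaces, and let \<open>k\<^sub>t(z) = exp(itz) \<kappa>\<^sub>t(z)\<close> be the translated kernels.
  Their increments over disjoint intervals are orthogonal, and the form
  \<open>B(F,G) = \<langle>jF,G\<rangle> + \<langle>F,jG\<rangle>\<close> satisfies \<open>Re B(k\<^sub>a,k\<^sub>b) = a K b + b K a\<close>, because \<open>\<kappa>\<^sub>a\<close> reproduces
  \<open>sin(ax)/x\<close>. If \<open>F\<close> is orthogonal to the space of index \<open>s\<close>, then \<open>\<langle>F,jG\<rangle> = O(t-s) \<parallel>F\<parallel> \<parallel>G\<parallel>\<close>:
  in the Lebesgue norm \<open>jG\<close> is within \<open>2(t-s) \<parallel>G\<parallel>\<close> of that space, and the sampling property compares
  the two norms. Applied to the increments over a union \<open>E\<close> of subintervals of \<open>I\<close> this gives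
  \<open>K(I) |E|\<^sup>2 \<le> D |I|\<^sup>2 K(E)\<close>, half of an \<open>A\<^sub>2\<close> condition, which leaves no room for a singular part.
\<close>

section \<open>The Phragmen-Lindelof principle\<close>


text \<open>The formula integrates the almost everywhere derivative of \<open>K\<close>, and this
  integral recovers \<open>K\<close> only if \<open>K\<close> has no singular part; monotonicity
  alone does not exclude one. The translation of spectra also makes the form informative. The
  kernels of the symmetric spaces are real on the real line, so on them the form would be purely
  imaginary; the factors exp(itx) produce the real part. The bound 2(t-s) has a Fourier reason:
  (exp(i\<lambda>z) - 1)/(iz) is the integral of exp(iuz) over u from 0 to \<lambda>, so j replaces
  a spectral density on [0,2t] by its tail integrals, and these are small in norm on the piece
  [2s,2t] of length 2(t-s). Spectra are never computed, however. That a spectrum lies above 2s is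
  expressed by the decay exp(-2s Im z) in the upper half-plane, and orthogonality of functions with
  separated spectra by the vanishing of a boundary integral. Hence the opening growth estimates for
  entire functions.\<close>

lemma frontier_closed_subset:
  fixes S U :: "'a::topological_space set"
  assumes "closed S" "open U" "U \<subseteq> S" "z \<in> frontier S"
  shows "z \<in> S" "z \<notin> U"
  using assms interior_maximal[of U S] by (auto simp: frontier_def)

text \<open>The comparison function \<open>E\<close> is a rotated branch of z+1 to the power 3/2.
  This exponent lies strictly between 1, the order of \<open>g\<close>, and 2, the critical order of
  a quadrant, so exp(-\<eta>E) beats the growth of \<open>g\<close> and the maximum principle
  applies on large quarter discs. Then \<eta> tends to 0.\<close>

lemma phragmen_lindelof_quadrant:
  fixes g :: "complex \<Rightarrow> complex"
  assumes hol: "g holomorphic_on UNIV"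
    and growth: "\<And>z. cmod (g z) \<le> C * exp (B * cmod z)"
    and re: "\<And>x. x \<ge> 0 \<Longrightarrow> cmod (g (complex_of_real x)) \<le> M"
    and im: "\<And>y. y \<ge> 0 \<Longrightarrow> cmod (g (\<i> * complex_of_real y)) \<le> M"
    and M: "M > 0" and z: "Re z \<ge> 0" "Im z \<ge> 0"
  shows "cmod (g z) \<le> M"
proof -
  \<comment> \<open>The argument of z+1 lies in [0, pi/2]; multiplied by 3/2 and diminished by 3pi/8
    it lies in [-3pi/8, 3pi/8], where the cosine is at least \<open>c\<close>. The shift by 1 keeps
    the branch cut of \<open>Ln\<close> away from the closed quadrant.\<close>
  define E where "E = (\<lambda>z. exp (3/2 * Ln (z + 1) - \<i> * complex_of_real (3*pi/8)))"
  define c where "c = cos (3*pi/8)"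
  have c: "c > 0" unfolding c_def by (rule cos_gt_zero_pi) auto
  have ReE: "Re (E z) \<ge> c * (cmod z) powr (3/2)" if "Re z \<ge> 0" "Im z \<ge> 0" for z
  proof -
    have nz: "z + 1 \<noteq> 0" using that by (auto simp: complex_eq_iff)
    have cm: "cmod z \<le> cmod (z+1)" unfolding cmod_def
      by (intro real_sqrt_le_mono) (use that in \<open>auto simp: power2_eq_square algebra_simps\<close>)
    have th: "Im (Ln (z+1)) \<le> pi/2" "Im (Ln (z+1)) \<ge> 0"
      using that Re_Ln_pos_lt[OF nz] Im_Ln_pos_le[OF nz] Re_Ln_pos_le[OF nz] by auto
    have "Re (E z) = cmod (z+1) powr (3/2) * cos (3/2 * Im (Ln (z+1)) - 3*pi/8)"
      unfolding E_def by (simp add: Re_exp powr_def nz Re_Ln)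
    moreover have "cos (3/2 * Im (Ln (z+1)) - 3*pi/8) \<ge> c"
    proof -
      have "\<bar>3/2 * Im (Ln (z+1)) - 3*pi/8\<bar> \<le> 3*pi/8" using th by (auto simp: abs_if)
      then have "cos (3*pi/8) \<le> cos \<bar>3/2 * Im (Ln (z+1)) - 3*pi/8\<bar>"
        by (intro cos_monotone_0_pi_le) auto
      then show ?thesis by (simp add: c_def)
    qed
    moreover have "cmod z powr (3/2) \<le> cmod (z+1) powr (3/2)"
      using cm by (intro powr_mono2) auto
    ultimately show ?thesis using c
      by (metis (no_types, lifting) less_eq_real_def mult.commute mult_mono norm_ge_zero powr_ge_zero)
  qed
  have bound: "cmod (g z) \<le> M * exp (\<eta> * Re (E z))" if \<eta>: "\<eta> > 0" for \<eta>
  proof -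
    define h where "h = (\<lambda>z. g z * exp (- complex_of_real \<eta> * E z))"
    have hn: "cmod (h w) = cmod (g w) * exp (- \<eta> * Re (E w))" for w
      by (simp add: h_def norm_mult)
    have "filterlim (\<lambda>R::real. \<eta> * c * R powr (3/2) - B * R) at_top at_top"
    proof -
      have "filterlim (\<lambda>R::real. R * (\<eta> * c * sqrt R - B)) at_top at_top"
      proof (rule filterlim_at_top_mult_at_top[OF filterlim_ident])
        have "filterlim (\<lambda>R::real. \<eta> * c * sqrt R) at_top at_top"
          using \<eta> c by (intro filterlim_tendsto_pos_mult_at_top[OF tendsto_const] sqrt_at_top) auto
        then show "filterlim (\<lambda>R::real. \<eta> * c * sqrt R - B) at_top at_top"
          using filterlim_tendsto_add_at_top[of "\<lambda>_. -B" "-B"] by auto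
      qed
      then show ?thesis
      proof (rule filterlim_cong[THEN iffD1, rotated -1])
        show "\<forall>\<^sub>F R::real in at_top. R * (\<eta> * c * sqrt R - B) = \<eta> * c * R powr (3/2) - B * R"
        proof (rule eventually_at_top_linorderI[of 1])
          fix R :: real assume "R \<ge> 1"
          then have "R powr (3/2) = R * sqrt R"
            using powr_add[of R 1 "1/2"] by (simp add: powr_half_sqrt)
          then show "R * (\<eta> * c * sqrt R - B) = \<eta> * c * R powr (3/2) - B * R"
            by (simp add: algebra_simps)
        qed
      qed auto
    qed
    then have "\<forall>\<^sub>F R in at_top. \<eta> * c * R powr (3/2) - B * R \<ge> ln ((\<bar>C\<bar>+1)/M)"
      by (simp add: filterlim_at_top)
    moreover have "\<forall>\<^sub>F R in at_top. R \<ge> cmod z + 1" by (rule eventually_ge_at_top)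
    ultimately have "\<forall>\<^sub>F R in at_top. \<eta> * c * R powr (3/2) - B * R \<ge> ln ((\<bar>C\<bar>+1)/M) \<and> R \<ge> cmod z + 1"
      by (rule eventually_conj)
    \<comment> \<open>The threshold is what makes the bound on the arc equal to \<open>M\<close>;
      the growth constant enters as |C| + 1 so that the logarithm has a positive argument.\<close>
    then obtain R where R1: "\<eta> * c * R powr (3/2) - B * R \<ge> ln ((\<bar>C\<bar>+1)/M)"
      and R2: "R \<ge> cmod z + 1"
      using eventually_happens'[OF trivial_limit_at_top_linorder] by blast
    define S where "S = {w. Re w \<ge> 0} \<inter> {w. Im w \<ge> 0} \<inter> cball 0 R"
    define U where "U = {w. Re w > 0} \<inter> {w. Im w > 0} \<inter> ball 0 R"
    have S: "closed S" unfolding S_def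
      by (intro closed_Int closed_halfspace_Re_ge closed_halfspace_Im_ge closed_cball)
    have U: "open U" unfolding U_def
      by (intro open_Int open_halfspace_Re_gt open_halfspace_Im_gt open_ball)
    have US: "U \<subseteq> S" by (auto simp: U_def S_def)
    have holE: "E holomorphic_on {w. Re w > -1}" unfolding E_def
      by (intro holomorphic_intros) (auto simp: complex_nonpos_Reals_iff)
    have holh: "h holomorphic_on {w. Re w > -1}" unfolding h_def
      by (intro holomorphic_intros holE holomorphic_on_subset[OF hol]) auto
    have "cmod (h z) \<le> M"
    proof (rule maximum_modulus_frontier[of h S])
      show "h holomorphic_on interior S"
        by (rule holomorphic_on_subset[OF holh]) (use interior_subset in \<open>force simp: S_def\<close>)
      have "S \<subseteq> {w. Re w > -1}" by (force simp: S_def)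
      then show "continuous_on (closure S) h"
        using S holomorphic_on_imp_continuous_on[OF holh] by (auto intro: continuous_on_subset)
      show "bounded S" unfolding S_def by (intro bounded_Int disjI2 bounded_cball)
      show "z \<in> S" using z R2 by (simp add: S_def)
      fix w assume w: "w \<in> frontier S"
      have wS: "w \<in> S" "w \<notin> U" using frontier_closed_subset[OF S U US w] by auto
      then have w0: "Re w \<ge> 0" "Im w \<ge> 0" by (auto simp: S_def)
      have "Re w = 0 \<or> Im w = 0 \<or> cmod w = R" using wS by (auto simp: U_def S_def)
      moreover have "cmod (h w) \<le> M" if "cmod (g w) \<le> M"
      proof -
        have "0 \<le> c * cmod w powr (3/2)" using c by simp
        then have "exp (- \<eta> * Re (E w)) \<le> 1" using ReE[OF w0] \<eta> by simp
        then show ?thesis unfolding hn using that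
          by (metis M dual_order.strict_implies_order exp_ge_zero mult.right_neutral mult_mono)
      qed
      moreover have "w = complex_of_real (Re w)" if "Im w = 0" using that by (simp add: complex_eq_iff)
      moreover have "w = \<i> * complex_of_real (Im w)" if "Re w = 0" using that by (simp add: complex_eq_iff)
      moreover have "cmod (h w) \<le> M" if "cmod w = R"
      proof -
        have "cmod (h w) \<le> (C * exp (B * R)) * exp (- \<eta> * Re (E w))"
          unfolding hn using growth[of w] that by (simp add: mult_right_mono)
        also have "\<dots> \<le> ((\<bar>C\<bar>+1) * exp (B * R)) * exp (- \<eta> * (c * R powr (3/2)))"
          using ReE[OF w0] that \<eta> by (intro mult_mono) auto
        also have "\<dots> = (\<bar>C\<bar>+1) * exp (- (\<eta> * c * R powr (3/2) - B * R))"
          by (simp flip: exp_add add: algebra_simps)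
        also have "\<dots> \<le> (\<bar>C\<bar>+1) * exp (- ln ((\<bar>C\<bar>+1)/M))"
          using R1 by (intro mult_left_mono) auto
        also have "\<dots> = M" using M by (simp add: exp_minus)
        finally show ?thesis .
      qed
      ultimately show "cmod (h w) \<le> M"
        using re[of "Re w"] im[of "Im w"] w0 by metis
    qed
    then show ?thesis using \<eta> by (simp add: hn exp_minus field_simps)
  qed
  have "((\<lambda>\<eta>. M * exp (\<eta> * Re (E z))) \<longlongrightarrow> M * exp (0 * Re (E z))) (at_right 0)"
    by (intro tendsto_intros)
  moreover have "\<forall>\<^sub>F \<eta> in at_right 0. cmod (g z) \<le> M * exp (\<eta> * Re (E z))"
    using bound eventually_at_right_less[of "0::real"] by (auto elim: eventually_mono)
  ultimately show ?thesis
    using tendsto_lowerbound by fastforce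
qed

text \<open>Powers remove the loss: the n-th power of \<open>g\<close>, divided by z + \<i>, is at
  most \<open>M ^ n\<close> on the real line and, by the a priori bound \<open>B\<close>, also on a
  large half circle. The maximum principle then costs a factor |z + \<i>| that does not depend on n,
  which forces |g z| / M to be at most 1.\<close>

lemma bounded_halfplane_max:
  fixes g :: "complex \<Rightarrow> complex"
  assumes hol: "g holomorphic_on UNIV"
    and B: "\<And>z. Im z \<ge> 0 \<Longrightarrow> cmod (g z) \<le> B"
    and re: "\<And>x. cmod (g (complex_of_real x)) \<le> M" and M: "M > 0" and z: "Im z \<ge> 0"
  shows "cmod (g z) \<le> M"
proof -
  have pw: "(cmod (g z) / M) ^ n \<le> cmod (z + \<i>)" for n
  proof -
    define h where "h = (\<lambda>w. g w ^ n / (w + \<i>))"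
    \<comment> \<open>On the arc the divisor z + \<i> has modulus at least R - 1 and must compensate
      \<open>(B / M) ^ n\<close>; the radius also has to enclose z.\<close>
    define R where "R = cmod z + 1 + (B / M) ^ n + 1"
    have B0: "B \<ge> 0" using order_trans[OF norm_ge_zero B[of 0]] by simp
    then have "(B / M) ^ n \<ge> 0" using M by simp
    moreover have "cmod z \<ge> 0" by simp
    ultimately have R: "R > 1" "cmod z < R" "R - 1 \<ge> (B/M)^n" unfolding R_def by linarith+
    define S where "S = {w. Im w \<ge> 0} \<inter> cball 0 R"
    define U where "U = {w. Im w > 0} \<inter> ball 0 R"
    have S: "closed S" unfolding S_def
      by (intro closed_Int closed_halfspace_Im_ge closed_cball)
    have U: "open U" unfolding U_def by (intro open_Int open_halfspace_Im_gt open_ball)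
    have US: "U \<subseteq> S" by (auto simp: U_def S_def)
    have holh: "h holomorphic_on {w. Im w > -1}" unfolding h_def
      by (intro holomorphic_intros holomorphic_on_subset[OF hol]) (auto simp: complex_eq_iff)
    have "cmod (h z) \<le> M ^ n"
    proof (rule maximum_modulus_frontier[of h S])
      show "h holomorphic_on interior S"
        by (rule holomorphic_on_subset[OF holh]) (use interior_subset in \<open>force simp: S_def\<close>)
      have "S \<subseteq> {w. Im w > -1}" by (force simp: S_def)
      then show "continuous_on (closure S) h"
        using S holomorphic_on_imp_continuous_on[OF holh] by (auto intro: continuous_on_subset)
      show "bounded S" unfolding S_def by (intro bounded_Int disjI2 bounded_cball)
      show "z \<in> S" using z R by (simp add: S_def)
      fix w assume w: "w \<in> frontier S"
      have wS: "w \<in> S" "w \<notin> U" using frontier_closed_subset[OF S U US w] by auto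
      then have w0: "Im w \<ge> 0" by (auto simp: S_def)
      have w1: "cmod (w + \<i>) \<ge> 1" using abs_Im_le_cmod[of "w + \<i>"] w0 by simp
      consider "Im w = 0" | "cmod w = R" using wS by (auto simp: U_def S_def)
      then show "cmod (h w) \<le> M ^ n"
      proof cases
        case 1
        then have "w = complex_of_real (Re w)" by (simp add: complex_eq_iff)
        then have "cmod (g w) \<le> M" using re by metis
        then have "cmod (g w) ^ n \<le> M ^ n" by (intro power_mono) auto
        then have "cmod (g w) ^ n / cmod (w + \<i>) \<le> M ^ n / 1"
          using w1 M by (intro frac_le) auto
        then show ?thesis unfolding h_def by (simp add: norm_divide norm_power)
      next
        case 2
        have "cmod (w + \<i>) \<ge> R - 1" using norm_triangle_ineq2[of w "-\<i>"] 2 by simp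
        then have "cmod (w + \<i>) \<ge> (B/M)^n" using R by linarith
        then have "B ^ n \<le> M ^ n * cmod (w + \<i>)" using M by (simp add: power_divide field_simps)
        moreover have "cmod (g w) ^ n \<le> B ^ n" using B[OF w0] by (intro power_mono) auto
        ultimately show ?thesis unfolding h_def using w1 M
          by (simp add: norm_divide norm_power divide_le_eq)
      qed
    qed
    moreover have "z + \<i> \<noteq> 0" using z by (auto simp: complex_eq_iff)
    ultimately show ?thesis using M
      by (simp add: h_def norm_divide norm_power power_divide field_simps)
  qed
  show ?thesis
  proof (rule ccontr)
    assume "\<not> ?thesis"
    then have "cmod (g z) / M > 1" using M by simp
    then obtain n where "(cmod (g z) / M) ^ n > cmod (z + \<i>)"
      using real_arch_pow by blast
    with pw[of n] show False by linarith
  qed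
qed

lemma exp_type_leD:
  assumes "exp_type_le t f" "\<epsilon> > 0"
  obtains C where "C > 0" "\<And>z. cmod (f z) \<le> C * exp ((t + \<epsilon>) * cmod z)"
proof -
  obtain C where C: "\<And>z. cmod (f z) \<le> C * exp ((t + \<epsilon>) * cmod z)"
    using assms unfolding exp_type_le_def by blast
  show ?thesis
  proof (rule that[of "\<bar>C\<bar> + 1"])
    fix z have "C * exp ((t + \<epsilon>) * cmod z) \<le> (\<bar>C\<bar> + 1) * exp ((t + \<epsilon>) * cmod z)"
      by (intro mult_right_mono) auto
    then show "cmod (f z) \<le> (\<bar>C\<bar> + 1) * exp ((t + \<epsilon>) * cmod z)" using C[of z] by linarith
  qed auto
qed

text \<open>The factor exp(\<i>(t+\<epsilon>)z) has modulus 1 on the real line and decays just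
  enough to keep the product bounded on the positive imaginary axis. Two quadrants give some bound
  on the half-plane, \<open>bounded_halfplane_max\<close> improves it to \<open>M\<close>, and
  \<epsilon> tends to 0.\<close>

lemma phragmen_lindelof_upper:
  assumes hol: "f holomorphic_on UNIV" and ty: "exp_type_le t f" and t: "t \<ge> 0"
    and M: "M > 0" "\<And>x. cmod (f (complex_of_real x)) \<le> M" and z: "Im z \<ge> 0"
  shows "cmod (f z) \<le> M * exp (t * Im z)"
proof -
  have eps: "cmod (f z) \<le> M * exp ((t + \<epsilon>) * Im z)" if \<epsilon>: "\<epsilon> > 0" for \<epsilon>
  proof -
    obtain C where C: "C > 0" "\<And>z. cmod (f z) \<le> C * exp ((t + \<epsilon>) * cmod z)"
      using exp_type_leD[OF ty \<epsilon>] by blast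
    define g where "g = (\<lambda>z. f z * exp (\<i> * complex_of_real (t + \<epsilon>) * z))"
    have gn: "cmod (g w) = cmod (f w) * exp (- (t + \<epsilon>) * Im w)" for w
      by (simp add: g_def norm_mult) (simp add: algebra_simps)
    have hol_g: "g holomorphic_on UNIV" unfolding g_def by (intro holomorphic_intros hol)
    have growth: "cmod (g w) \<le> C * exp (2 * (t + \<epsilon>) * cmod w)" for w
    proof -
      have "- (t + \<epsilon>) * Im w \<le> (t + \<epsilon>) * cmod w"
        using abs_Im_le_cmod[of w] t \<epsilon>
        by (smt (verit, ccfv_SIG) minus_mult_minus mult_left_mono)
      then have "cmod (g w) \<le> (C * exp ((t + \<epsilon>) * cmod w)) * exp ((t + \<epsilon>) * cmod w)"
        unfolding gn using C by (intro mult_mono) auto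
      then show ?thesis by (simp add: algebra_simps flip: exp_add)
    qed
    have rM: "cmod (g (complex_of_real x)) \<le> M" for x using M by (simp add: gn)
    have iC: "cmod (g (\<i> * complex_of_real y)) \<le> C" if "y \<ge> 0" for y
    proof -
      have "cmod (f (\<i> * complex_of_real y)) \<le> C * exp ((t + \<epsilon>) * y)"
        using C(2)[of "\<i> * complex_of_real y"] that by (simp add: norm_mult)
      then have "cmod (g (\<i> * complex_of_real y)) \<le> (C * exp ((t + \<epsilon>) * y)) * exp (- (t + \<epsilon>) * y)"
        unfolding gn by (simp add: mult_right_mono)
      also have "\<dots> = C" by (simp flip: exp_add add: algebra_simps)
      finally show ?thesis .
    qed
    have bd: "cmod (g w) \<le> max M C" if w: "Im w \<ge> 0" for w
    proof (cases "Re w \<ge> 0")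
      case True
      show ?thesis
        by (rule phragmen_lindelof_quadrant[OF hol_g growth])
           (use True w rM iC M in \<open>auto intro: order_trans[OF iC] order_trans[OF rM]\<close>)
    next
      case False
      \<comment> \<open>Rotation by \<i> carries the first quadrant onto the second and exchanges
        the roles of the two bounding axes.\<close>
      define g' where "g' = (\<lambda>z. g (\<i> * z))"
      have "cmod (g' (- \<i> * w)) \<le> max M C"
      proof (rule phragmen_lindelof_quadrant[of g' C "2 * (t + \<epsilon>)"])
        show "g' holomorphic_on UNIV" unfolding g'_def
          using holomorphic_on_compose_gen[of "\<lambda>z. \<i> * z" UNIV g UNIV] hol_g
          by (auto simp: o_def intro!: holomorphic_intros)
        show "cmod (g' z) \<le> C * exp (2 * (t + \<epsilon>) * cmod z)" for z
          using growth[of "\<i> * z"] by (simp add: g'_def norm_mult)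
        show "cmod (g' (\<i> * complex_of_real y)) \<le> max M C" for y
          using rM[of "-y"] by (simp add: g'_def mult.assoc[symmetric])
      qed (use iC M False w in \<open>auto simp: g'_def intro: order_trans[OF iC]\<close>)
      then show ?thesis by (simp add: g'_def mult.assoc[symmetric])
    qed
    have "cmod (g z) \<le> M" by (rule bounded_halfplane_max[OF hol_g bd rM M(1) z])
    then have "cmod (f z) * exp (- ((t + \<epsilon>) * Im z)) \<le> M" by (simp only: gn mult_minus_left)
    then show ?thesis by (simp add: exp_minus divide_simps)
  qed
  have "((\<lambda>\<epsilon>. M * exp ((t + \<epsilon>) * Im z)) \<longlongrightarrow> M * exp ((t + 0) * Im z)) (at_right 0)"
    by (intro tendsto_intros)
  moreover have "\<forall>\<^sub>F \<epsilon> in at_right 0. cmod (f z) \<le> M * exp ((t + \<epsilon>) * Im z)"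
    using eps eventually_at_right_less[of "0::real"] by (auto elim: eventually_mono)
  ultimately show ?thesis using tendsto_lowerbound by fastforce
qed

lemma phragmen_lindelof_exp_type:
  assumes hol: "f holomorphic_on UNIV" and ty: "exp_type_le t f" and t: "t \<ge> 0"
    and M: "M > 0" "\<And>x. cmod (f (complex_of_real x)) \<le> M"
  shows "cmod (f z) \<le> M * exp (t * \<bar>Im z\<bar>)"
proof (cases "Im z \<ge> 0")
  case True
  then show ?thesis using phragmen_lindelof_upper[OF hol ty t M] by simp
next
  case False
  have "cmod ((\<lambda>z. f (- z)) (- z)) \<le> M * exp (t * Im (- z))"
  proof (rule phragmen_lindelof_upper[OF _ _ t M(1)])
    show "(\<lambda>z. f (- z)) holomorphic_on UNIV"
      using holomorphic_on_compose_gen[of "\<lambda>z. - z" UNIV f UNIV] hol holomorphic_on_minus[OF holomorphic_on_ident]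
      by (auto simp: o_def)
    show "exp_type_le t (\<lambda>z. f (- z))"
      using ty unfolding exp_type_le_def by (metis norm_minus_cancel)
    show "cmod (f (- complex_of_real x)) \<le> M" for x using M(2)[of "-x"] by simp
  qed (use False in auto)
  then show ?thesis using False by simp
qed

section \<open>Square integrable functions\<close>


text \<open>Functions of a complex variable are measured through their real values only, so entire
  functions are elements without restriction or quotient. Accordingly \<open>nsq\<close> is just a
  seminorm; on Paley-Wiener functions the pointwise bounds make it definite.\<close>

definition L2fun :: "real measure \<Rightarrow> (complex \<Rightarrow> complex) set" where
  "L2fun \<nu> = {f. (\<lambda>x. f (complex_of_real x)) \<in> borel_measurable \<nu> \<and>
                 integrable \<nu> (\<lambda>x. (cmod (f (complex_of_real x)))\<^sup>2)}"

definition ip :: "real measure \<Rightarrow> (complex \<Rightarrow> complex) \<Rightarrow> (complex \<Rightarrow> complex) \<Rightarrow> complex" where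
  "ip \<nu> f g = (\<integral>x. f (complex_of_real x) * cnj (g (complex_of_real x)) \<partial>\<nu>)"

definition nsq :: "real measure \<Rightarrow> (complex \<Rightarrow> complex) \<Rightarrow> real" where
  "nsq \<nu> f = (\<integral>x. (cmod (f (complex_of_real x)))\<^sup>2 \<partial>\<nu>)"

lemma L2funI:
  assumes "(\<lambda>x. f (complex_of_real x)) \<in> borel_measurable \<nu>"
    "integrable \<nu> (\<lambda>x. (cmod (f (complex_of_real x)))\<^sup>2)"
  shows "f \<in> L2fun \<nu>"
  using assms by (simp add: L2fun_def)

lemma L2fun_measurable: "f \<in> L2fun \<nu> \<Longrightarrow> (\<lambda>x. f (complex_of_real x)) \<in> borel_measurable \<nu>"
  by (simp add: L2fun_def)

lemma L2fun_integrable: "f \<in> L2fun \<nu> \<Longrightarrow> integrable \<nu> (\<lambda>x. (cmod (f (complex_of_real x)))\<^sup>2)"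
  by (simp add: L2fun_def)

lemma L2fun_prod_integrable:
  assumes "f \<in> L2fun \<nu>" "g \<in> L2fun \<nu>"
  shows "integrable \<nu> (\<lambda>x. f (complex_of_real x) * cnj (g (complex_of_real x)))"
proof (rule Bochner_Integration.integrable_bound)
  note [measurable] = assms[THEN L2fun_measurable]
  show "integrable \<nu> (\<lambda>x. (cmod (f (complex_of_real x)))\<^sup>2 + (cmod (g (complex_of_real x)))\<^sup>2)"
    using assms[THEN L2fun_integrable] by (rule Bochner_Integration.integrable_add)
  have "continuous_on UNIV cnj" by (intro continuous_intros)
  then have [measurable]: "cnj \<in> borel_measurable borel" by (rule borel_measurable_continuous_onI)
  show "(\<lambda>x. f (complex_of_real x) * cnj (g (complex_of_real x))) \<in> borel_measurable \<nu>"
    by measurable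
  have "cmod a * cmod b \<le> (cmod a)\<^sup>2 + (cmod b)\<^sup>2" for a b :: complex
  proof -
    have "0 \<le> cmod a * cmod b" by simp
    then show ?thesis using sum_squares_bound[of "cmod a" "cmod b"] by linarith
  qed
  then show "AE x in \<nu>. cmod (f (complex_of_real x) * cnj (g (complex_of_real x)))
          \<le> norm ((cmod (f (complex_of_real x)))\<^sup>2 + (cmod (g (complex_of_real x)))\<^sup>2)"
    by (simp add: norm_mult)
qed

lemma L2fun_add:
  assumes "f \<in> L2fun \<nu>" "g \<in> L2fun \<nu>"
  shows "(\<lambda>z. f z + g z) \<in> L2fun \<nu>"
proof (rule L2funI)
  note [measurable] = assms[THEN L2fun_measurable]
  show "(\<lambda>x. f (complex_of_real x) + g (complex_of_real x)) \<in> borel_measurable \<nu>" by measurable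
  show "integrable \<nu> (\<lambda>x. (cmod (f (complex_of_real x) + g (complex_of_real x)))\<^sup>2)"
  proof (rule Bochner_Integration.integrable_bound)
    show "integrable \<nu> (\<lambda>x. 2 * (cmod (f (complex_of_real x)))\<^sup>2 + 2 * (cmod (g (complex_of_real x)))\<^sup>2)"
      using assms[THEN L2fun_integrable] by auto
    have "(cmod (a + b))\<^sup>2 \<le> 2 * (cmod a)\<^sup>2 + 2 * (cmod b)\<^sup>2" for a b :: complex
    proof -
      have "(cmod (a + b))\<^sup>2 \<le> (cmod a + cmod b)\<^sup>2" by (intro power_mono norm_triangle_ineq) auto
      then show ?thesis using sum_squares_bound[of "cmod a" "cmod b"] by (simp add: power2_sum)
    qed
    then show "AE x in \<nu>. norm ((cmod (f (complex_of_real x) + g (complex_of_real x)))\<^sup>2)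
          \<le> norm (2 * (cmod (f (complex_of_real x)))\<^sup>2 + 2 * (cmod (g (complex_of_real x)))\<^sup>2)"
      by simp
  qed measurable
qed

lemma L2fun_mult_bounded:
  assumes "f \<in> L2fun \<nu>" "(\<lambda>x. m (complex_of_real x)) \<in> borel_measurable \<nu>"
    "\<And>x. cmod (m (complex_of_real x)) \<le> c"
  shows "(\<lambda>z. m z * f z) \<in> L2fun \<nu>" "nsq \<nu> (\<lambda>z. m z * f z) \<le> c\<^sup>2 * nsq \<nu> f"
proof -
  note [measurable] = assms(1)[THEN L2fun_measurable] assms(2)
  have le: "(cmod (m (complex_of_real x) * f (complex_of_real x)))\<^sup>2
              \<le> c\<^sup>2 * (cmod (f (complex_of_real x)))\<^sup>2" for x
    unfolding norm_mult power_mult_distrib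
    by (intro mult_right_mono power_mono assms(3)) auto
  have int: "integrable \<nu> (\<lambda>x. c\<^sup>2 * (cmod (f (complex_of_real x)))\<^sup>2)"
    using L2fun_integrable[OF assms(1)] by simp
  have "integrable \<nu> (\<lambda>x. (cmod (m (complex_of_real x) * f (complex_of_real x)))\<^sup>2)"
    by (rule Bochner_Integration.integrable_bound[OF int]) (use le in auto)
  then show "(\<lambda>z. m z * f z) \<in> L2fun \<nu>" by (intro L2funI) auto
  show "nsq \<nu> (\<lambda>z. m z * f z) \<le> c\<^sup>2 * nsq \<nu> f"
    unfolding nsq_def Bochner_Integration.integral_mult_right_zero[symmetric]
    by (rule integral_mono) (use le int \<open>integrable \<nu> (\<lambda>x. (cmod (m (complex_of_real x) * f (complex_of_real x)))\<^sup>2)\<close> in auto)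
qed

lemma L2fun_scale: "f \<in> L2fun \<nu> \<Longrightarrow> (\<lambda>z. c * f z) \<in> L2fun \<nu>"
  by (rule L2fun_mult_bounded(1)[where m = "\<lambda>_. c" and c = "cmod c"]) auto

lemma L2fun_diff: "f \<in> L2fun \<nu> \<Longrightarrow> g \<in> L2fun \<nu> \<Longrightarrow> (\<lambda>z. f z - g z) \<in> L2fun \<nu>"
  using L2fun_add[of f \<nu> "\<lambda>z. (-1) * g z"] L2fun_scale[of g \<nu> "-1"] by simp

lemma L2fun_zero: "(\<lambda>z. 0) \<in> L2fun \<nu>"
  by (auto simp: L2fun_def)

lemma L2fun_sum: "(\<And>i. i \<in> A \<Longrightarrow> f i \<in> L2fun \<nu>) \<Longrightarrow> (\<lambda>z. \<Sum>i\<in>A. f i z) \<in> L2fun \<nu>"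
  by (induction A rule: infinite_finite_induct) (auto simp: L2fun_zero intro: L2fun_add)

lemma ip_add_left:
  "f \<in> L2fun \<nu> \<Longrightarrow> g \<in> L2fun \<nu> \<Longrightarrow> h \<in> L2fun \<nu> \<Longrightarrow> ip \<nu> (\<lambda>z. f z + g z) h = ip \<nu> f h + ip \<nu> g h"
  unfolding ip_def by (simp add: distrib_right L2fun_prod_integrable)

lemma ip_diff_left:
  "f \<in> L2fun \<nu> \<Longrightarrow> g \<in> L2fun \<nu> \<Longrightarrow> h \<in> L2fun \<nu> \<Longrightarrow> ip \<nu> (\<lambda>z. f z - g z) h = ip \<nu> f h - ip \<nu> g h"
  unfolding ip_def by (simp add: left_diff_distrib L2fun_prod_integrable)

lemma ip_scale_left: "ip \<nu> (\<lambda>z. c * f z) h = c * ip \<nu> f h"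
  unfolding ip_def by (simp add: mult.assoc)

lemma ip_commute: "ip \<nu> g f = cnj (ip \<nu> f g)"
proof -
  have "cnj (ip \<nu> f g) = (\<integral>x. cnj (f (complex_of_real x) * cnj (g (complex_of_real x))) \<partial>\<nu>)"
    unfolding ip_def by (rule Bochner_Integration.integral_cnj[symmetric])
  then show ?thesis by (simp add: ip_def mult.commute)
qed

lemma ip_add_right:
  "f \<in> L2fun \<nu> \<Longrightarrow> g \<in> L2fun \<nu> \<Longrightarrow> h \<in> L2fun \<nu> \<Longrightarrow> ip \<nu> h (\<lambda>z. f z + g z) = ip \<nu> h f + ip \<nu> h g"
  using ip_add_left[of f \<nu> g h] ip_commute[of \<nu> h] by (metis complex_cnj_add)

lemma ip_diff_right:
  "f \<in> L2fun \<nu> \<Longrightarrow> g \<in> L2fun \<nu> \<Longrightarrow> h \<in> L2fun \<nu> \<Longrightarrow> ip \<nu> h (\<lambda>z. f z - g z) = ip \<nu> h f - ip \<nu> h g"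
  using ip_diff_left[of f \<nu> g h] ip_commute[of \<nu> h] by (metis complex_cnj_diff)

lemma ip_scale_right: "ip \<nu> h (\<lambda>z. c * f z) = cnj c * ip \<nu> h f"
  using ip_scale_left[of \<nu> c f h] ip_commute[of \<nu> h] by (metis complex_cnj_mult)

lemma ip_zero_left [simp]: "ip \<nu> (\<lambda>z. 0) f = 0"
  by (simp add: ip_def)

lemma ip_sum_left:
  assumes "\<And>i. i \<in> A \<Longrightarrow> f i \<in> L2fun \<nu>" "h \<in> L2fun \<nu>"
  shows "ip \<nu> (\<lambda>z. \<Sum>i\<in>A. f i z) h = (\<Sum>i\<in>A. ip \<nu> (f i) h)"
  using assms(1)
  by (induction A rule: infinite_finite_induct) (auto simp: ip_add_left L2fun_sum assms(2))

lemma ip_sum_right: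
  assumes "\<And>i. i \<in> A \<Longrightarrow> f i \<in> L2fun \<nu>" "h \<in> L2fun \<nu>"
  shows "ip \<nu> h (\<lambda>z. \<Sum>i\<in>A. f i z) = (\<Sum>i\<in>A. ip \<nu> h (f i))"
proof -
  have "ip \<nu> h (\<lambda>z. \<Sum>i\<in>A. f i z) = cnj (\<Sum>i\<in>A. ip \<nu> (f i) h)"
    by (subst ip_commute) (simp add: ip_sum_left assms)
  also have "\<dots> = (\<Sum>i\<in>A. ip \<nu> h (f i))" by (simp flip: ip_commute)
  finally show ?thesis .
qed

lemma ip_self: "ip \<nu> f f = complex_of_real (nsq \<nu> f)"
  unfolding ip_def nsq_def
  by (simp only: integral_complex_of_real[symmetric] complex_norm_square)

lemma nsq_nonneg [simp]: "nsq \<nu> f \<ge> 0"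
  by (simp add: nsq_def)

lemma nsq_scale: "nsq \<nu> (\<lambda>z. c * f z) = (cmod c)\<^sup>2 * nsq \<nu> f"
  unfolding nsq_def by (simp add: norm_mult power_mult_distrib)

lemma nsq_add:
  assumes "f \<in> L2fun \<nu>" "g \<in> L2fun \<nu>"
  shows "nsq \<nu> (\<lambda>z. f z + g z) = nsq \<nu> f + 2 * Re (ip \<nu> f g) + nsq \<nu> g"
proof -
  have "complex_of_real (nsq \<nu> (\<lambda>z. f z + g z)) = ip \<nu> (\<lambda>z. f z + g z) (\<lambda>z. f z + g z)"
    by (simp add: ip_self)
  also have "\<dots> = ip \<nu> f f + ip \<nu> f g + (cnj (ip \<nu> f g) + ip \<nu> g g)"
    by (simp add: ip_add_left ip_add_right assms L2fun_add flip: ip_commute)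
  also have "\<dots> = complex_of_real (nsq \<nu> f + 2 * Re (ip \<nu> f g) + nsq \<nu> g)"
    by (simp add: ip_self complex_eq_iff)
  finally show ?thesis using of_real_eq_iff by blast
qed

lemma nsq_diff:
  assumes "f \<in> L2fun \<nu>" "g \<in> L2fun \<nu>"
  shows "nsq \<nu> (\<lambda>z. f z - g z) = nsq \<nu> f - 2 * Re (ip \<nu> f g) + nsq \<nu> g"
  using nsq_add[OF assms(1) L2fun_scale[OF assms(2), of "-1"]]
    ip_scale_right[of \<nu> f "-1" g] nsq_scale[of \<nu> "-1" g]
  by simp

text \<open>With c = l <f,g> and l real, the cross term in the expansion of \<open>nsq\<close> of f
  - c g is real. Since \<open>nsq \<nu> g\<close> may vanish for a nonzero \<open>g\<close>, that
  case is separate: the expansion is then linear in l, and a large l would make it negative.\<close>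

lemma nsq_cauchy_schwarz:
  assumes "f \<in> L2fun \<nu>" "g \<in> L2fun \<nu>"
  shows "(cmod (ip \<nu> f g))\<^sup>2 \<le> nsq \<nu> f * nsq \<nu> g"
proof -
  have key: "0 \<le> nsq \<nu> f - 2 * l * (cmod (ip \<nu> f g))\<^sup>2 + l\<^sup>2 * (cmod (ip \<nu> f g))\<^sup>2 * nsq \<nu> g" for l :: real
  proof -
    define c where "c = complex_of_real l * ip \<nu> f g"
    have "Re (cnj c * ip \<nu> f g) = l * (cmod (ip \<nu> f g))\<^sup>2"
      by (simp add: c_def cmod_def power2_eq_square algebra_simps)
    moreover have "(cmod c)\<^sup>2 = l\<^sup>2 * (cmod (ip \<nu> f g))\<^sup>2"
      by (simp add: c_def norm_mult power_mult_distrib)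
    moreover have "0 \<le> nsq \<nu> (\<lambda>z. f z - c * g z)" by simp
    ultimately show ?thesis
      using nsq_diff[OF assms(1) L2fun_scale[OF assms(2), of c]]
      by (simp add: nsq_scale ip_scale_right)
  qed
  show ?thesis
  proof (cases "nsq \<nu> g = 0")
    case True
    have "(cmod (ip \<nu> f g))\<^sup>2 = 0"
    proof (rule ccontr)
      assume a: "\<not> ?thesis"
      then have "nsq \<nu> f \<ge> 2 * ((nsq \<nu> f + 1) / (cmod (ip \<nu> f g))\<^sup>2) * (cmod (ip \<nu> f g))\<^sup>2"
        using key[of "(nsq \<nu> f + 1) / (cmod (ip \<nu> f g))\<^sup>2"] True by simp
      then have "nsq \<nu> f \<ge> 2 * (nsq \<nu> f + 1)" using a by simp
      moreover have "nsq \<nu> f \<ge> 0" by simp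
      ultimately show False by simp
    qed
    then show ?thesis using True by simp
  next
    case False
    then have g: "nsq \<nu> g > 0" using nsq_nonneg[of \<nu> g] by linarith
    then show ?thesis using key[of "1 / nsq \<nu> g"] by (simp add: field_simps power2_eq_square)
  qed
qed

lemma nsq_add_le:
  assumes "f \<in> L2fun \<nu>" "g \<in> L2fun \<nu>"
  shows "nsq \<nu> (\<lambda>z. f z + g z) \<le> 2 * nsq \<nu> f + 2 * nsq \<nu> g"
  using nsq_add[OF assms] nsq_diff[OF assms] nsq_nonneg[of \<nu> "\<lambda>z. f z - g z"] by linarith

lemma parallelogram:
  assumes "f \<in> L2fun \<nu>" "g \<in> L2fun \<nu>"
  shows "nsq \<nu> (\<lambda>z. f z - g z) = 2 * nsq \<nu> f + 2 * nsq \<nu> g - 4 * nsq \<nu> (\<lambda>z. (f z + g z) / 2)"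
  using nsq_add[OF assms] nsq_diff[OF assms] nsq_scale[of \<nu> "1/2" "\<lambda>z. f z + g z"]
  by (simp add: norm_divide power_divide)

lemma L2fun_iff_L2sq:
  assumes "(\<lambda>x. f (complex_of_real x)) \<in> borel_measurable \<nu>"
  shows "f \<in> L2fun \<nu> \<longleftrightarrow> L2sq \<nu> f < \<infinity>"
  using assms by (auto simp: L2fun_def L2sq_def integrable_iff_bounded)

lemma L2sq_eq_nsq: "f \<in> L2fun \<nu> \<Longrightarrow> L2sq \<nu> f = ennreal (nsq \<nu> f)"
  unfolding L2sq_def nsq_def by (intro nn_integral_eq_integral L2fun_integrable) auto

text \<open>An instance of the general inequality for Lebesgue measure on the interval, where h(Re
  z) lifts a function of a real variable to the plane.\<close>

lemma cauchy_schwarz_interval: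
  fixes f g :: "real \<Rightarrow> complex"
  assumes f: "continuous_on {a..b} f" and g: "continuous_on {a..b} g"
  shows "(cmod (integral {a..b} (\<lambda>x. f x * g x)))\<^sup>2 \<le>
           integral {a..b} (\<lambda>x. (cmod (f x))\<^sup>2) * integral {a..b} (\<lambda>x. (cmod (g x))\<^sup>2)"
proof -
  define M where "M = restrict_space (lborel :: real measure) {a..b}"
  have int: "integrable M h \<and> integral\<^sup>L M h = integral {a..b} h"
    if "continuous_on {a..b} h" for h :: "real \<Rightarrow> 'b::euclidean_space"
  proof -
    have "set_integrable lborel {a..b} h" by (rule borel_integrable_atLeastAtMost') fact
    then show ?thesis
      using set_borel_integral_eq_integral(2)[of "{a..b}" h]
      by (simp add: M_def integrable_restrict_space integral_restrict_space set_integrable_def set_lebesgue_integral_def)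
  qed
  have L2: "(\<lambda>z. h (Re z)) \<in> L2fun M" "nsq M (\<lambda>z. h (Re z)) = integral {a..b} (\<lambda>x. (cmod (h x))\<^sup>2)"
    if "continuous_on {a..b} h" for h
  proof -
    have "continuous_on {a..b} (\<lambda>x. (cmod (h x))\<^sup>2)" using that by (intro continuous_intros)
    from int[OF that] int[OF this]
    show "(\<lambda>z. h (Re z)) \<in> L2fun M" "nsq M (\<lambda>z. h (Re z)) = integral {a..b} (\<lambda>x. (cmod (h x))\<^sup>2)"
      by (auto simp: L2fun_def nsq_def)
  qed
  have g': "continuous_on {a..b} (\<lambda>x. cnj (g x))" using g by (intro continuous_intros)
  have "ip M (\<lambda>z. f (Re z)) (\<lambda>z. cnj (g (Re z))) = integral {a..b} (\<lambda>x. f x * g x)"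
    using int[OF continuous_on_mult[OF f g]] by (simp add: ip_def)
  then show ?thesis
    using nsq_cauchy_schwarz[OF L2(1)[OF f] L2(1)[OF g']] L2(2)[OF f] L2(2)[OF g'] by simp
qed

section \<open>Paley-Wiener functions\<close>


lemma entire_measurable:
  assumes "f holomorphic_on UNIV"
  shows "(\<lambda>x. f (complex_of_real x)) \<in> borel_measurable borel"
proof (rule borel_measurable_continuous_onI)
  have "continuous_on UNIV (f \<circ> complex_of_real)"
    by (intro continuous_on_compose continuous_intros
        continuous_on_subset[OF holomorphic_on_imp_continuous_on[OF assms]]) auto
  then show "continuous_on UNIV (\<lambda>x. f (complex_of_real x))" by (simp add: o_def)
qed

section \<open>Stability of exponential type and of the Paley-Wiener spaces\<close>

lemma exp_type_le_add:
  assumes "exp_type_le t f" "exp_type_le t g" shows "exp_type_le t (\<lambda>z. f z + g z)"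
  unfolding exp_type_le_def
proof (intro allI impI)
  fix \<epsilon> :: real assume e: "\<epsilon> > 0"
  obtain C D where "\<And>z. cmod (f z) \<le> C * exp ((t + \<epsilon>) * cmod z)" "\<And>z. cmod (g z) \<le> D * exp ((t + \<epsilon>) * cmod z)"
    using assms e exp_type_leD by metis
  then have "cmod (f z + g z) \<le> (C + D) * exp ((t + \<epsilon>) * cmod z)" for z
    using norm_triangle_ineq[of "f z" "g z"] by (smt (verit, best) distrib_right)
  then show "\<exists>C. \<forall>z. cmod (f z + g z) \<le> C * exp ((t + \<epsilon>) * cmod z)" by blast
qed

lemma exp_type_le_scale:
  assumes "exp_type_le t f" shows "exp_type_le t (\<lambda>z. c * f z)"
  unfolding exp_type_le_def
proof (intro allI impI)
  fix \<epsilon> :: real assume e: "\<epsilon> > 0"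
  obtain C where "\<And>z. cmod (f z) \<le> C * exp ((t + \<epsilon>) * cmod z)"
    using assms e exp_type_leD by metis
  then have "cmod (c * f z) \<le> (cmod c * C) * exp ((t + \<epsilon>) * cmod z)" for z
    by (simp add: norm_mult mult.assoc mult_left_mono)
  then show "\<exists>C. \<forall>z. cmod (c * f z) \<le> C * exp ((t + \<epsilon>) * cmod z)" by blast
qed

lemma exp_type_le_mono:
  assumes "exp_type_le s f" "s \<le> t" shows "exp_type_le t f"
  unfolding exp_type_le_def
proof (intro allI impI)
  fix \<epsilon> :: real assume e: "\<epsilon> > 0"
  obtain C where C: "C > 0" "\<And>z. cmod (f z) \<le> C * exp ((s + \<epsilon>) * cmod z)"
    using exp_type_leD[OF assms(1) e] by blast
  have "C * exp ((s + \<epsilon>) * cmod z) \<le> C * exp ((t + \<epsilon>) * cmod z)" for z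
    using C assms(2) by (intro mult_left_mono) (auto intro: mult_right_mono)
  then show "\<exists>C. \<forall>z. cmod (f z) \<le> C * exp ((t + \<epsilon>) * cmod z)" using C(2) order_trans by blast
qed

lemma norm_exp_i_real: "cmod (exp (\<i> * complex_of_real c * z)) = exp (- c * Im z)"
  by simp

lemma exp_type_le_exp_mult:
  assumes "exp_type_le t f" shows "exp_type_le (t + \<bar>c\<bar>) (\<lambda>z. exp (\<i> * complex_of_real c * z) * f z)"
  unfolding exp_type_le_def
proof (intro allI impI)
  fix \<epsilon> :: real assume e: "\<epsilon> > 0"
  obtain C where C: "C > 0" "\<And>z. cmod (f z) \<le> C * exp ((t + \<epsilon>) * cmod z)"
    using exp_type_leD[OF assms e] by blast
  have "cmod (exp (\<i> * complex_of_real c * z) * f z) \<le> C * exp ((t + \<bar>c\<bar> + \<epsilon>) * cmod z)" for z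
  proof -
    have "- c * Im z \<le> \<bar>c\<bar> * \<bar>Im z\<bar>" by (metis abs_ge_minus_self abs_mult mult_minus_left)
    also have "\<dots> \<le> \<bar>c\<bar> * cmod z" by (intro mult_left_mono abs_Im_le_cmod) auto
    finally have "cmod (exp (\<i> * complex_of_real c * z)) \<le> exp (\<bar>c\<bar> * cmod z)"
      unfolding norm_exp_i_real by simp
    then have "cmod (exp (\<i> * complex_of_real c * z) * f z) \<le> exp (\<bar>c\<bar> * cmod z) * (C * exp ((t + \<epsilon>) * cmod z))"
      unfolding norm_mult using C by (intro mult_mono) auto
    also have "\<dots> = C * exp ((t + \<bar>c\<bar> + \<epsilon>) * cmod z)"
      by (simp add: algebra_simps flip: exp_add)
    finally show ?thesis .
  qed
  then show "\<exists>C. \<forall>z. cmod (exp (\<i> * complex_of_real c * z) * f z) \<le> C * exp ((t + \<bar>c\<bar> + \<epsilon>) * cmod z)" by blast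
qed

lemma exp_type_le_translate:
  assumes "exp_type_le t f" "t \<ge> 0" shows "exp_type_le t (\<lambda>z. f (z + w))"
  unfolding exp_type_le_def
proof (intro allI impI)
  fix \<epsilon> :: real assume e: "\<epsilon> > 0"
  obtain C where C: "C > 0" "\<And>z. cmod (f z) \<le> C * exp ((t + \<epsilon>) * cmod z)"
    using exp_type_leD[OF assms(1) e] by blast
  have "cmod (f (z + w)) \<le> (C * exp ((t + \<epsilon>) * cmod w)) * exp ((t + \<epsilon>) * cmod z)" for z
  proof -
    have "(t + \<epsilon>) * cmod (z + w) \<le> (t + \<epsilon>) * (cmod w + cmod z)"
      using assms(2) e norm_triangle_ineq[of z w] by (intro mult_left_mono) auto
    then have "C * exp ((t + \<epsilon>) * cmod (z + w)) \<le> C * exp ((t + \<epsilon>) * (cmod w + cmod z))"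
      using C by (intro mult_left_mono) auto
    then show ?thesis using C(2)[of "z + w"] by (simp add: distrib_left exp_add mult.assoc)
  qed
  then show "\<exists>C. \<forall>z. cmod (f (z + w)) \<le> C * exp ((t + \<epsilon>) * cmod z)" by blast
qed

lemma holomorphic_translate: "f holomorphic_on UNIV \<Longrightarrow> (\<lambda>z. f (z + w)) holomorphic_on UNIV"
  using holomorphic_on_compose_gen[of "\<lambda>z. z + w" UNIV f UNIV]
  by (simp add: o_def holomorphic_on_add holomorphic_on_ident holomorphic_on_const)

lemma PW_holomorphic: "f \<in> PW t \<Longrightarrow> f holomorphic_on UNIV"
  by (simp add: PW_def)

lemma PW_exp_type: "f \<in> PW t \<Longrightarrow> exp_type_le t f"
  by (simp add: PW_def)

lemma PW_L2fun: "f \<in> PW t \<Longrightarrow> f \<in> L2fun lborel"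
  by (subst L2fun_iff_L2sq) (auto simp: PW_def)

lemma PWI:
  assumes "f holomorphic_on UNIV" "exp_type_le t f" "f \<in> L2fun lborel"
  shows "f \<in> PW t"
  using assms L2fun_iff_L2sq[of f lborel] entire_measurable[OF assms(1)]
  by (simp add: PW_def)

lemma PW_add: "f \<in> PW t \<Longrightarrow> g \<in> PW t \<Longrightarrow> (\<lambda>z. f z + g z) \<in> PW t"
  by (intro PWI holomorphic_intros exp_type_le_add L2fun_add)
     (auto intro: PW_holomorphic PW_exp_type PW_L2fun)

lemma PW_scale: "f \<in> PW t \<Longrightarrow> (\<lambda>z. c * f z) \<in> PW t"
  by (intro PWI holomorphic_intros exp_type_le_scale L2fun_scale)
     (auto intro: PW_holomorphic PW_exp_type PW_L2fun)

lemma PW_diff: "f \<in> PW t \<Longrightarrow> g \<in> PW t \<Longrightarrow> (\<lambda>z. f z - g z) \<in> PW t"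
  using PW_add[of f t "\<lambda>z. (-1) * g z"] PW_scale[of g t "-1"] by simp

lemma PW_mono: "f \<in> PW s \<Longrightarrow> s \<le> t \<Longrightarrow> f \<in> PW t"
  by (intro PWI) (auto intro: PW_holomorphic PW_exp_type PW_L2fun exp_type_le_mono)

lemma L2fun_exp_mult:
  assumes "f \<in> L2fun \<nu>" "sets \<nu> = sets borel"
  shows "(\<lambda>z. exp (\<i> * complex_of_real c * z) * f z) \<in> L2fun \<nu>"
proof (rule L2fun_mult_bounded(1)[OF assms(1), where c = 1])
  have "(\<lambda>z. exp (\<i> * complex_of_real c * z)) holomorphic_on UNIV" by (intro holomorphic_intros)
  from entire_measurable[OF this]
  show "(\<lambda>x. exp (\<i> * complex_of_real c * complex_of_real x)) \<in> borel_measurable \<nu>"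
    using measurable_cong_sets[OF assms(2) refl] by blast
qed (simp add: norm_exp_i_real)

text \<open>The factor has modulus 1 on the real line, so spectra may be translated without changing
  inner products, for every measure.\<close>

lemma ip_exp_mult:
  "ip \<nu> (\<lambda>z. exp (\<i> * complex_of_real c * z) * f z) (\<lambda>z. exp (\<i> * complex_of_real c * z) * g z) = ip \<nu> f g"
proof -
  have "exp (\<i> * complex_of_real c * complex_of_real x) * a * cnj (exp (\<i> * complex_of_real c * complex_of_real x) * b)
      = a * cnj b" for x a b
  proof -
    have "exp (\<i> * complex_of_real c * complex_of_real x) * cnj (exp (\<i> * complex_of_real c * complex_of_real x)) = 1"
      by (subst complex_norm_square[symmetric]) (simp add: norm_exp_i_real)
    then show ?thesis
      by (metis (no_types, lifting) complex_cnj_mult mult.assoc mult.left_commute mult.right_neutral)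
  qed
  then show ?thesis by (simp only: ip_def)
qed

lemma nsq_exp_mult: "nsq \<nu> (\<lambda>z. exp (\<i> * complex_of_real c * z) * f z) = nsq \<nu> f"
  using ip_exp_mult[of \<nu> c f f] by (simp only: ip_self of_real_eq_iff)

lemma PW_exp_mult: "f \<in> PW t \<Longrightarrow> t + \<bar>c\<bar> \<le> s \<Longrightarrow> (\<lambda>z. exp (\<i> * complex_of_real c * z) * f z) \<in> PW s"
  by (rule PW_mono[of _ "t + \<bar>c\<bar>"], intro PWI exp_type_le_exp_mult L2fun_exp_mult holomorphic_intros)
     (auto intro: PW_holomorphic PW_exp_type PW_L2fun)

lemma PW_translate:
  assumes "f \<in> PW t" "t \<ge> 0"
  shows "(\<lambda>z. f (z + complex_of_real a)) \<in> PW t"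
    and "nsq lborel (\<lambda>z. f (z + complex_of_real a)) = nsq lborel f"
proof -
  let ?g = "\<lambda>x. (cmod (f (complex_of_real x)))\<^sup>2"
  have "(\<lambda>x. ?g (a + 1 * x)) = (\<lambda>x. (cmod (f (complex_of_real x + complex_of_real a)))\<^sup>2)"
    by (simp add: add.commute)
  then show eq: "nsq lborel (\<lambda>z. f (z + complex_of_real a)) = nsq lborel f"
    using lborel_integral_real_affine[of 1 ?g a] by (simp add: nsq_def)
  have "integrable lborel (\<lambda>x. ?g (a + 1 * x))"
    using lborel_integrable_real_affine_iff[of 1 ?g a] L2fun_integrable[OF PW_L2fun[OF assms(1)]] by simp
  then have "(\<lambda>z. f (z + complex_of_real a)) \<in> L2fun lborel"
    using entire_measurable[OF holomorphic_translate[OF PW_holomorphic[OF assms(1)], of "complex_of_real a"]]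
    by (auto simp: L2fun_def add.commute)
  then show "(\<lambda>z. f (z + complex_of_real a)) \<in> PW t"
    by (intro PWI holomorphic_translate exp_type_le_translate assms PW_holomorphic[OF assms(1)] PW_exp_type[OF assms(1)])
qed

section \<open>From the real line to horizontal lines and to points\<close>

lemma integral_interval_le_nsq:
  assumes "f \<in> PW t"
  shows "integral {a..b} (\<lambda>x. (cmod (f (complex_of_real x)))\<^sup>2) \<le> nsq lborel f"
proof -
  let ?g = "\<lambda>x. (cmod (f (complex_of_real x)))\<^sup>2"
  have int: "integrable lborel ?g" by (rule L2fun_integrable[OF PW_L2fun[OF assms]])
  then have "set_integrable lborel {a..b} ?g"
    unfolding set_integrable_def by (intro integrable_mult_indicator) auto
  from set_borel_integral_eq_integral(2)[OF this] this
  have "integral {a..b} ?g = (LINT x:{a..b}|lborel. ?g x)" "integrable lborel (\<lambda>x. indicat_real {a..b} x *\<^sub>R ?g x)"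
    unfolding set_integrable_def by simp_all
  then show ?thesis unfolding nsq_def set_lebesgue_integral_def
    by (auto intro!: integral_mono int simp: indicator_def)
qed

text \<open>Pairing \<open>f\<close> with its own restriction to the line \<open>Im z = y\<close> turns the \<open>L\<^sup>2\<close> bound
  on that line into a pointwise Phragmen-Lindelof bound.\<close>

lemma PW_line_bound:
  assumes f: "f \<in> PW t" and t: "t \<ge> 0"
  shows "integral {-R..R} (\<lambda>u. (cmod (f (\<i> * complex_of_real y + complex_of_real u)))\<^sup>2)
           \<le> exp (2 * t * \<bar>y\<bar>) * nsq lborel f"
proof -
  define N where "N = nsq lborel f"
  define m where "m = integral {-R..R} (\<lambda>u. (cmod (f (\<i> * complex_of_real y + complex_of_real u)))\<^sup>2)"
  define \<Phi> where "\<Phi> = (\<lambda>z. integral {-R..R} (\<lambda>u. f (z + complex_of_real u) * cnj (f (\<i> * complex_of_real y + complex_of_real u))))"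
  have hol: "f holomorphic_on UNIV" by (rule PW_holomorphic[OF f])
  have cf: "continuous_on UNIV f" by (rule holomorphic_on_imp_continuous_on[OF hol])
  have cfl: "continuous_on A (\<lambda>u. f (z + complex_of_real u))" for z A
    by (rule continuous_on_compose2[OF cf]) (auto intro!: continuous_intros)
  have m0: "m \<ge> 0" unfolding m_def
    by (intro integral_nonneg integrable_continuous_real continuous_intros cfl) auto
  have N0: "N \<ge> 0" by (simp add: N_def)
  have hol\<Phi>: "\<Phi> holomorphic_on UNIV"
  proof -
    have "(\<lambda>z. integral (cbox (-R) R) (\<lambda>u. f (z + complex_of_real u) * cnj (f (\<i> * complex_of_real y + complex_of_real u)))) holomorphic_on UNIV"
    proof (rule leibniz_rule_holomorphic[where fx = "\<lambda>z u. deriv f (z + complex_of_real u) * cnj (f (\<i> * complex_of_real y + complex_of_real u))"])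
      fix z :: complex and u :: real
      have "(f has_field_derivative deriv f (z + complex_of_real u)) (at (z + complex_of_real u))"
        using hol by (simp add: holomorphic_derivI)
      then show "((\<lambda>z. f (z + complex_of_real u) * cnj (f (\<i> * complex_of_real y + complex_of_real u))) has_field_derivative
            deriv f (z + complex_of_real u) * cnj (f (\<i> * complex_of_real y + complex_of_real u))) (at z within UNIV)"
        by (auto intro!: derivative_eq_intros DERIV_chain2[where f = f])
    next
      show "(\<lambda>u. f (z + complex_of_real u) * cnj (f (\<i> * complex_of_real y + complex_of_real u))) integrable_on cbox (-R) R" for z
        by (intro integrable_continuous continuous_intros cfl)
    next
      have cd: "continuous_on UNIV (deriv f)"
        by (intro holomorphic_on_imp_continuous_on holomorphic_deriv[OF hol]) auto
      show "continuous_on (UNIV \<times> cbox (-R) R) (\<lambda>(z, u). deriv f (z + complex_of_real u) * cnj (f (\<i> * complex_of_real y + complex_of_real u)))"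
        unfolding case_prod_beta
        by (intro continuous_intros continuous_on_compose2[OF cd] continuous_on_compose2[OF cf]) auto
    qed auto
    then show ?thesis by (simp add: \<Phi>_def)
  qed
  obtain A where A: "A > 0" "\<And>u. u \<in> {-R..R} \<Longrightarrow> cmod (f (\<i> * complex_of_real y + complex_of_real u)) \<le> A"
  proof -
    have "compact ((\<lambda>u. f (\<i> * complex_of_real y + complex_of_real u)) ` {-R..R})"
      by (intro compact_continuous_image cfl) auto
    then obtain A where "A > 0" "\<forall>x\<in>((\<lambda>u. f (\<i> * complex_of_real y + complex_of_real u)) ` {-R..R}). norm x \<le> A"
      using compact_imp_bounded bounded_pos by blast
    then show ?thesis using that by auto
  qed
  have ty: "exp_type_le t \<Phi>"
    unfolding exp_type_le_def
  proof (intro allI impI)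
    fix \<epsilon> :: real assume e: "\<epsilon> > 0"
    obtain C where C: "C > 0" "\<And>z. cmod (f z) \<le> C * exp ((t + \<epsilon>) * cmod z)"
      using exp_type_leD[OF PW_exp_type[OF f] e] by blast
    have "cmod (\<Phi> z) \<le> (C * exp ((t + \<epsilon>) * \<bar>R\<bar>) * A * measure lborel (cbox (-R) R)) * exp ((t + \<epsilon>) * cmod z)" for z
    proof -
      have "cmod (integral (cbox (-R) R) (\<lambda>u. f (z + complex_of_real u) * cnj (f (\<i> * complex_of_real y + complex_of_real u))))
          \<le> (C * exp ((t + \<epsilon>) * (cmod z + \<bar>R\<bar>)) * A) * measure lborel (cbox (-R) R)"
      proof (rule integrable_bound)
        show "0 \<le> C * exp ((t + \<epsilon>) * (cmod z + \<bar>R\<bar>)) * A" using C A by simp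
        show "(\<lambda>u. f (z + complex_of_real u) * cnj (f (\<i> * complex_of_real y + complex_of_real u))) integrable_on cbox (-R) R"
          by (intro integrable_continuous continuous_intros cfl)
        fix u assume u: "u \<in> cbox (-R) R"
        have "cmod (z + complex_of_real u) \<le> cmod z + \<bar>R\<bar>"
          using norm_triangle_ineq[of z "complex_of_real u"] u by auto
        then have "(t + \<epsilon>) * cmod (z + complex_of_real u) \<le> (t + \<epsilon>) * (cmod z + \<bar>R\<bar>)"
          using t e by (intro mult_left_mono) auto
        then have "C * exp ((t + \<epsilon>) * cmod (z + complex_of_real u)) \<le> C * exp ((t + \<epsilon>) * (cmod z + \<bar>R\<bar>))"
          using C by (intro mult_left_mono) auto
        then have "cmod (f (z + complex_of_real u)) \<le> C * exp ((t + \<epsilon>) * (cmod z + \<bar>R\<bar>))"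
          using C(2) order_trans by blast
        then show "cmod (f (z + complex_of_real u) * cnj (f (\<i> * complex_of_real y + complex_of_real u)))
             \<le> C * exp ((t + \<epsilon>) * (cmod z + \<bar>R\<bar>)) * A"
          unfolding norm_mult using A(2)[of u] u C by (intro mult_mono) auto
      qed
      then show ?thesis by (simp add: \<Phi>_def distrib_left exp_add mult_ac)
    qed
    then show "\<exists>C. \<forall>z. cmod (\<Phi> z) \<le> C * exp ((t + \<epsilon>) * cmod z)" by blast
  qed
  have real: "cmod (\<Phi> (complex_of_real x)) \<le> sqrt (N * m)" for x
  proof -
    have "(cmod (\<Phi> (complex_of_real x)))\<^sup>2 \<le> integral {-R..R} (\<lambda>u. (cmod (f (complex_of_real x + complex_of_real u)))\<^sup>2)
       * integral {-R..R} (\<lambda>u. (cmod (cnj (f (\<i> * complex_of_real y + complex_of_real u))))\<^sup>2)"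
      unfolding \<Phi>_def by (intro cauchy_schwarz_interval continuous_intros cfl)
    also have "\<dots> \<le> N * m"
    proof (rule mult_mono)
      show "integral {-R..R} (\<lambda>u. (cmod (f (complex_of_real x + complex_of_real u)))\<^sup>2) \<le> N"
        using integral_interval_le_nsq[OF PW_translate(1)[OF f t, of x], of "-R" R]
        by (simp add: N_def PW_translate(2)[OF f t] add.commute)
    qed (use m0 N0 in \<open>auto simp: m_def\<close>)
    finally show ?thesis by (simp add: real_le_rsqrt)
  qed
  have \<Phi>m: "\<Phi> (\<i> * complex_of_real y) = complex_of_real m"
  proof -
    have "\<Phi> (\<i> * complex_of_real y) = integral {-R..R} (\<lambda>u. complex_of_real ((cmod (f (\<i> * complex_of_real y + complex_of_real u)))\<^sup>2))"
      unfolding \<Phi>_def complex_norm_square by simp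
    also have "\<dots> = complex_of_real m" unfolding m_def
      by (intro integral_unique has_integral_of_real integrable_integral integrable_continuous_real continuous_intros cfl)
    finally show ?thesis .
  qed
  \<comment> \<open>The strict inequality guarantees M > 0, which the Phragmen-Lindelof bound
    requires even if \<open>sqrt (N * m)\<close> is 0.\<close>
  have "m \<le> M * exp (t * \<bar>y\<bar>)" if "M > sqrt (N * m)" for M
  proof -
    have "M > 0" using that m0 N0 by (meson mult_nonneg_nonneg order_le_less_trans real_sqrt_ge_zero)
    have "cmod (\<Phi> (\<i> * complex_of_real y)) \<le> M * exp (t * \<bar>Im (\<i> * complex_of_real y)\<bar>)"
      by (rule phragmen_lindelof_exp_type[OF hol\<Phi> ty t \<open>M > 0\<close>]) (rule order_trans[OF real less_imp_le[OF that]])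
    then show ?thesis using m0 by (simp add: \<Phi>m)
  qed
  then have "m / exp (t * \<bar>y\<bar>) \<le> M" if "M > sqrt (N * m)" for M
    using that by (simp add: pos_divide_le_eq)
  then have "m / exp (t * \<bar>y\<bar>) \<le> sqrt (N * m)" by (rule dense_ge)
  then have "m \<le> sqrt (N * m) * exp (t * \<bar>y\<bar>)" by (simp add: pos_divide_le_eq)
  \<comment> \<open>\<open>\<Phi>\<close> takes the value \<open>m\<close> at \<i>y but is bounded
    by \<open>sqrt (N * m)\<close> on the real line; after squaring, one factor \<open>m\<close>
    cancels and a bound linear in \<open>N\<close> remains.\<close>
  then have "m\<^sup>2 \<le> (sqrt (N * m) * exp (t * \<bar>y\<bar>))\<^sup>2" using m0 by (intro power_mono)
  also have "\<dots> = (N * m) * exp (2 * t * \<bar>y\<bar>)"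
    using m0 N0 by (simp add: power_mult_distrib flip: exp_double)
  finally have "m * m \<le> (exp (2 * t * \<bar>y\<bar>) * N) * m" by (simp add: power2_eq_square mult_ac)
  then have "m \<le> exp (2 * t * \<bar>y\<bar>) * N"
    using m0 N0 by (cases "m = 0") auto
  then show ?thesis by (simp add: m_def N_def)
qed

lemma contour_integral_linepath_horizontal:
  assumes "a < b"
  shows "contour_integral (linepath (Complex a y) (Complex b y)) g = integral {a..b} (\<lambda>x. g (Complex x y))"
proof -
  have "linepath (Complex a y) (Complex b y) x = linepath (complex_of_real a) (complex_of_real b) x + \<i> * complex_of_real y" for x
    by (simp add: linepath_def complex_eq_iff algebra_simps)
  then have "contour_integral (linepath (Complex a y) (Complex b y)) g
    = contour_integral (linepath (complex_of_real a) (complex_of_real b)) (\<lambda>z. g (z + \<i> * complex_of_real y))"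
    by (simp add: contour_integral_integral Complex_eq)
  also have "\<dots> = integral {a..b} (\<lambda>x. g (complex_of_real x + \<i> * complex_of_real y))"
    using assms by (subst contour_integral_linepath_Reals_eq) auto
  finally show ?thesis by (simp add: Complex_eq mult.commute)
qed

lemma integral_inverse_one_plus_square_le:
  assumes "R \<ge> 0"
  shows "(\<lambda>x::real. 1 / (1 + x\<^sup>2)) integrable_on {-R..R}"
    and "integral {-R..R} (\<lambda>x::real. 1 / (1 + x\<^sup>2)) \<le> pi"
proof -
  have "((\<lambda>x::real. inverse (1 + x\<^sup>2)) has_integral (arctan R - arctan (-R))) {-R..R}"
    using assms
    by (intro fundamental_theorem_of_calculus)
       (auto intro!: derivative_eq_intros simp: has_real_derivative_iff_has_vector_derivative[symmetric])
  then have h: "((\<lambda>x::real. 1 / (1 + x\<^sup>2)) has_integral (arctan R - arctan (-R))) {-R..R}"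
    by (simp add: inverse_eq_divide)
  then show "(\<lambda>x::real. 1 / (1 + x\<^sup>2)) integrable_on {-R..R}" by blast
  show "integral {-R..R} (\<lambda>x::real. 1 / (1 + x\<^sup>2)) \<le> pi"
    using integral_unique[OF h] arctan_bounded[of R] arctan_bounded[of "-R"] by linarith
qed

text \<open>Cauchy's formula for f(w) exp(-w^2) over the rectangle with corners +-R +- \<i>. The
  Gaussian is 1 at 0 and overwhelms the exponential growth of \<open>f\<close> on the vertical sides
  as R grows; on the horizontal sides it stays bounded, so Cauchy-Schwarz against 1/w
  suffices.\<close>

lemma entire_value_le_line_L2:
  assumes hol: "f holomorphic_on UNIV" and ty: "exp_type_le t f" and t: "t \<ge> 0"
    and N: "\<And>\<eta> R. \<bar>\<eta>\<bar> = 1 \<Longrightarrow> integral {-R..R} (\<lambda>u. (cmod (f (Complex u \<eta>)))\<^sup>2) \<le> N"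
  shows "(cmod (f 0))\<^sup>2 \<le> exp 2 * N"
proof -
  define G where "G = (\<lambda>w. f w * exp (- w\<^sup>2) / (w - 0))"
  obtain C where C: "C > 0" "\<And>z. cmod (f z) \<le> C * exp ((t + 1) * cmod z)"
    using exp_type_leD[OF ty, of 1] by auto
  have cf: "continuous_on UNIV f" by (rule holomorphic_on_imp_continuous_on[OF hol])
  have N0: "N \<ge> 0" using N[of 1 0] by simp
  have nexp: "cmod (exp (- w\<^sup>2)) = exp ((Im w)\<^sup>2 - (Re w)\<^sup>2)" for w
    by (simp add: power2_eq_square)
  have cont: "continuous_on A G" if "0 \<notin> A" for A
    unfolding G_def using that
    by (intro continuous_intros continuous_on_subset[OF cf]) auto
  \<comment> \<open>On |Im w| = 1 the squared modulus of exp(-w^2)/w is at most exp 2 / (1 + x^2),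
    whose integral is at most exp 2 times pi.\<close>
  have horiz: "cmod (integral {-R..R} (\<lambda>x. G (Complex x \<eta>))) \<le> sqrt (N * (exp 2 * pi))"
    if eta: "\<bar>\<eta>\<bar> = 1" and R: "R \<ge> 0" for R \<eta>
  proof -
    have nz: "Complex x \<eta> \<noteq> 0" for x using eta by (auto simp: complex_eq_iff)
    have cC: "continuous_on A (\<lambda>x. Complex x \<eta>)" for A
      unfolding Complex_eq by (intro continuous_intros)
    have c1: "continuous_on {-R..R} (\<lambda>x. f (Complex x \<eta>))"
      by (rule continuous_on_compose2[OF cf cC]) auto
    have c2: "continuous_on {-R..R} (\<lambda>x. exp (- (Complex x \<eta>)\<^sup>2) / Complex x \<eta>)"
      by (intro continuous_intros cC) (use nz in auto)
    have "(cmod (integral {-R..R} (\<lambda>x. f (Complex x \<eta>) * (exp (- (Complex x \<eta>)\<^sup>2) / Complex x \<eta>))))\<^sup>2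
       \<le> integral {-R..R} (\<lambda>x. (cmod (f (Complex x \<eta>)))\<^sup>2) * integral {-R..R} (\<lambda>x. (cmod (exp (- (Complex x \<eta>)\<^sup>2) / Complex x \<eta>))\<^sup>2)"
      by (rule cauchy_schwarz_interval[OF c1 c2])
    also have "\<dots> \<le> N * (exp 2 * pi)"
    proof (rule mult_mono)
      have "integral {-R..R} (\<lambda>x. (cmod (exp (- (Complex x \<eta>)\<^sup>2) / Complex x \<eta>))\<^sup>2)
         \<le> integral {-R..R} (\<lambda>x. exp 2 * (1 / (1 + x\<^sup>2)))"
      proof (rule integral_le)
        show "(\<lambda>x. (cmod (exp (- (Complex x \<eta>)\<^sup>2) / Complex x \<eta>))\<^sup>2) integrable_on {-R..R}"
          by (intro integrable_continuous_real continuous_intros cC) (use nz in auto)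
        show "(\<lambda>x. exp 2 * (1 / (1 + x\<^sup>2))) integrable_on {-R..R}"
          by (intro integrable_on_mult_right integral_inverse_one_plus_square_le R)
        fix x
        have e1: "\<eta>\<^sup>2 = 1" using eta by (metis abs_1 power2_abs power_one)
        have "(cmod (exp (- (Complex x \<eta>)\<^sup>2)))\<^sup>2 = exp (2 * (1 - x\<^sup>2))"
          unfolding nexp by (simp add: e1 flip: exp_double)
        also have "\<dots> \<le> exp 2" by simp
        finally have "(cmod (exp (- (Complex x \<eta>)\<^sup>2)))\<^sup>2 \<le> exp 2" .
        moreover have "(cmod (Complex x \<eta>))\<^sup>2 = 1 + x\<^sup>2" by (simp add: cmod_power2 e1)
        ultimately show "(cmod (exp (- (Complex x \<eta>)\<^sup>2) / Complex x \<eta>))\<^sup>2 \<le> exp 2 * (1 / (1 + x\<^sup>2))"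
          by (simp add: norm_divide power_divide divide_right_mono)
      qed
      also have "\<dots> \<le> exp 2 * pi"
        using integral_inverse_one_plus_square_le[OF R] by (subst integral_mult_right) auto
      finally show "integral {-R..R} (\<lambda>x. (cmod (exp (- (Complex x \<eta>)\<^sup>2) / Complex x \<eta>))\<^sup>2) \<le> exp 2 * pi" .
    qed (use N eta N0 in \<open>auto intro!: integral_nonneg integrable_continuous_real continuous_intros c2\<close>)
    finally show ?thesis by (simp add: G_def real_le_rsqrt mult.assoc)
  qed
  define e where "e = (\<lambda>R. C * exp ((t + 1) * (R + 1) + 1 - R\<^sup>2))"
  have vert: "cmod (G w) \<le> e R" if "R \<ge> 1" "\<bar>Re w\<bar> = R" "\<bar>Im w\<bar> \<le> 1" for w R
  proof -
    have w1: "cmod w \<ge> 1" using abs_Re_le_cmod[of w] that by linarith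
    have wR: "cmod w \<le> R + 1" using cmod_le[of w] that by linarith
    have "cmod (f w) \<le> C * exp ((t + 1) * (R + 1))"
    proof -
      have "(t + 1) * cmod w \<le> (t + 1) * (R + 1)" using wR t by (intro mult_left_mono) auto
      then have "C * exp ((t + 1) * cmod w) \<le> C * exp ((t + 1) * (R + 1))" using C by simp
      then show ?thesis using C(2)[of w] by linarith
    qed
    moreover have "cmod (exp (- w\<^sup>2)) \<le> exp (1 - R\<^sup>2)"
    proof -
      have "(Im w)\<^sup>2 \<le> 1" using that(3) abs_le_square_iff[of "Im w" 1] by simp
      moreover have "(Re w)\<^sup>2 = R\<^sup>2" using that(2) by (metis power2_abs)
      ultimately show ?thesis unfolding nexp by simp
    qed
    ultimately have "cmod (f w) * cmod (exp (- w\<^sup>2)) \<le> C * exp ((t + 1) * (R + 1)) * exp (1 - R\<^sup>2)"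
      using C by (intro mult_mono) auto
    also have "\<dots> = e R" unfolding e_def by (simp add: mult.assoc flip: exp_add)
    finally have "cmod (f w) * cmod (exp (- w\<^sup>2)) / cmod w \<le> e R / 1"
      using w1 C by (intro frac_le) (auto simp: e_def)
    then show ?thesis by (simp add: G_def norm_mult norm_divide)
  qed
  have main: "2 * pi * cmod (f 0) \<le> 2 * sqrt (N * (exp 2 * pi)) + 4 * e R" if R: "R \<ge> 1" for R
  proof -
    define a1 a2 a3 a4 where "a1 = Complex (-R) (-1)" and "a2 = Complex R (-1)"
      and "a3 = Complex R 1" and "a4 = Complex (-R) 1"
    have rp: "rectpath a1 a3 = linepath a1 a2 +++ linepath a2 a3 +++ linepath a3 a4 +++ linepath a4 a1"
      by (simp add: rectpath_def Let_def a1_def a2_def a3_def a4_def)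
    have bx: "0 \<in> box a1 a3" using R by (simp add: in_box_complex_iff a1_def a3_def)
    have pi0: "0 \<notin> path_image (rectpath a1 a3)"
      using R bx by (subst path_image_rectpath_cbox_minus_box) (auto simp: a1_def a3_def)
    have "(G has_contour_integral (2 * pi * \<i> * winding_number (rectpath a1 a3) 0 * (f 0 * exp (- 0\<^sup>2)))) (rectpath a1 a3)"
      unfolding G_def
      by (rule Cauchy_integral_formula_convex_simple[where S = UNIV])
         (use pi0 in \<open>auto intro!: holomorphic_intros hol\<close>)
    then have I: "contour_integral (rectpath a1 a3) G = 2 * pi * \<i> * f 0"
      using winding_number_rectpath[OF bx] by (simp add: contour_integral_unique)
    have seg: "0 \<notin> closed_segment a1 a2" "0 \<notin> closed_segment a2 a3" "0 \<notin> closed_segment a3 a4" "0 \<notin> closed_segment a4 a1"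
      using pi0 by (auto simp: rp path_image_join)
    have gi: "G contour_integrable_on linepath a1 a2" "G contour_integrable_on linepath a2 a3"
      "G contour_integrable_on linepath a3 a4" "G contour_integrable_on linepath a4 a1"
      using seg by (auto intro!: contour_integrable_continuous_linepath cont)
    have split: "contour_integral (rectpath a1 a3) G = contour_integral (linepath a1 a2) G + contour_integral (linepath a2 a3) G
       + contour_integral (linepath a3 a4) G + contour_integral (linepath a4 a1) G"
      unfolding rp using gi by (simp add: a1_def a2_def a3_def a4_def contour_integrable_joinI)
    have e0: "e R \<ge> 0" using C by (simp add: e_def)
    have b1: "cmod (contour_integral (linepath a1 a2) G) \<le> sqrt (N * (exp 2 * pi))"
      unfolding a1_def a2_def using R horiz[of "-1" R] by (subst contour_integral_linepath_horizontal) auto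
    have b3: "cmod (contour_integral (linepath a3 a4) G) \<le> sqrt (N * (exp 2 * pi))"
    proof -
      have "contour_integral (linepath a3 a4) G = - contour_integral (linepath a4 a3) G"
        by (intro contour_integral_reverse_linepath cont seg)
      then show ?thesis unfolding a3_def a4_def using R horiz[of "1" R]
        by (simp add: contour_integral_linepath_horizontal)
    qed
    have b2: "cmod (contour_integral (linepath a2 a3) G) \<le> e R * cmod (a3 - a2)"
      using gi e0 R by (intro contour_integral_bound_linepath vert)
        (auto simp: a2_def a3_def closed_segment_same_Re closed_segment_eq_real_ivl)
    have b4: "cmod (contour_integral (linepath a4 a1) G) \<le> e R * cmod (a1 - a4)"
      using gi e0 R by (intro contour_integral_bound_linepath vert)
        (auto simp: a1_def a4_def closed_segment_same_Re closed_segment_eq_real_ivl)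
    have n: "cmod (a3 - a2) = 2" "cmod (a1 - a4) = 2"
      by (auto simp: a1_def a2_def a3_def a4_def cmod_def)
    have "2 * pi * cmod (f 0) = cmod (contour_integral (rectpath a1 a3) G)"
      unfolding I by (simp add: norm_mult)
    also have "\<dots> \<le> cmod (contour_integral (linepath a1 a2) G) + cmod (contour_integral (linepath a2 a3) G)
       + cmod (contour_integral (linepath a3 a4) G) + cmod (contour_integral (linepath a4 a1) G)"
      unfolding split by (intro order_trans[OF norm_triangle_ineq] add_mono order_refl)
    finally show ?thesis using b1 b2 b3 b4 n by simp
  qed
  have "(e \<longlongrightarrow> 0) at_top"
  proof (rule tendsto_sandwich[OF _ _ tendsto_const])
    show "\<forall>\<^sub>F R in at_top. 0 \<le> e R" using C by (simp add: e_def)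
    show "\<forall>\<^sub>F R in at_top. e R \<le> C * exp (t + 2) * exp (- R)"
    proof (rule eventually_at_top_linorderI[of "t + 2"])
      fix R assume R: "R \<ge> t + 2"
      have "R * (R - (t + 1)) \<ge> R * 1" using R t by (intro mult_left_mono) auto
      then have "(t + 1) * (R + 1) + 1 - R\<^sup>2 \<le> t + 2 + - R" by (simp add: power2_eq_square algebra_simps)
      then show "e R \<le> C * exp (t + 2) * exp (- R)" using C unfolding e_def mult.assoc exp_add[symmetric] by simp
    qed
    have "((\<lambda>R::real. C * exp (t + 2) * exp (- R)) \<longlongrightarrow> C * exp (t + 2) * 0) at_top"
      by (intro tendsto_intros filterlim_compose[OF exp_at_bot] filterlim_uminus_at_bot_at_top)
    then show "((\<lambda>R::real. C * exp (t + 2) * exp (- R)) \<longlongrightarrow> 0) at_top" by simp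
  qed
  then have "((\<lambda>R. 2 * sqrt (N * (exp 2 * pi)) + 4 * e R) \<longlongrightarrow> 2 * sqrt (N * (exp 2 * pi)) + 4 * 0) at_top"
    by (intro tendsto_intros)
  then have "2 * pi * cmod (f 0) \<le> 2 * sqrt (N * (exp 2 * pi)) + 4 * 0"
    by (rule tendsto_lowerbound) (auto intro!: eventually_at_top_linorderI[of 1] main)
  then have "pi * cmod (f 0) \<le> sqrt (N * (exp 2 * pi))" by simp
  then have "(pi * cmod (f 0))\<^sup>2 \<le> N * (exp 2 * pi)"
    using N0 by (metis mult_nonneg_nonneg norm_ge_zero pi_ge_zero real_sqrt_le_iff real_sqrt_unique)
  then have "pi * (cmod (f 0))\<^sup>2 \<le> exp 2 * N" by (simp add: power_mult_distrib power2_eq_square mult_ac)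
  moreover have "1 * (cmod (f 0))\<^sup>2 \<le> pi * (cmod (f 0))\<^sup>2" using pi_gt3 by (intro mult_right_mono) auto
  ultimately show ?thesis by linarith
qed

text \<open>\<open>entire_value_le_line_L2\<close> is applied with z moved to 0. The two lines at
  distance 1 from z have height at most |Im z| + 1, where \<open>PW_line_bound\<close> controls the
  norm; this extra height contributes exp(2t), Cauchy's formula the factor exp 2.\<close>

lemma PW_pointwise_bound:
  assumes f: "f \<in> PW t" and t: "t \<ge> 0"
  shows "(cmod (f z))\<^sup>2 \<le> exp (2 + 2 * t) * exp (2 * t * \<bar>Im z\<bar>) * nsq lborel f"
proof -
  have "(cmod ((\<lambda>w. f (w + z)) 0))\<^sup>2 \<le> exp 2 * (exp (2 * t * (\<bar>Im z\<bar> + 1)) * nsq lborel f)"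
  proof (rule entire_value_le_line_L2)
    show "(\<lambda>w. f (w + z)) holomorphic_on UNIV" by (rule holomorphic_translate[OF PW_holomorphic[OF f]])
    show "exp_type_le t (\<lambda>w. f (w + z))" by (rule exp_type_le_translate[OF PW_exp_type[OF f] t])
    fix \<eta> R :: real assume "\<bar>\<eta>\<bar> = 1"
    then have le: "\<bar>\<eta> + Im z\<bar> \<le> \<bar>Im z\<bar> + 1" by linarith
    have "(\<lambda>u. f (Complex u \<eta> + z)) = (\<lambda>u. f (\<i> * complex_of_real (\<eta> + Im z) + complex_of_real u + complex_of_real (Re z)))"
      by (intro ext arg_cong[of _ _ f]) (simp add: complex_eq_iff)
    then have "integral {-R..R} (\<lambda>u. (cmod (f (Complex u \<eta> + z)))\<^sup>2) \<le> exp (2 * t * \<bar>\<eta> + Im z\<bar>) * nsq lborel f"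
      using PW_line_bound[OF PW_translate(1)[OF f t, of "Re z"] t, of R "\<eta> + Im z"]
      unfolding PW_translate(2)[OF f t] by (simp add: fun_eq_iff)
    also have "\<dots> \<le> exp (2 * t * (\<bar>Im z\<bar> + 1)) * nsq lborel f"
      using le t by (intro mult_right_mono) (auto intro!: mult_left_mono)
    finally show "integral {-R..R} (\<lambda>u. (cmod (f (Complex u \<eta> + z)))\<^sup>2) \<le> exp (2 * t * (\<bar>Im z\<bar> + 1)) * nsq lborel f" .
  qed (rule t)
  also have "exp 2 * (exp (2 * t * (\<bar>Im z\<bar> + 1)) * nsq lborel f) = exp (2 + 2 * t) * exp (2 * t * \<bar>Im z\<bar>) * nsq lborel f"
    by (simp add: distrib_left exp_add)
  finally show ?thesis by simp
qed

section \<open>Completeness and reproducing kernels\<close>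


lemma integrable_inverse_one_plus_square: "integrable lborel (\<lambda>x::real. 1 / (1 + x\<^sup>2))"
proof -
  let ?h = "\<lambda>x::real. 1 / (1 + x\<^sup>2) * indicator {0..} x"
  have "(\<integral>\<^sup>+ x. ennreal (1 / (1 + x\<^sup>2)) * indicator {0..} x \<partial>lborel) = ennreal (pi/2 - arctan 0)"
    by (rule nn_integral_FTC_atLeast[where F = arctan])
       (auto intro!: derivative_eq_intros tendsto_arctan_at_top simp: inverse_eq_divide)
  moreover have "ennreal (?h x) = ennreal (1 / (1 + x\<^sup>2)) * indicator {0..} x" for x
    by (auto simp: indicator_def)
  ultimately have "(\<integral>\<^sup>+ x. ennreal (?h x) \<partial>lborel) < \<infinity>"
    by (simp only: infinity_ennreal_def ennreal_less_top)
  then have h: "integrable lborel ?h" by (intro integrableI_nonneg) auto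
  then have h': "integrable lborel (\<lambda>x. ?h (0 + (-1) * x))"
    by (subst lborel_integrable_real_affine_iff) auto
  show ?thesis
  proof (rule Bochner_Integration.integrable_bound[OF Bochner_Integration.integrable_add[OF h h']])
    show "AE x in lborel. norm (1 / (1 + x\<^sup>2)) \<le> norm (?h x + ?h (0 + (-1) * x))"
      by (auto simp: indicator_def)
  qed auto
qed

section \<open>Divided differences and the functions sin(tz)/z\<close>

definition divdiff :: "(complex \<Rightarrow> complex) \<Rightarrow> complex \<Rightarrow> complex \<Rightarrow> complex" where
  "divdiff f w z = (if z = w then deriv f w else (f z - f w) / (z - w))"

lemma divdiff_holomorphic: "f holomorphic_on UNIV \<Longrightarrow> divdiff f w holomorphic_on UNIV"
  using pole_lemma_open[of f UNIV w] by (simp add: divdiff_def[abs_def])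

lemma divdiff_eq: "z \<noteq> w \<Longrightarrow> divdiff f w z = (f z - f w) / (z - w)"
  by (simp add: divdiff_def)

lemma divdiff_exp_type:
  assumes hol: "f holomorphic_on UNIV" and ty: "exp_type_le t f" and t: "t \<ge> 0"
  shows "exp_type_le t (divdiff f w)"
  unfolding exp_type_le_def
proof (intro allI impI)
  have "compact (divdiff f w ` cball w 1)"
    by (intro compact_continuous_image continuous_on_subset[OF holomorphic_on_imp_continuous_on[OF divdiff_holomorphic[OF hol]]]) auto
  then obtain D where D: "D > 0" "\<And>z. z \<in> cball w 1 \<Longrightarrow> cmod (divdiff f w z) \<le> D"
    using compact_imp_bounded bounded_pos by (metis imageI)
  fix \<epsilon> :: real assume e: "\<epsilon> > 0"
  obtain C where C: "C > 0" "\<And>z. cmod (f z) \<le> C * exp ((t + \<epsilon>) * cmod z)"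
    using exp_type_leD[OF ty e] by blast
  have "cmod (divdiff f w z) \<le> (C + cmod (f w) + D) * exp ((t + \<epsilon>) * cmod z)" for z
  proof -
    define E where "E = exp ((t + \<epsilon>) * cmod z)"
    have E: "E \<ge> 1" using t e by (simp add: E_def)
    have m: "(C + cmod (f w) + D) * E = C * E + cmod (f w) * E + D * E" by (simp add: distrib_right)
    have p: "C * E \<ge> 0" "cmod (f w) * E \<ge> cmod (f w)" "D * E \<ge> D" "D * E \<ge> 0"
      using E C D mult_left_mono[OF E, of "cmod (f w)"] mult_left_mono[OF E, of D] by auto
    show ?thesis
    proof (cases "z \<in> cball w 1")
      case True
      then have "cmod (divdiff f w z) \<le> D" by (rule D)
      moreover have "cmod (f w) \<ge> 0" by simp
      ultimately show ?thesis using m p unfolding E_def[symmetric] by linarith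
    next
      case False
      then have d: "cmod (z - w) \<ge> 1" by (simp add: dist_norm norm_minus_commute)
      then have "z \<noteq> w" by auto
      then have "cmod (divdiff f w z) = cmod (f z - f w) / cmod (z - w)"
        by (simp add: divdiff_eq norm_divide)
      also have "\<dots> \<le> cmod (f z - f w) / 1" using d by (intro divide_left_mono) auto
      also have "\<dots> \<le> C * E + cmod (f w)"
        using norm_triangle_ineq4[of "f z" "f w"] C(2)[of z] by (simp add: E_def)
      finally show ?thesis using m p unfolding E_def[symmetric] by linarith
    qed
  qed
  then show "\<exists>C. \<forall>z. cmod (divdiff f w z) \<le> C * exp ((t + \<epsilon>) * cmod z)" by blast
qed

text \<open>Boundedness of \<open>f\<close> on the real line makes the divided difference O(1/|x|)
  there, hence square integrable. The base point may be any complex number, so that Cauchy kernels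
  with their pole removed are covered.\<close>

lemma PW_divdiff:
  assumes hol: "f holomorphic_on UNIV" and ty: "exp_type_le t f" and t: "t \<ge> 0"
    and B: "\<And>x. cmod (f (complex_of_real x)) \<le> B"
  shows "divdiff f w \<in> PW t"
proof (rule PWI[OF divdiff_holomorphic[OF hol] divdiff_exp_type[OF hol ty t]], rule L2funI)
  have meas: "(\<lambda>x. divdiff f w (complex_of_real x)) \<in> borel_measurable borel"
    by (rule entire_measurable[OF divdiff_holomorphic[OF hol]])
  then show "(\<lambda>x. divdiff f w (complex_of_real x)) \<in> borel_measurable lborel" by simp
  have "compact (divdiff f w ` cball w 1)"
    by (intro compact_continuous_image continuous_on_subset[OF holomorphic_on_imp_continuous_on[OF divdiff_holomorphic[OF hol]]]) auto
  then obtain D where D: "D > 0" "\<And>z. z \<in> cball w 1 \<Longrightarrow> cmod (divdiff f w z) \<le> D"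
    using compact_imp_bounded bounded_pos by (metis imageI)
  define b where "b = B + cmod (f w)"
  define c where "c = 1 + (1 + cmod w)\<^sup>2"
  \<comment> \<open>Near \<open>w\<close> compactness bounds the divided difference by
    \<open>D\<close>; farther away b/|x-w| does. The inequality 1 + x^2 <= c |x-w|^2 brings the
    second case under the same integrable majorant.\<close>
  have le: "(cmod (divdiff f w (complex_of_real x)))\<^sup>2 \<le> (D\<^sup>2 + b\<^sup>2) * c * (1 / (1 + x\<^sup>2))" for x
  proof -
    let ?x = "complex_of_real x"
    have c0: "c \<ge> 0" by (simp add: c_def)
    have "(cmod (divdiff f w ?x))\<^sup>2 * (1 + x\<^sup>2) \<le> (D\<^sup>2 + b\<^sup>2) * c"
    proof (cases "?x \<in> cball w 1")
      case True
      then have "\<bar>x\<bar> \<le> 1 + cmod w"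
        using norm_triangle_ineq2[of ?x w] by (simp add: dist_norm norm_minus_commute)
      then have "1 + x\<^sup>2 \<le> c" unfolding c_def using abs_le_square_iff[of x "1 + cmod w"] by simp
      moreover have "(cmod (divdiff f w ?x))\<^sup>2 \<le> D\<^sup>2" using D(2)[OF True] by (intro power_mono) auto
      ultimately have "(cmod (divdiff f w ?x))\<^sup>2 * (1 + x\<^sup>2) \<le> (D\<^sup>2 + b\<^sup>2) * c"
        using c0 by (intro mult_mono) (auto intro: order_trans)
      then show ?thesis .
    next
      case False
      then have d: "cmod (?x - w) \<ge> 1" by (simp add: dist_norm norm_minus_commute)
      then have ne: "?x \<noteq> w" by auto
      have "cmod (f ?x - f w) \<le> b" using norm_triangle_ineq4[of "f ?x" "f w"] B[of x] by (simp add: b_def)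
      then have b2: "(cmod (f ?x - f w))\<^sup>2 \<le> b\<^sup>2" by (intro power_mono) auto
      have "\<bar>x\<bar> \<le> cmod (?x - w) + cmod w" using norm_triangle_ineq[of "?x - w" w] by simp
      also have "\<dots> \<le> cmod (?x - w) + cmod w * cmod (?x - w)" using d by (simp add: mult_left_le_imp_le mult_le_cancel_left1)
      also have "\<dots> = cmod (?x - w) * (1 + cmod w)" by (simp add: algebra_simps)
      finally have "x\<^sup>2 \<le> (cmod (?x - w) * (1 + cmod w))\<^sup>2"
        by (metis abs_ge_zero power2_abs power_mono)
      moreover have "1 \<le> (cmod (?x - w))\<^sup>2" using d by simp
      ultimately have x2: "1 + x\<^sup>2 \<le> (cmod (?x - w))\<^sup>2 * c"
        unfolding c_def distrib_left[of "(cmod (?x - w))\<^sup>2"] power_mult_distrib by linarith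
      have "(cmod (f ?x - f w))\<^sup>2 * (1 + x\<^sup>2) \<le> b\<^sup>2 * ((cmod (?x - w))\<^sup>2 * c)"
        using b2 x2 by (intro mult_mono) auto
      then have "(cmod (divdiff f w ?x))\<^sup>2 * (1 + x\<^sup>2) \<le> b\<^sup>2 * c"
        using ne d by (simp add: divdiff_eq norm_divide power_divide divide_le_eq mult_ac)
      also have "\<dots> \<le> (D\<^sup>2 + b\<^sup>2) * c" using c0 by (intro mult_right_mono) auto
      finally show ?thesis .
    qed
    moreover have "1 + x\<^sup>2 > 0" by (simp add: add_pos_nonneg)
    ultimately show ?thesis by (simp add: pos_le_divide_eq)
  qed
  have "(D\<^sup>2 + b\<^sup>2) * c \<ge> 0" by (simp add: c_def)
  have "integrable lborel (\<lambda>x. (D\<^sup>2 + b\<^sup>2) * c * (1 / (1 + x\<^sup>2)))"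
    by (intro integrable_mult_right integrable_inverse_one_plus_square)
  then show "integrable lborel (\<lambda>x. (cmod (divdiff f w (complex_of_real x)))\<^sup>2)"
    by (rule Bochner_Integration.integrable_bound) (use meas le \<open>(D\<^sup>2 + b\<^sup>2) * c \<ge> 0\<close> in auto)
qed

text \<open>The entire function sin(tz)/z, which is pi times the reproducing kernel at 0 for
  Lebesgue measure.\<close>

definition sinq :: "real \<Rightarrow> complex \<Rightarrow> complex" where
  "sinq t = divdiff (\<lambda>z. sin (complex_of_real t * z)) 0"

lemma sin_real_mult_bound:
  "cmod (sin (complex_of_real t * z)) \<le> exp (\<bar>t\<bar> * \<bar>Im z\<bar>)"
  using cmod_sin_le_exp[of 1 "complex_of_real t * z"] by (simp add: abs_mult)

lemma sin_exp_type:
  assumes "t \<ge> 0"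
  shows "exp_type_le t (\<lambda>z. sin (complex_of_real t * z))"
  unfolding exp_type_le_def
proof (intro allI impI exI)
  fix \<epsilon> :: real and z assume e: "\<epsilon> > 0"
  have "\<bar>t\<bar> * \<bar>Im z\<bar> \<le> (t + \<epsilon>) * cmod z"
    using assms e abs_Im_le_cmod[of z] by (intro mult_mono) auto
  then show "cmod (sin (complex_of_real t * z)) \<le> 1 * exp ((t + \<epsilon>) * cmod z)"
    using sin_real_mult_bound[of t z] by (smt (verit) exp_le_cancel_iff mult_1)
qed

lemma sinq_PW: "t \<ge> 0 \<Longrightarrow> sinq t \<in> PW t"
  unfolding sinq_def
  by (rule PW_divdiff[where B = 1])
     (use sin_real_mult_bound[of t "complex_of_real x" for x] in \<open>auto intro!: holomorphic_intros sin_exp_type\<close>)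

lemma sinq_0: "sinq t 0 = complex_of_real t"
proof -
  have "((\<lambda>z. sin (complex_of_real t * z)) has_field_derivative complex_of_real t) (at 0)"
    by (auto intro!: derivative_eq_intros)
  then show ?thesis by (simp add: sinq_def divdiff_def DERIV_imp_deriv)
qed

section \<open>Sampling measures, completeness and elements of least norm\<close>

lemma PW_sampling_lborel: "PW_sampling lborel"
  unfolding PW_sampling_def by (auto intro!: exI[of _ 1])

lemma PW_sampling_sets: "PW_sampling \<nu> \<Longrightarrow> sets \<nu> = sets borel"
  by (simp add: PW_sampling_def)

text \<open>The squared constant of the definition becomes a single constant comparing the real
  quantities \<open>nsq\<close>. Square integrability for \<nu> appears among the conclusions
  because it follows from the upper sampling bound.\<close>

lemma sampling_bounds:
  assumes "PW_sampling \<nu>" "a > 0"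
  obtains C where "C > 0" "\<And>f. f \<in> PW a \<Longrightarrow> f \<in> L2fun \<nu>"
    "\<And>f. f \<in> PW a \<Longrightarrow> nsq lborel f \<le> C * nsq \<nu> f"
    "\<And>f. f \<in> PW a \<Longrightarrow> nsq \<nu> f \<le> C * nsq lborel f"
proof -
  obtain C where C: "C > 0" "\<And>f. f \<in> PW a \<Longrightarrow> ennreal (inverse (C\<^sup>2)) * L2sq lborel f \<le> L2sq \<nu> f"
    "\<And>f. f \<in> PW a \<Longrightarrow> L2sq \<nu> f \<le> ennreal (C\<^sup>2) * L2sq lborel f"
    using assms unfolding PW_sampling_def by blast
  have L2: "f \<in> L2fun \<nu>" if f: "f \<in> PW a" for f
  proof -
    have "(\<lambda>x. f (complex_of_real x)) \<in> borel_measurable \<nu>"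
      using entire_measurable[OF PW_holomorphic[OF f]] measurable_cong_sets[OF PW_sampling_sets[OF assms(1)] refl] by blast
    moreover have "L2sq \<nu> f < \<infinity>"
      using C(3)[OF f] L2sq_eq_nsq[OF PW_L2fun[OF f]]
      by (metis ennreal_less_top ennreal_mult_less_top infinity_ennreal_def le_less_trans)
    ultimately show ?thesis by (simp add: L2fun_iff_L2sq)
  qed
  show ?thesis
  proof (rule that[of "C\<^sup>2"])
    fix f assume f: "f \<in> PW a"
    have 1: "ennreal (inverse (C\<^sup>2) * nsq lborel f) \<le> ennreal (nsq \<nu> f)"
      using C(2)[OF f] by (simp add: L2sq_eq_nsq L2[OF f] PW_L2fun[OF f] ennreal_mult'')
    have 2: "ennreal (nsq \<nu> f) \<le> ennreal (C\<^sup>2 * nsq lborel f)"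
      using C(3)[OF f] by (simp add: L2sq_eq_nsq L2[OF f] PW_L2fun[OF f] ennreal_mult'')
    show "nsq lborel f \<le> C\<^sup>2 * nsq \<nu> f" using 1 C(1) by (simp add: field_simps)
    show "nsq \<nu> f \<le> C\<^sup>2 * nsq lborel f" using 2 by (subst (asm) ennreal_le_iff) auto
  qed (use C L2 in auto)
qed

lemma PW_L2fun_sampling: "PW_sampling \<nu> \<Longrightarrow> f \<in> PW a \<Longrightarrow> a > 0 \<Longrightarrow> f \<in> L2fun \<nu>"
  using sampling_bounds by metis

text \<open>The pointwise bound turns a Cauchy sequence in norm into a locally uniformly convergent
  one, so the limit is entire. The factor exp(a|Im z|) of the same bound gives its exponential type,
  and Fatou's lemma gives convergence in norm.\<close>

lemma PW_complete:
  assumes F: "\<And>n. F n \<in> PW a" and a: "a \<ge> 0"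
    and Cauchy: "\<And>e. e > 0 \<Longrightarrow> \<exists>M. \<forall>m\<ge>M. \<forall>n\<ge>M. nsq lborel (\<lambda>z. F m z - F n z) \<le> e"
  obtains f where "f \<in> PW a" "\<And>z. (\<lambda>n. F n z) \<longlonglongrightarrow> f z"
    "(\<lambda>n. nsq lborel (\<lambda>z. F n z - f z)) \<longlonglongrightarrow> 0"
proof -
  define c where "c = (\<lambda>z. exp (2 + 2 * a) * exp (2 * a * \<bar>Im z\<bar>))"
  have c0: "c z > 0" for z by (simp add: c_def)
  have pb: "(cmod (F m z - F n z))\<^sup>2 \<le> c z * nsq lborel (\<lambda>z. F m z - F n z)" for m n z
    using PW_pointwise_bound[OF PW_diff[OF F[of m] F[of n]] a, of z] by (simp add: c_def)
  have unif: "\<exists>M. \<forall>m\<ge>M. \<forall>n\<ge>M. cmod (F m z - F n z) \<le> sqrt (c z * e)" if e: "e > 0" for z e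
  proof -
    obtain M where M: "\<forall>m\<ge>M. \<forall>n\<ge>M. nsq lborel (\<lambda>z. F m z - F n z) \<le> e" using Cauchy[OF e] by blast
    have "cmod (F m z - F n z) \<le> sqrt (c z * e)" if "m \<ge> M" "n \<ge> M" for m n
    proof (rule real_le_rsqrt)
      show "(cmod (F m z - F n z))\<^sup>2 \<le> c z * e"
        using M that c0[of z] by (intro order_trans[OF pb] mult_left_mono) auto
    qed
    then show ?thesis by blast
  qed
  have "Cauchy (\<lambda>n. F n z)" for z
  proof (rule metric_CauchyI)
    fix e :: real assume e: "e > 0"
    obtain M where M: "\<forall>m\<ge>M. \<forall>n\<ge>M. cmod (F m z - F n z) \<le> sqrt (c z * ((e/2)\<^sup>2 / c z))"
      using unif[of "(e/2)\<^sup>2 / c z" z] e c0[of z] by auto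
    have "dist (F m z) (F n z) < e" if "m \<ge> M" "n \<ge> M" for m n
    proof -
      have "cmod (F m z - F n z) \<le> e / 2" using M that e c0[of z] by simp
      then show ?thesis using e by (simp add: dist_norm)
    qed
    then show "\<exists>M. \<forall>m\<ge>M. \<forall>n\<ge>M. dist (F m z) (F n z) < e" by blast
  qed
  then have "\<exists>l. (\<lambda>n. F n z) \<longlonglongrightarrow> l" for z
    using Cauchy_convergent_iff convergent_def by blast
  then obtain f where lim: "\<And>z. (\<lambda>n. F n z) \<longlonglongrightarrow> f z" by metis
  have diff: "cmod (F m z - f z) \<le> sqrt (c z * e)"
    if "\<forall>m\<ge>M. \<forall>n\<ge>M. nsq lborel (\<lambda>z. F m z - F n z) \<le> e" "m \<ge> M" for M m z e
  proof (rule tendsto_upperbound)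
    show "(\<lambda>n. cmod (F m z - F n z)) \<longlonglongrightarrow> cmod (F m z - f z)" by (intro tendsto_intros lim)
    show "\<forall>\<^sub>F n in sequentially. cmod (F m z - F n z) \<le> sqrt (c z * e)"
      using that c0[of z]
      by (auto intro!: eventually_sequentiallyI[of M] real_le_rsqrt order_trans[OF pb] mult_left_mono)
  qed auto
  have hol: "f holomorphic_on UNIV"
  proof (rule holomorphic_uniform_sequence)
    fix w :: complex
    define c' where "c' = exp (2 + 2 * a) * exp (2 * a * (cmod w + 1))"
    have cz: "c z \<le> c'" if "z \<in> cball w 1" for z
    proof -
      have "\<bar>Im z\<bar> \<le> cmod w + 1"
        using that abs_Im_le_cmod[of z] norm_triangle_ineq2[of z w] by (auto simp: dist_norm norm_minus_commute)
      then have "2 * a * \<bar>Im z\<bar> \<le> 2 * a * (cmod w + 1)" using a by (intro mult_left_mono) auto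
      then show ?thesis by (simp add: c_def c'_def)
    qed
    have "uniform_limit (cball w 1) F f sequentially"
    proof (rule uniform_limitI)
      fix e :: real assume e: "e > 0"
      have c'0: "c' > 0" by (simp add: c'_def)
      obtain M where M: "\<forall>m\<ge>M. \<forall>n\<ge>M. nsq lborel (\<lambda>z. F m z - F n z) \<le> (e/2)\<^sup>2 / c'"
        using Cauchy[of "(e/2)\<^sup>2 / c'"] e c'0 by auto
      have "dist (F m z) (f z) < e" if "m \<ge> M" "z \<in> cball w 1" for m z
      proof -
        have "cmod (F m z - f z) \<le> sqrt (c z * ((e/2)\<^sup>2 / c'))" by (rule diff[OF M that(1)])
        also have "\<dots> \<le> sqrt (c' * ((e/2)\<^sup>2 / c'))"
          using cz[OF that(2)] c'0 by (intro real_sqrt_le_mono mult_right_mono) auto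
        also have "\<dots> = e/2" using c'0 e by simp
        finally show ?thesis using e by (simp add: dist_norm)
      qed
      then show "\<forall>\<^sub>F n in sequentially. \<forall>x\<in>cball w 1. dist (F n x) (f x) < e"
        by (auto intro!: eventually_sequentiallyI[of M])
    qed
    then show "\<exists>d>0. cball w d \<subseteq> UNIV \<and> uniform_limit (cball w d) F f sequentially"
      by (intro exI[of _ 1]) auto
  qed (auto intro: PW_holomorphic[OF F])
  have ty: "exp_type_le a f"
  proof -
    obtain M where M: "\<forall>m\<ge>M. \<forall>n\<ge>M. nsq lborel (\<lambda>z. F m z - F n z) \<le> 1" using Cauchy[of 1] by auto
    \<comment> \<open>The type is read off from the distance to one fixed member of the sequence,
      which is at most exp(1+a) exp(a|Im z|).\<close>
    have "exp_type_le a (\<lambda>z. f z - F M z)" unfolding exp_type_le_def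
    proof (intro allI impI exI)
      fix \<epsilon> :: real and z :: complex assume e: "\<epsilon> > 0"
      have "cmod (f z - F M z) \<le> sqrt (c z)"
        using diff[OF M order_refl, of z] by (simp add: norm_minus_commute)
      also have "sqrt (c z) = exp (1 + a) * exp (a * \<bar>Im z\<bar>)"
      proof (rule real_sqrt_unique)
        show "(exp (1 + a) * exp (a * \<bar>Im z\<bar>))\<^sup>2 = c z"
          unfolding c_def power_mult_distrib exp_double[symmetric] by (simp add: algebra_simps)
      qed auto
      also have "\<dots> \<le> exp (1 + a) * exp ((a + \<epsilon>) * cmod z)"
        using a e abs_Im_le_cmod[of z] by (intro mult_left_mono) (auto intro!: mult_mono)
      finally show "cmod (f z - F M z) \<le> exp (1 + a) * exp ((a + \<epsilon>) * cmod z)" .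
    qed
    then show ?thesis using exp_type_le_add[OF _ PW_exp_type[OF F[of M]], of "\<lambda>z. f z - F M z"] by simp
  qed
  have mf: "(\<lambda>x. f (complex_of_real x)) \<in> borel_measurable borel" by (rule entire_measurable[OF hol])
  have mF: "(\<lambda>x. F n (complex_of_real x)) \<in> borel_measurable borel" for n
    by (rule entire_measurable[OF PW_holomorphic[OF F]])
  have fatou: "(\<lambda>z. F m z - f z) \<in> L2fun lborel \<and> nsq lborel (\<lambda>z. F m z - f z) \<le> e"
    if M: "\<forall>m\<ge>M. \<forall>n\<ge>M. nsq lborel (\<lambda>z. F m z - F n z) \<le> e" and m: "m \<ge> M" and e: "e \<ge> 0" for M m e
  proof -
    let ?u = "\<lambda>n x. ennreal ((cmod (F m (complex_of_real x) - F n (complex_of_real x)))\<^sup>2)"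
    have "L2sq lborel (\<lambda>z. F m z - f z) = (\<integral>\<^sup>+ x. liminf (\<lambda>n. ?u n x) \<partial>lborel)"
      unfolding L2sq_def
    proof (intro nn_integral_cong)
      fix x :: real
      have "(\<lambda>n. ?u n x) \<longlonglongrightarrow> ennreal ((cmod (F m (complex_of_real x) - f (complex_of_real x)))\<^sup>2)"
        by (intro tendsto_intros lim)
      then show "ennreal ((cmod (F m (complex_of_real x) - f (complex_of_real x)))\<^sup>2) = liminf (\<lambda>n. ?u n x)"
        by (rule lim_imp_Liminf[OF sequentially_bot, symmetric])
    qed
    also have "\<dots> \<le> liminf (\<lambda>n. \<integral>\<^sup>+ x. ?u n x \<partial>lborel)"
      by (rule nn_integral_liminf) (use mF in auto)
    also have "\<dots> \<le> ennreal e"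
    proof (rule Liminf_le)
      show "\<forall>\<^sub>F n in sequentially. (\<integral>\<^sup>+ x. ?u n x \<partial>lborel) \<le> ennreal e"
      proof (rule eventually_sequentiallyI[of M])
        fix n assume n: "n \<ge> M"
        have "(\<lambda>z. F m z - F n z) \<in> L2fun lborel" by (rule PW_L2fun[OF PW_diff[OF F F]])
        then have "(\<integral>\<^sup>+ x. ?u n x \<partial>lborel) = ennreal (nsq lborel (\<lambda>z. F m z - F n z))"
          using L2sq_eq_nsq by (force simp: L2sq_def)
        also have "\<dots> \<le> ennreal e" using M m n by (intro ennreal_leI) auto
        finally show "(\<integral>\<^sup>+ x. ?u n x \<partial>lborel) \<le> ennreal e" .
      qed
    qed auto
    finally have le: "L2sq lborel (\<lambda>z. F m z - f z) \<le> ennreal e" .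
    have L2: "(\<lambda>z. F m z - f z) \<in> L2fun lborel"
      using le mF[of m] mf by (subst L2fun_iff_L2sq) (auto intro: le_less_trans)
    then show ?thesis using le e by (simp add: L2sq_eq_nsq)
  qed
  obtain M1 where M1: "\<forall>m\<ge>M1. \<forall>n\<ge>M1. nsq lborel (\<lambda>z. F m z - F n z) \<le> 1" using Cauchy[of 1] by auto
  have "f \<in> L2fun lborel"
    using L2fun_diff[OF PW_L2fun[OF F[of M1]] conjunct1[OF fatou[OF M1 order_refl]]] by simp
  with hol ty have "f \<in> PW a" by (intro PWI)
  moreover have "(\<lambda>n. nsq lborel (\<lambda>z. F n z - f z)) \<longlonglongrightarrow> 0"
  proof (rule LIMSEQ_I)
    fix e :: real assume e: "e > 0"
    obtain M where M: "\<forall>m\<ge>M. \<forall>n\<ge>M. nsq lborel (\<lambda>z. F m z - F n z) \<le> e/2" using Cauchy[of "e/2"] e by auto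
    have "norm (nsq lborel (\<lambda>z. F n z - f z) - 0) < e" if "n \<ge> M" for n
      using conjunct2[OF fatou[OF M that]] e by simp
    then show "\<exists>M. \<forall>n\<ge>M. norm (nsq lborel (\<lambda>z. F n z - f z) - 0) < e" by blast
  qed
  ultimately show ?thesis using that lim by blast
qed

text \<open>By the parallelogram law a minimizing sequence is Cauchy for \<nu>, hence for Lebesgue
  measure. Closedness is phrased through the two modes of convergence that
  \<open>PW_complete\<close> delivers. The result is used twice: for the hyperplane that yields the
  kernel and for the coset that yields a projection.\<close>

lemma PW_min_norm_exists:
  assumes \<nu>: "PW_sampling \<nu>" and a: "a > 0" and V: "V \<subseteq> PW a" "V \<noteq> {}"
    and mid: "\<And>f g. f \<in> V \<Longrightarrow> g \<in> V \<Longrightarrow> (\<lambda>z. (f z + g z) / 2) \<in> V"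
    and closed: "\<And>F f. (\<And>n. F n \<in> V) \<Longrightarrow> f \<in> PW a \<Longrightarrow> (\<And>z. (\<lambda>n. F n z) \<longlonglongrightarrow> f z) \<Longrightarrow>
        (\<lambda>n. nsq lborel (\<lambda>z. F n z - f z)) \<longlonglongrightarrow> 0 \<Longrightarrow> f \<in> V"
  obtains f where "f \<in> V" "\<And>g. g \<in> V \<Longrightarrow> nsq \<nu> f \<le> nsq \<nu> g"
proof -
  obtain C where C: "C > 0" and L2: "\<And>f. f \<in> PW a \<Longrightarrow> f \<in> L2fun \<nu>"
    and C1: "\<And>f. f \<in> PW a \<Longrightarrow> nsq lborel f \<le> C * nsq \<nu> f"
    and C2: "\<And>f. f \<in> PW a \<Longrightarrow> nsq \<nu> f \<le> C * nsq lborel f"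
    using sampling_bounds[OF \<nu> a] by blast
  define d where "d = Inf (nsq \<nu> ` V)"
  have bdd: "bdd_below (nsq \<nu> ` V)" by (intro bdd_belowI[of _ 0]) auto
  have dle: "d \<le> nsq \<nu> g" if "g \<in> V" for g unfolding d_def using bdd that by (intro cInf_lower) auto
  have "\<exists>f\<in>V. nsq \<nu> f < d + 1 / real (Suc n)" for n
    using cInf_lessD[of "nsq \<nu> ` V" "d + 1 / real (Suc n)"] V(2) by (auto simp: d_def)
  then obtain F where F: "\<And>n. F n \<in> V" "\<And>n. nsq \<nu> (F n) < d + 1 / real (Suc n)" by metis
  have FP: "F n \<in> PW a" for n using F(1) V(1) by blast
  have small: "nsq lborel (\<lambda>z. F m z - F n z) \<le> C * (2 / real (Suc m) + 2 / real (Suc n))" for m n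
  proof -
    have "nsq \<nu> (\<lambda>z. F m z - F n z) = 2 * nsq \<nu> (F m) + 2 * nsq \<nu> (F n) - 4 * nsq \<nu> (\<lambda>z. (F m z + F n z) / 2)"
      by (intro parallelogram L2 FP)
    also have "\<dots> \<le> 2 / real (Suc m) + 2 / real (Suc n)"
      using dle[OF mid[OF F(1)[of m] F(1)[of n]]] F(2)[of m] F(2)[of n] by linarith
    finally show ?thesis using C1[OF PW_diff[OF FP[of m] FP[of n]]] C
      by (meson mult_left_mono order_trans less_imp_le)
  qed
  have cau: "\<exists>M. \<forall>m\<ge>M. \<forall>n\<ge>M. nsq lborel (\<lambda>z. F m z - F n z) \<le> e" if e: "e > 0" for e
  proof -
    obtain M where M: "1 / real (Suc M) < e / (4 * C)"
      using reals_Archimedean[of "e / (4 * C)"] e C by (auto simp: inverse_eq_divide)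
    have "nsq lborel (\<lambda>z. F m z - F n z) \<le> e" if "m \<ge> M" "n \<ge> M" for m n
    proof -
      have "1 / real (Suc m) \<le> 1 / real (Suc M)" "1 / real (Suc n) \<le> 1 / real (Suc M)"
        using that by (auto intro!: divide_left_mono)
      then have "2 / real (Suc m) + 2 / real (Suc n) \<le> e / C"
        using M by simp
      then have "C * (2 / real (Suc m) + 2 / real (Suc n)) \<le> C * (e / C)" using C by (intro mult_left_mono) auto
      then show ?thesis using small[of m n] C by simp
    qed
    then show ?thesis by blast
  qed
  have "\<exists>f. f \<in> PW a \<and> (\<forall>z. (\<lambda>n. F n z) \<longlonglongrightarrow> f z) \<and> (\<lambda>n. nsq lborel (\<lambda>z. F n z - f z)) \<longlonglongrightarrow> 0"
    by (rule PW_complete[of F, OF FP less_imp_le[OF a]], erule cau) blast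
  then obtain f where f: "f \<in> PW a" "\<And>z. (\<lambda>n. F n z) \<longlonglongrightarrow> f z"
    "(\<lambda>n. nsq lborel (\<lambda>z. F n z - f z)) \<longlonglongrightarrow> 0"
    by blast
  have fV: "f \<in> V" by (rule closed[OF F(1) f])
  define x where "x = (\<lambda>n. nsq \<nu> (\<lambda>z. F n z - f z))"
  have "x \<longlonglongrightarrow> 0"
  proof (rule tendsto_sandwich[OF _ _ tendsto_const])
    show "\<forall>\<^sub>F n in sequentially. x n \<le> C * nsq lborel (\<lambda>z. F n z - f z)"
      unfolding x_def by (intro always_eventually allI C2 PW_diff FP f)
    show "(\<lambda>n. C * nsq lborel (\<lambda>z. F n z - f z)) \<longlonglongrightarrow> 0"
      using tendsto_mult_right_zero[OF f(3)] by simp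
  qed (simp add: x_def)
  \<comment> \<open>Expanding f as F n - (F n - f) compares its norm with that of F n;
    Cauchy-Schwarz bounds the cross term by means of x n, which tends to 0.\<close>
  have est: "nsq \<nu> f \<le> (d + 1 / real (Suc n)) + 2 * sqrt ((d + 1) * x n) + x n" for n
  proof -
    have Fd: "F n \<in> L2fun \<nu>" "(\<lambda>z. F n z - f z) \<in> L2fun \<nu>" by (auto intro!: L2 FP PW_diff f)
    have "nsq \<nu> f = nsq \<nu> (F n) - 2 * Re (ip \<nu> (F n) (\<lambda>z. F n z - f z)) + x n"
      using nsq_diff[OF Fd] by (simp add: x_def)
    moreover have "- Re (ip \<nu> (F n) (\<lambda>z. F n z - f z)) \<le> sqrt ((d + 1) * x n)"
    proof -
      have "(cmod (ip \<nu> (F n) (\<lambda>z. F n z - f z)))\<^sup>2 \<le> nsq \<nu> (F n) * x n"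
        using nsq_cauchy_schwarz[OF Fd] by (simp add: x_def)
      also have "\<dots> \<le> (d + 1) * x n"
      proof (rule mult_right_mono)
        have "1 / real (Suc n) \<le> 1" by simp
        then show "nsq \<nu> (F n) \<le> d + 1" using F(2)[of n] by linarith
      qed (simp add: x_def)
      finally have "cmod (ip \<nu> (F n) (\<lambda>z. F n z - f z)) \<le> sqrt ((d + 1) * x n)" by (rule real_le_rsqrt)
      then show ?thesis using abs_Re_le_cmod[of "ip \<nu> (F n) (\<lambda>z. F n z - f z)"] by linarith
    qed
    ultimately show ?thesis using F(2)[of n] by linarith
  qed
  have "(\<lambda>n. (d + 1 / real (Suc n)) + 2 * sqrt ((d + 1) * x n) + x n) \<longlonglongrightarrow> (d + 0) + 2 * sqrt ((d + 1) * 0) + 0"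
    using \<open>x \<longlonglongrightarrow> 0\<close> LIMSEQ_inverse_real_of_nat
    by (intro tendsto_intros) (auto simp: inverse_eq_divide)
  then have "nsq \<nu> f \<le> (d + 0) + 2 * sqrt ((d + 1) * 0) + 0"
    by (rule tendsto_lowerbound) (use est in auto)
  then have "nsq \<nu> f \<le> d" by simp
  then show ?thesis using that[OF fV] order_trans[OF _ dle] by blast
qed

text \<open>The competitor uses c = l <f,h> with l = 1/(\<open>nsq \<nu> h\<close> + 1). The summand
  1 avoids a division by zero, and l times \<open>nsq \<nu> h\<close> being at most 1 leaves enough
  gain to force <f,h> = 0.\<close>

lemma minimal_imp_orthogonal:
  assumes "f \<in> L2fun \<nu>" "h \<in> L2fun \<nu>" and min: "\<And>c. nsq \<nu> f \<le> nsq \<nu> (\<lambda>z. f z - c * h z)"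
  shows "ip \<nu> f h = 0"
proof -
  define l where "l = 1 / (nsq \<nu> h + 1)"
  define c where "c = complex_of_real l * ip \<nu> f h"
  have h0: "nsq \<nu> h \<ge> 0" by simp
  then have "nsq \<nu> h + 1 > 0" by linarith
  with h0 have l: "l > 0" "l * nsq \<nu> h \<le> 1" by (auto simp: l_def)
  have "Re (cnj c * ip \<nu> f h) = l * (cmod (ip \<nu> f h))\<^sup>2"
    by (simp add: c_def cmod_def power2_eq_square algebra_simps)
  moreover have "(cmod c)\<^sup>2 = l\<^sup>2 * (cmod (ip \<nu> f h))\<^sup>2"
    by (simp add: c_def norm_mult power_mult_distrib)
  ultimately have "2 * (l * (cmod (ip \<nu> f h))\<^sup>2) \<le> l\<^sup>2 * (cmod (ip \<nu> f h))\<^sup>2 * nsq \<nu> h"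
    using min[of c] nsq_diff[OF assms(1) L2fun_scale[OF assms(2), of c]]
    by (simp add: nsq_scale ip_scale_right)
  also have "\<dots> = (l * (cmod (ip \<nu> f h))\<^sup>2) * (l * nsq \<nu> h)" by (simp add: power2_eq_square)
  also have "\<dots> \<le> (l * (cmod (ip \<nu> f h))\<^sup>2) * 1" using l by (intro mult_left_mono) auto
  finally have "l * (cmod (ip \<nu> f h))\<^sup>2 \<le> 0" by simp
  then show ?thesis using l by (simp add: mult_le_0_iff)
qed

text \<open>The element of least norm among the functions with value 1 at 0 is orthogonal to every
  function that vanishes at 0, hence proportional to the kernel; division by its squared norm
  normalizes it. The function sin(tz)/(tz) shows that there are competitors.\<close>

lemma PW_kernel_exists:
  assumes \<nu>: "PW_sampling \<nu>" and t: "t > 0"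
  obtains k where "k \<in> PW t" "\<And>f. f \<in> PW t \<Longrightarrow> f 0 = ip \<nu> f k"
proof -
  define V where "V = {f \<in> PW t. f 0 = 1}"
  have s: "(\<lambda>z. (1 / complex_of_real t) * sinq t z) \<in> V"
    using t PW_scale[OF sinq_PW[of t], of "1 / complex_of_real t"] by (simp add: V_def sinq_0)
  have mid: "(\<lambda>z. (f z + g z) / 2) \<in> V" if "f \<in> V" "g \<in> V" for f g
    using that PW_scale[OF PW_add[of f t g], of "1/2"] by (simp add: V_def)
  have cl: "f \<in> V" if "\<And>n. F n \<in> V" "f \<in> PW t" "\<And>z. (\<lambda>n. F n z) \<longlonglongrightarrow> f z"
    "(\<lambda>n. nsq lborel (\<lambda>z. F n z - f z)) \<longlonglongrightarrow> 0" for F f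
  proof -
    have "(\<lambda>n. F n 0) = (\<lambda>n. 1)" using that(1) by (auto simp: V_def)
    then have "f 0 = 1" using that(3)[of 0] LIMSEQ_unique tendsto_const by metis
    then show ?thesis using that(2) by (simp add: V_def)
  qed
  obtain f0 where f0: "f0 \<in> V" "\<And>g. g \<in> V \<Longrightarrow> nsq \<nu> f0 \<le> nsq \<nu> g"
  proof (rule PW_min_norm_exists[OF \<nu> t, of V])
    show "V \<subseteq> PW t" "V \<noteq> {}" using s by (auto simp: V_def)
  qed (use mid cl in blast)+
  have f0P: "f0 \<in> PW t" "f0 0 = 1" using f0 by (auto simp: V_def)
  have L2: "f \<in> L2fun \<nu>" if "f \<in> PW t" for f using PW_L2fun_sampling[OF \<nu> that t] .
  obtain C where C: "C > 0" "\<And>f. f \<in> PW t \<Longrightarrow> nsq lborel f \<le> C * nsq \<nu> f"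
    using sampling_bounds[OF \<nu> t] by metis
  have n0: "nsq \<nu> f0 > 0"
  proof (rule ccontr)
    assume "\<not> ?thesis"
    then have "nsq \<nu> f0 = 0" using nsq_nonneg[of \<nu> f0] by linarith
    then have "nsq lborel f0 = 0" using C(2)[OF f0P(1)] nsq_nonneg[of lborel f0] by simp
    then show False using PW_pointwise_bound[OF f0P(1), of 0] t f0P(2) by simp
  qed
  have orth: "ip \<nu> h f0 = 0" if h: "h \<in> PW t" "h 0 = 0" for h
  proof -
    have "ip \<nu> f0 h = 0"
    proof (rule minimal_imp_orthogonal[OF L2[OF f0P(1)] L2[OF h(1)]])
      fix c
      have "(\<lambda>z. f0 z - c * h z) \<in> V" using h f0P by (auto simp: V_def intro!: PW_diff PW_scale)
      then show "nsq \<nu> f0 \<le> nsq \<nu> (\<lambda>z. f0 z - c * h z)" by (rule f0)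
    qed
    then show ?thesis by (subst ip_commute) simp
  qed
  define k where "k = (\<lambda>z. complex_of_real (1 / nsq \<nu> f0) * f0 z)"
  show ?thesis
  proof (rule that[of k])
    show "k \<in> PW t" unfolding k_def by (rule PW_scale[OF f0P(1)])
    fix f assume f: "f \<in> PW t"
    have "ip \<nu> (\<lambda>z. f z - f 0 * f0 z) f0 = 0"
      by (rule orth) (use f f0P in \<open>auto intro!: PW_diff PW_scale\<close>)
    then have "ip \<nu> f f0 = f 0 * complex_of_real (nsq \<nu> f0)"
      using ip_diff_left[OF L2[OF f] L2[OF PW_scale[OF f0P(1)]] L2[OF f0P(1)], of "f 0"]
      by (simp add: ip_scale_left ip_self)
    then show "f 0 = ip \<nu> f k" unfolding k_def ip_scale_right using n0 by simp
  qed
qed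

text \<open>\<open>nsq \<nu>\<close> is definite on \<open>PW t\<close>: sampling compares it with
  the Lebesgue norm, which dominates point values.\<close>

lemma PW_orthogonal_self_zero:
  assumes \<nu>: "PW_sampling \<nu>" and t: "t > 0" and g: "g \<in> PW t" and o: "nsq \<nu> g = 0"
  shows "g z = 0"
proof -
  obtain C where "C > 0" "\<And>f. f \<in> PW t \<Longrightarrow> nsq lborel f \<le> C * nsq \<nu> f"
    using sampling_bounds[OF \<nu> t] by metis
  then have "nsq lborel g \<le> 0" using g o by force
  then have "nsq lborel g = 0" using nsq_nonneg[of lborel g] by linarith
  then show ?thesis using PW_pointwise_bound[OF g, of z] t by simp
qed

lemma PW_kernel_unique:
  assumes \<nu>: "PW_sampling \<nu>" and t: "t > 0"
    and k: "k \<in> PW t" "\<And>f. f \<in> PW t \<Longrightarrow> f 0 = ip \<nu> f k"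
    and k': "k' \<in> PW t" "\<And>f. f \<in> PW t \<Longrightarrow> f 0 = ip \<nu> f k'"
  shows "k = k'"
proof -
  have L2: "f \<in> L2fun \<nu>" if "f \<in> PW t" for f using PW_L2fun_sampling[OF \<nu> that t] .
  let ?g = "\<lambda>z. k z - k' z"
  have g: "?g \<in> PW t" by (rule PW_diff[OF k(1) k'(1)])
  have "ip \<nu> ?g ?g = ip \<nu> ?g k - ip \<nu> ?g k'" by (intro ip_diff_right L2 k k' g)
  then have "nsq \<nu> ?g = 0" using k(2)[OF g] k'(2)[OF g] by (simp add: ip_self)
  then have "k z = k' z" for z using PW_orthogonal_self_zero[OF \<nu> t g, of z] by simp
  then show ?thesis by blast
qed

text \<open>As the kernel is given by a definite description, it is identified in practice by
  exhibiting a reproducing function.\<close>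

lemma PW_kernel_eqI:
  assumes \<nu>: "PW_sampling \<nu>" and t: "t > 0"
    and k: "k \<in> PW t" "\<And>f. f \<in> PW t \<Longrightarrow> f 0 = ip \<nu> f k"
  shows "PW_kernel \<nu> t = k"
  unfolding PW_kernel_def ip_def[symmetric]
  by (rule the_equality) (use k PW_kernel_unique[OF \<nu> t] in auto)

lemma PW_kernel_props:
  assumes \<nu>: "PW_sampling \<nu>" and t: "t > 0"
  shows "PW_kernel \<nu> t \<in> PW t" "f \<in> PW t \<Longrightarrow> ip \<nu> f (PW_kernel \<nu> t) = f 0"
proof -
  obtain k where k: "k \<in> PW t" "\<And>f. f \<in> PW t \<Longrightarrow> f 0 = ip \<nu> f k"
    using PW_kernel_exists[OF \<nu> t] by blast
  then show "PW_kernel \<nu> t \<in> PW t" "f \<in> PW t \<Longrightarrow> ip \<nu> f (PW_kernel \<nu> t) = f 0"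
    using PW_kernel_eqI[OF \<nu> t k] by auto
qed

lemma PW_cnj:
  assumes "f \<in> PW t" shows "(\<lambda>z. cnj (f (cnj z))) \<in> PW t"
proof (rule PWI)
  have "f holomorphic_on cnj ` UNIV"
    using PW_holomorphic[OF assms] by (rule holomorphic_on_subset) auto
  from holomorphic_on_compose_cnj_cnj[OF this]
  show "(\<lambda>z. cnj (f (cnj z))) holomorphic_on UNIV" by (simp add: o_def)
  show "exp_type_le t (\<lambda>z. cnj (f (cnj z)))"
    using PW_exp_type[OF assms] unfolding exp_type_le_def by (metis complex_mod_cnj)
  have "continuous_on UNIV cnj" by (intro continuous_intros)
  then have [measurable]: "cnj \<in> borel_measurable borel" by (rule borel_measurable_continuous_onI)
  note [measurable] = entire_measurable[OF PW_holomorphic[OF assms]]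
  show "(\<lambda>z. cnj (f (cnj z))) \<in> L2fun lborel"
    by (rule L2funI) (use L2fun_integrable[OF PW_L2fun[OF assms]] in auto)
qed

text \<open>The reflection that takes f to cnj(f(cnj z)) preserves \<open>PW t\<close> and
  conjugates real values, so the reflected kernel reproduces too and uniqueness applies.\<close>

lemma PW_kernel_real:
  assumes \<nu>: "PW_sampling \<nu>" and t: "t > 0"
  shows "cnj (PW_kernel \<nu> t (complex_of_real x)) = PW_kernel \<nu> t (complex_of_real x)"
proof -
  define k where "k = PW_kernel \<nu> t"
  note k = PW_kernel_props[OF \<nu> t, folded k_def]
  have "PW_kernel \<nu> t = (\<lambda>z. cnj (k (cnj z)))"
  proof (rule PW_kernel_eqI[OF \<nu> t PW_cnj[OF k(1)]])
    fix f assume f: "f \<in> PW t"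
    have "cnj (f 0) = ip \<nu> (\<lambda>z. cnj (f (cnj z))) k"
      using k(2)[OF PW_cnj[OF f]] by simp
    also have "\<dots> = cnj (ip \<nu> f (\<lambda>z. cnj (k (cnj z))))"
      by (subst ip_commute[symmetric]) (simp add: ip_def mult.commute)
    finally show "f 0 = ip \<nu> f (\<lambda>z. cnj (k (cnj z)))" by simp
  qed
  then have "PW_kernel \<nu> t (complex_of_real x) = cnj (k (cnj (complex_of_real x)))" by metis
  then show ?thesis by (simp add: k_def)
qed

section \<open>Boundary integrals over a half-plane\<close>


lemma cmod_exp_i_minus_one_le: "cmod (exp (\<i> * complex_of_real y) - 1) \<le> \<bar>y\<bar>"
proof -
  have "(cmod (exp (\<i> * complex_of_real y) - 1))\<^sup>2 = (cos y - 1)\<^sup>2 + (sin y)\<^sup>2"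
    by (simp add: cmod_power2 Re_exp Im_exp)
  also have "\<dots> = 2 - 2 * cos (2 * (y/2))" using sin_cos_squared_add[of y] by (simp add: power2_eq_square algebra_simps)
  also have "\<dots> = (2 * sin (y/2))\<^sup>2" unfolding cos_double_sin by (simp add: power_mult_distrib)
  also have "\<dots> \<le> \<bar>y\<bar>\<^sup>2"
    unfolding abs_le_square_iff[symmetric] using abs_sin_x_le_abs_x[of "y/2"] by (simp add: abs_mult)
  finally show ?thesis by (rule power2_le_imp_le) simp
qed

lemma integral_tendsto_interval:
  fixes f :: "real \<Rightarrow> complex"
  assumes "integrable lborel f"
  shows "(\<lambda>n. integral {- real n..real n} f) \<longlonglongrightarrow> (LINT x|lborel. f x)"
proof -
  have eq: "integral {- real n..real n} f = (LINT x|lborel. indicat_real {- real n..real n} x *\<^sub>R f x)" for n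
  proof -
    have "set_integrable lborel {- real n..real n} f"
      unfolding set_integrable_def using assms by (intro integrable_mult_indicator) auto
    then show ?thesis using set_borel_integral_eq_integral(2) by (metis set_lebesgue_integral_def)
  qed
  have "(\<lambda>n. LINT x|lborel. indicat_real {- real n..real n} x *\<^sub>R f x) \<longlonglongrightarrow> (LINT x|lborel. f x)"
  proof (rule integral_dominated_convergence[where w = "\<lambda>x. norm (f x)"])
    show "AE x in lborel. (\<lambda>n. indicat_real {- real n..real n} x *\<^sub>R f x) \<longlonglongrightarrow> f x"
    proof (rule AE_I2)
      fix x :: real
      obtain N where N: "\<bar>x\<bar> \<le> real N" using real_arch_simple by blast
      show "(\<lambda>n. indicat_real {- real n..real n} x *\<^sub>R f x) \<longlonglongrightarrow> f x"
      proof (rule tendsto_eventually, rule eventually_sequentiallyI[of N])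
        fix n assume "n \<ge> N"
        then have "\<bar>x\<bar> \<le> real n" using N by linarith
        then show "indicat_real {- real n..real n} x *\<^sub>R f x = f x" by (auto simp: indicator_def)
      qed
    qed
    show "AE x in lborel. norm (indicat_real {- real n..real n} x *\<^sub>R f x) \<le> norm (f x)" for n
      by (auto simp: indicator_def)
  qed (use assms in \<open>auto intro: borel_measurable_integrable\<close>)
  then show ?thesis by (simp add: eq)
qed

text \<open>The factor \<open>((e\<^sup>w - 1)/w)\<^sup>2\<close> with \<open>w = i\<epsilon>z\<close> forces decay on large half circles and is removed
  by dominated convergence as \<open>\<epsilon> \<rightarrow> 0\<close>.\<close>

lemma halfplane_integral_zero:
  assumes \<eta>: "\<eta> > 0" and hol: "P holomorphic_on {z. Im z > - \<eta>}"
    and B: "\<And>z. Im z \<ge> 0 \<Longrightarrow> cmod (P z) \<le> B"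
    and int: "integrable lborel (\<lambda>x. P (complex_of_real x))"
  shows "(LINT x|lborel. P (complex_of_real x)) = 0"
proof -
  define \<phi> where "\<phi> = divdiff exp 0"
  have hol\<phi>: "\<phi> holomorphic_on UNIV" unfolding \<phi>_def by (intro divdiff_holomorphic holomorphic_intros)
  have \<phi>0: "\<phi> 0 = 1" by (simp add: \<phi>_def divdiff_def DERIV_imp_deriv[OF DERIV_exp])
  have \<phi>: "\<phi> w = (exp w - 1) / w" if "w \<noteq> 0" for w using that by (simp add: \<phi>_def divdiff_def)
  have \<phi>1: "cmod (\<phi> (\<i> * complex_of_real y)) \<le> 1" for y
    using cmod_exp_i_minus_one_le[of y] by (cases "y = 0") (auto simp: \<phi>0 \<phi> norm_divide norm_mult divide_le_eq_1)
  \<comment> \<open>For Im z >= 0 the point w = \<i>\<epsilon>z satisfies Re w <= 0, which is the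
    half-plane where this decay holds.\<close>
  have \<phi>2: "cmod (\<phi> w) \<le> 2 / cmod w" if "Re w \<le> 0" "w \<noteq> 0" for w
  proof -
    have "cmod (exp w - 1) \<le> exp (Re w) + 1" using norm_triangle_ineq4[of "exp w" 1] by simp
    also have "\<dots> \<le> 2" using that by simp
    finally show ?thesis using that by (simp add: \<phi> norm_divide divide_right_mono)
  qed
  have B0: "B \<ge> 0" using order_trans[OF norm_ge_zero B[of 0]] by simp
  define Q where "Q = (\<lambda>\<epsilon> z. P z * (\<phi> (\<i> * complex_of_real \<epsilon> * z))\<^sup>2)"
  have holm: "(\<lambda>z. \<phi> (\<i> * complex_of_real \<epsilon> * z)) holomorphic_on A" for \<epsilon> A
    using holomorphic_on_compose_gen[of "\<lambda>z. \<i> * complex_of_real \<epsilon> * z" A \<phi> UNIV] hol\<phi>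
    by (auto simp: o_def intro!: holomorphic_intros)
  have mm: "(\<lambda>x. \<phi> (\<i> * complex_of_real \<epsilon> * complex_of_real x)) \<in> borel_measurable borel" for \<epsilon>
    by (rule entire_measurable[OF holm])
  note mP = borel_measurable_integrable[OF int]
  have dom: "cmod (Q \<epsilon> (complex_of_real x)) \<le> cmod (P (complex_of_real x))" for \<epsilon> x
  proof -
    have "cmod (\<phi> (\<i> * complex_of_real \<epsilon> * complex_of_real x)) \<le> 1" using \<phi>1[of "\<epsilon> * x"] by (simp add: mult.assoc)
    then have "(cmod (\<phi> (\<i> * complex_of_real \<epsilon> * complex_of_real x)))\<^sup>2 \<le> 1" by (simp add: power_le_one)
    then show ?thesis unfolding Q_def norm_mult norm_power
      by (metis mult.right_neutral mult_left_mono norm_ge_zero)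
  qed
  have mQ: "(\<lambda>x. Q \<epsilon> (complex_of_real x)) \<in> borel_measurable lborel" for \<epsilon>
    unfolding Q_def using mm[of \<epsilon>] mP by simp
  have intQ: "integrable lborel (\<lambda>x. Q \<epsilon> (complex_of_real x))" for \<epsilon>
    by (rule Bochner_Integration.integrable_bound[OF int mQ]) (use dom in auto)
  have zero: "(LINT x|lborel. Q \<epsilon> (complex_of_real x)) = 0" if \<epsilon>: "\<epsilon> > 0" for \<epsilon>
  proof -
    have "(\<lambda>n. integral {- real n..real n} (\<lambda>x. Q \<epsilon> (complex_of_real x))) \<longlonglongrightarrow> 0"
    proof (rule Lim_null_comparison)
      show "(\<lambda>n. (4 * B * pi / \<epsilon>\<^sup>2) * (1 / real n)) \<longlonglongrightarrow> 0"
        by (intro tendsto_mult_right_zero lim_1_over_n)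
      show "\<forall>\<^sub>F n in sequentially. cmod (integral {- real n..real n} (\<lambda>x. Q \<epsilon> (complex_of_real x))) \<le> (4 * B * pi / \<epsilon>\<^sup>2) * (1 / real n)"
      proof (rule eventually_sequentiallyI[of 1])
        fix n :: nat assume "n \<ge> 1"
        define R where "R = real n"
        have R: "R > 0" using \<open>n \<ge> 1\<close> by (simp add: R_def)
        let ?l = "linepath (- complex_of_real R) (complex_of_real R)" and ?c = "part_circlepath 0 R 0 pi"
        define U where "U = {z. Im z > - \<eta>}"
        have holQ: "Q \<epsilon> holomorphic_on U" unfolding Q_def U_def by (intro holomorphic_intros hol holm)
        have contQ: "continuous_on U (Q \<epsilon>)" by (rule holomorphic_on_imp_continuous_on[OF holQ])
        have pil: "path_image ?l \<subseteq> U"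
          using \<eta> by (auto simp: U_def closed_segment_same_Im)
        have Imc: "Im w \<ge> 0 \<and> cmod w = R" if "w \<in> path_image ?c" for w
          using that R by (auto simp: path_image_part_circlepath Im_exp norm_mult intro!: mult_nonneg_nonneg sin_ge_zero)
        then have pic: "path_image ?c \<subseteq> U" using \<eta> by (force simp: U_def)
        have "(Q \<epsilon> has_contour_integral 0) (?l +++ ?c)"
          by (rule Cauchy_theorem_convex_simple[OF holQ])
             (use pil pic in \<open>auto simp: U_def convex_halfspace_Im_gt path_image_join exp_Euler
                simp del: path_image_linepath intro!: valid_path_join\<close>)
        moreover have il: "Q \<epsilon> contour_integrable_on ?l" and ic: "Q \<epsilon> contour_integrable_on ?c"
          using contQ pil pic by (auto intro!: contour_integrable_continuous_linepath contour_integrable_continuous_part_circlepath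
              intro: continuous_on_subset)
        ultimately have "contour_integral ?l (Q \<epsilon>) + contour_integral ?c (Q \<epsilon>) = 0"
          using contour_integral_join[OF il ic] by (simp add: contour_integral_unique)
        then have "contour_integral ?l (Q \<epsilon>) = - contour_integral ?c (Q \<epsilon>)" by (simp add: eq_neg_iff_add_eq_0)
        \<comment> \<open>The squared factor is O(1/R^2) on an arc of length pi R, so the arc
          contributes O(1/R); its first power would leave a bound that does not tend to 0.\<close>
        moreover have "cmod (contour_integral ?c (Q \<epsilon>)) \<le> (4 * B / (\<epsilon> * R)\<^sup>2) * R * \<bar>pi - 0\<bar>"
        proof (rule contour_integral_bound_part_circlepath[OF ic])
          show "0 \<le> 4 * B / (\<epsilon> * R)\<^sup>2" using B0 by simp
          fix w assume "w \<in> path_image ?c"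
          then have w: "Im w \<ge> 0" "cmod w = R" using Imc by auto
          have "cmod (\<phi> (\<i> * complex_of_real \<epsilon> * w)) \<le> 2 / cmod (\<i> * complex_of_real \<epsilon> * w)"
            by (rule \<phi>2) (use w \<epsilon> R in auto)
          then have "(cmod (\<phi> (\<i> * complex_of_real \<epsilon> * w)))\<^sup>2 \<le> (2 / (\<epsilon> * R))\<^sup>2"
            using w \<epsilon> by (intro power_mono) (auto simp: norm_mult)
          then have "cmod (P w) * (cmod (\<phi> (\<i> * complex_of_real \<epsilon> * w)))\<^sup>2 \<le> B * (2 / (\<epsilon> * R))\<^sup>2"
            using B[OF w(1)] B0 by (intro mult_mono) auto
          then show "cmod (Q \<epsilon> w) \<le> 4 * B / (\<epsilon> * R)\<^sup>2"
            by (simp add: Q_def norm_mult norm_power power_divide mult.commute)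
        qed (use R in auto)
        ultimately have "cmod (contour_integral ?l (Q \<epsilon>)) \<le> (4 * B / (\<epsilon> * R)\<^sup>2) * R * pi" by simp
        also have "\<dots> = (4 * B * pi / \<epsilon>\<^sup>2) * (1 / R)" using R by (simp add: power2_eq_square)
        also have "contour_integral ?l (Q \<epsilon>) = integral {- R..R} (\<lambda>x. Q \<epsilon> (complex_of_real x))"
          using R by (subst contour_integral_linepath_Reals_eq) auto
        finally show "cmod (integral {- real n..real n} (\<lambda>x. Q \<epsilon> (complex_of_real x))) \<le> (4 * B * pi / \<epsilon>\<^sup>2) * (1 / real n)"
          by (simp add: R_def)
      qed
    qed
    then show ?thesis using integral_tendsto_interval[OF intQ[of \<epsilon>]] LIMSEQ_unique by blast
  qed
  have "(\<lambda>n. LINT x|lborel. Q (1 / real (Suc n)) (complex_of_real x)) \<longlonglongrightarrow> (LINT x|lborel. P (complex_of_real x))"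
  proof (rule integral_dominated_convergence[where w = "\<lambda>x. cmod (P (complex_of_real x))"])
    show "AE x in lborel. (\<lambda>n. Q (1 / real (Suc n)) (complex_of_real x)) \<longlonglongrightarrow> P (complex_of_real x)"
    proof (rule AE_I2)
      fix x :: real
      have e0: "(\<lambda>n. complex_of_real (1 / real (Suc n))) \<longlonglongrightarrow> complex_of_real 0"
        using LIMSEQ_inverse_real_of_nat by (intro tendsto_of_real) (simp add: inverse_eq_divide)
      have "(\<lambda>n. \<i> * complex_of_real (1 / real (Suc n)) * complex_of_real x) \<longlonglongrightarrow> \<i> * complex_of_real 0 * complex_of_real x"
        by (intro tendsto_mult e0 tendsto_const)
      moreover have "isCont \<phi> 0"
        using holomorphic_on_imp_continuous_on[OF hol\<phi>] by (simp add: continuous_on_eq_continuous_at)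
      ultimately have "(\<lambda>n. \<phi> (\<i> * complex_of_real (1 / real (Suc n)) * complex_of_real x)) \<longlonglongrightarrow> \<phi> 0"
        using isCont_tendsto_compose[of 0 \<phi>] by simp
      then have "(\<lambda>n. P (complex_of_real x) * (\<phi> (\<i> * complex_of_real (1 / real (Suc n)) * complex_of_real x))\<^sup>2) \<longlonglongrightarrow> P (complex_of_real x) * (\<phi> 0)\<^sup>2"
        by (intro tendsto_intros)
      then show "(\<lambda>n. Q (1 / real (Suc n)) (complex_of_real x)) \<longlonglongrightarrow> P (complex_of_real x)"
        by (simp add: Q_def \<phi>0)
    qed
    show "AE x in lborel. norm (Q (1 / real (Suc n)) (complex_of_real x)) \<le> cmod (P (complex_of_real x))" for n
      using dom by auto
  qed (use mP mQ int in auto)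
  then show ?thesis using zero LIMSEQ_unique[OF _ tendsto_const] by auto
qed

text \<open>This number is pi, in the form in which the norm of the Cauchy kernel produces
  it.\<close>

definition arctan_mass :: real where
  "arctan_mass = (LINT x|lborel. 1 / (1 + x\<^sup>2))"

lemma arctan_mass_pos: "arctan_mass > 0"
proof -
  have "arctan_mass \<noteq> 0"
  proof
    assume "arctan_mass = 0"
    then have "AE x in lborel. 1 / (1 + x\<^sup>2) = (0::real)"
      unfolding arctan_mass_def using integrable_inverse_one_plus_square
      by (subst (asm) integral_nonneg_eq_0_iff_AE) auto
    moreover have "1 / (1 + x\<^sup>2) \<noteq> (0::real)" for x :: real
      by (smt (verit) divide_eq_0_iff zero_le_power2)
    ultimately have "AE x::real in lborel. False" by simp
    then have "emeasure lborel (UNIV :: real set) = 0" using AE_iff_measurable[of UNIV "lborel :: real measure" "\<lambda>_. False"] by simp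
    then show False by simp
  qed
  moreover have "arctan_mass \<ge> 0" unfolding arctan_mass_def by simp
  ultimately show ?thesis by linarith
qed

lemma cauchy_kernel_L2:
  assumes w: "Im w > 0"
  shows "(\<lambda>z. 1 / (z - cnj w)) \<in> L2fun lborel"
    and "nsq lborel (\<lambda>z. 1 / (z - cnj w)) = arctan_mass / Im w"
proof -
  define v where "v = Im w"
  have v: "v > 0" using w by (simp add: v_def)
  let ?g = "\<lambda>x. (cmod (1 / (complex_of_real x - cnj w)))\<^sup>2"
  have g: "?g (Re w + v * x) = (1 / v\<^sup>2) * (1 / (1 + x\<^sup>2))" for x
  proof -
    have "(cmod (complex_of_real (Re w + v * x) - cnj w))\<^sup>2 = v\<^sup>2 * (1 + x\<^sup>2)"
      by (simp add: cmod_power2 v_def power_mult_distrib algebra_simps)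
    then show ?thesis by (simp add: norm_divide power_divide)
  qed
  have "integrable lborel (\<lambda>x. ?g (Re w + v * x))"
    unfolding g by (intro integrable_mult_right integrable_inverse_one_plus_square)
  then have int: "integrable lborel ?g"
    using lborel_integrable_real_affine_iff[of v ?g "Re w"] v by simp
  have nz: "complex_of_real x - cnj w \<noteq> 0" for x using w by (auto simp: complex_eq_iff)
  have "continuous_on UNIV (\<lambda>x. 1 / (complex_of_real x - cnj w))"
    by (intro continuous_intros) (use nz in auto)
  then have "(\<lambda>x. 1 / (complex_of_real x - cnj w)) \<in> borel_measurable lborel"
    by (simp add: borel_measurable_continuous_onI)
  with int show "(\<lambda>z. 1 / (z - cnj w)) \<in> L2fun lborel" by (intro L2funI)
  have "(LINT x|lborel. ?g x) = \<bar>v\<bar> *\<^sub>R (LINT x|lborel. ?g (Re w + v * x))"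
    using v by (intro lborel_integral_real_affine) auto
  also have "\<dots> = v * ((1 / v\<^sup>2) * arctan_mass)"
    unfolding g arctan_mass_def using v by (subst Bochner_Integration.integral_mult_right_zero) simp
  also have "\<dots> = arctan_mass / v" using v by (simp add: power2_eq_square)
  finally show "nsq lborel (\<lambda>z. 1 / (z - cnj w)) = arctan_mass / Im w" by (simp add: nsq_def v_def)
qed

text \<open>Instead of a residue at \<open>w\<close>, a multiple of the Cauchy kernel 1/(z - cnj w)
  is subtracted from \<open>Y\<close> so that the difference vanishes at \<open>w\<close>. Divided
  by z - w it is holomorphic across the real line and integrable on it, as both parts are products
  of square integrable functions. Its integral is 0, and the subtracted part contributes the squared
  norm of the Cauchy kernel.\<close>

lemma cauchy_formula_halfplane:
  assumes hol: "Y holomorphic_on UNIV" and L2: "Y \<in> L2fun lborel"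
    and B: "\<And>z. Im z \<ge> 0 \<Longrightarrow> cmod (Y z) \<le> B" and w: "Im w > 0"
  shows "ip lborel Y (\<lambda>z. 1 / (z - cnj w)) = 2 * \<i> * complex_of_real arctan_mass * Y w"
proof -
  define v where "v = Im w"
  have v: "v > 0" using w by (simp add: v_def)
  define c where "c = 2 * \<i> * complex_of_real v"
  define q where "q = (\<lambda>z. 1 / (z - cnj w))"
  define U where "U = {z. Im z > - v}"
  have U: "open U" unfolding U_def by (rule open_halfspace_Im_gt)
  have wc: "w - cnj w = c" by (simp add: c_def v_def complex_eq_iff)
  have c0: "c \<noteq> 0" using v by (simp add: c_def)
  define g where "g = (\<lambda>z. Y z - Y w * c / (z - cnj w))"
  have gw: "g w = 0" using c0 by (simp add: g_def wc)
  have holg: "g holomorphic_on U" unfolding g_def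
    by (intro holomorphic_intros holomorphic_on_subset[OF hol]) (auto simp: U_def v_def complex_eq_iff)
  \<comment> \<open>The zero of \<open>g\<close> at \<open>w\<close> is divided out; the remaining
    singularity cnj w has height -v, so \<open>P\<close> is holomorphic above it.\<close>
  define P where "P = divdiff g w"
  have holP: "P holomorphic_on U"
    using pole_lemma_open[OF holg U, of w] by (simp add: P_def divdiff_def[abs_def])
  have P: "P z = g z / (z - w)" if "z \<noteq> w" for z using that gw by (simp add: P_def divdiff_def)
  have B0: "B \<ge> 0" using order_trans[OF norm_ge_zero B[of 0]] by simp
  have sub: "cball w (v/2) \<subseteq> U"
  proof
    fix z assume "z \<in> cball w (v/2)"
    then have "\<bar>Im (z - w)\<bar> \<le> v/2" using abs_Im_le_cmod[of "z - w"] by (simp add: dist_norm norm_minus_commute)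
    then have "Im z - Im w \<ge> - (v/2)" unfolding minus_complex.sel by linarith
    then show "z \<in> U" using v by (simp add: U_def v_def)
  qed
  have "compact (P ` cball w (v/2))"
    by (intro compact_continuous_image continuous_on_subset[OF holomorphic_on_imp_continuous_on[OF holP] sub]) auto
  then obtain D where D: "D > 0" "\<And>z. z \<in> cball w (v/2) \<Longrightarrow> cmod (P z) \<le> D"
    using compact_imp_bounded bounded_pos by (metis imageI)
  have bd: "cmod (P z) \<le> max D (3 * B / (v/2))" if z: "Im z \<ge> 0" for z
  proof (cases "z \<in> cball w (v/2)")
    case True then show ?thesis using D(2)[OF True] by simp
  next
    case False
    then have d: "cmod (z - w) \<ge> v/2" by (simp add: dist_norm norm_minus_commute)
    then have ne: "z \<noteq> w" using v by auto
    have "cmod (z - cnj w) \<ge> v" using abs_Im_le_cmod[of "z - cnj w"] z v by (simp add: v_def)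
    then have "cmod (Y w * c / (z - cnj w)) \<le> (B * (2 * v)) / v"
      unfolding norm_divide norm_mult using B[of w] w v B0
      by (intro frac_le mult_mono) (auto simp: c_def norm_mult)
    also have "\<dots> = 2 * B" using v by simp
    finally have "cmod (g z) \<le> 3 * B"
      using norm_triangle_ineq4[of "Y z" "Y w * c / (z - cnj w)"] B[OF z] by (simp add: g_def)
    then have "cmod (g z) / cmod (z - w) \<le> 3 * B / (v/2)"
      using d v B0 by (intro frac_le) auto
    then show ?thesis by (simp add: P[OF ne] norm_divide)
  qed
  note qL2 = cauchy_kernel_L2[OF w, folded q_def]
  have Px: "P (complex_of_real x) = Y (complex_of_real x) * cnj (q (complex_of_real x)) - Y w * c * (q (complex_of_real x) * cnj (q (complex_of_real x)))" for x
  proof -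
    have "complex_of_real x \<noteq> w" "complex_of_real x - w \<noteq> 0" using w by auto
    then show ?thesis by (simp add: P g_def q_def diff_divide_distrib)
  qed
  have i1: "integrable lborel (\<lambda>x. Y (complex_of_real x) * cnj (q (complex_of_real x)))"
    by (rule L2fun_prod_integrable[OF L2 qL2(1)])
  have i2: "integrable lborel (\<lambda>x. q (complex_of_real x) * cnj (q (complex_of_real x)))"
    by (rule L2fun_prod_integrable[OF qL2(1) qL2(1)])
  have intP: "integrable lborel (\<lambda>x. P (complex_of_real x))"
    unfolding Px by (intro Bochner_Integration.integrable_diff i1 integrable_mult_right i2)
  have "0 = (LINT x|lborel. P (complex_of_real x))"
    by (rule halfplane_integral_zero[OF v _ bd intP, symmetric]) (use holP in \<open>auto simp: U_def\<close>)
  also have "\<dots> = ip lborel Y q - Y w * c * ip lborel q q"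
    unfolding Px ip_def by (subst Bochner_Integration.integral_diff) (use i1 i2 in auto)
  also have "ip lborel q q = complex_of_real (arctan_mass / v)" by (simp add: ip_self qL2 v_def)
  finally have "ip lborel Y q = Y w * c * complex_of_real (arctan_mass / v)" by simp
  then show ?thesis using v by (simp add: q_def c_def)
qed

section \<open>Spectra on the half-line and the backward shift\<close>


definition osc :: "real \<Rightarrow> complex \<Rightarrow> complex" where
  "osc c z = exp (\<i> * complex_of_real c * z)"

lemma osc_add: "osc a z * osc b z = osc (a + b) z"
  by (simp add: osc_def algebra_simps flip: exp_add)

lemma osc_cancel [simp]: "osc (- a) z * (osc a z * w) = w" "osc a z * (osc (- a) z * w) = w"
  by (simp_all add: osc_add mult.assoc[symmetric]) (simp_all add: osc_def)

lemma osc_0 [simp]: "osc c 0 = 1"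
  by (simp add: osc_def)

lemma norm_osc: "cmod (osc c z) = exp (- c * Im z)"
  unfolding osc_def by (rule norm_exp_i_real)

lemma osc_holomorphic: "osc c holomorphic_on A"
  unfolding osc_def[abs_def] by (intro holomorphic_intros)

lemma osc_exp_type: "\<bar>c\<bar> \<le> t \<Longrightarrow> exp_type_le t (osc c)"
proof -
  assume c: "\<bar>c\<bar> \<le> t"
  have "exp_type_le 0 (\<lambda>z. 1)" unfolding exp_type_le_def by (auto intro!: exI[of _ 1])
  from exp_type_le_exp_mult[OF this, of c] show ?thesis
    using c by (auto simp: osc_def[abs_def] intro: exp_type_le_mono)
qed

lemmas PW_osc = PW_exp_mult[folded osc_def]
lemmas L2fun_osc = L2fun_exp_mult[folded osc_def]
lemmas nsq_osc = nsq_exp_mult[folded osc_def]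
lemmas ip_osc = ip_exp_mult[folded osc_def]

text \<open>\<open>PWs t\<close> is \<open>PW t\<close> with its spectrum translated from \<open>[-t,t]\<close> to \<open>[0,2t]\<close>; the backward
  shift \<open>F \<mapsto> (F - F 0)/(iz)\<close> acts on it.\<close>

definition PWs :: "real \<Rightarrow> (complex \<Rightarrow> complex) set" where
  "PWs t = {F. (\<lambda>z. osc (- t) z * F z) \<in> PW t}"

lemma PWsI: "f \<in> PW t \<Longrightarrow> (\<lambda>z. osc t z * f z) \<in> PWs t"
  by (simp add: PWs_def)

lemma PWsE:
  assumes "F \<in> PWs t" obtains f where "f \<in> PW t" "F = (\<lambda>z. osc t z * f z)"
  using assms that[of "\<lambda>z. osc (- t) z * F z"] by (simp add: PWs_def)

lemma PWs_holomorphic: "F \<in> PWs t \<Longrightarrow> F holomorphic_on UNIV"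
  by (erule PWsE) (auto intro!: holomorphic_on_mult osc_holomorphic intro: PW_holomorphic)

lemma PWs_add: "F \<in> PWs t \<Longrightarrow> G \<in> PWs t \<Longrightarrow> (\<lambda>z. F z + G z) \<in> PWs t"
  using PW_add by (fastforce simp: PWs_def distrib_left)

lemma PWs_diff: "F \<in> PWs t \<Longrightarrow> G \<in> PWs t \<Longrightarrow> (\<lambda>z. F z - G z) \<in> PWs t"
  using PW_diff by (fastforce simp: PWs_def right_diff_distrib)

lemma PWs_zero: "(\<lambda>z. 0) \<in> PWs t"
proof -
  have "exp_type_le t (\<lambda>z. 0)" by (auto simp: exp_type_le_def intro!: exI[of _ 0])
  then show ?thesis by (auto simp: PWs_def intro!: PWI L2fun_zero)
qed

lemma PWs_sum: "(\<And>i. i \<in> A \<Longrightarrow> F i \<in> PWs t) \<Longrightarrow> (\<lambda>z. \<Sum>i\<in>A. F i z) \<in> PWs t"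
  by (induction A rule: infinite_finite_induct) (auto simp: PWs_zero intro: PWs_add)

lemma PWs_mono:
  assumes "F \<in> PWs s" "s \<le> t" shows "F \<in> PWs t"
proof -
  have "(\<lambda>z. osc (s - t) z * (osc (- s) z * F z)) \<in> PW t"
    by (rule PW_osc) (use assms in \<open>auto simp: PWs_def\<close>)
  then show ?thesis by (simp add: PWs_def osc_add mult.assoc[symmetric])
qed

lemma PWs_pointwise_bound:
  assumes "F \<in> PWs t" "t \<ge> 0"
  shows "(cmod (F z))\<^sup>2 \<le> exp (2 + 2 * t) * exp (2 * t * (\<bar>Im z\<bar> - Im z)) * nsq lborel F"
proof -
  obtain f where f: "f \<in> PW t" "F = (\<lambda>z. osc t z * f z)" using PWsE[OF assms(1)] .
  have "(cmod (osc t z))\<^sup>2 * (cmod (f z))\<^sup>2 \<le> exp (- (2 * t * Im z)) * (exp (2 + 2 * t) * exp (2 * t * \<bar>Im z\<bar>) * nsq lborel f)"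
    using PW_pointwise_bound[OF f(1) assms(2), of z]
    by (intro mult_mono) (auto simp: norm_osc algebra_simps simp flip: exp_double)
  also have "\<dots> = exp (2 + 2 * t) * (exp (- (2 * t * Im z)) * exp (2 * t * \<bar>Im z\<bar>)) * nsq lborel f"
    by (simp only: mult_ac)
  also have "exp (- (2 * t * Im z)) * exp (2 * t * \<bar>Im z\<bar>) = exp (2 * t * (\<bar>Im z\<bar> - Im z))"
    by (simp add: algebra_simps flip: exp_add)
  finally show ?thesis by (simp add: f(2) norm_mult power_mult_distrib nsq_osc)
qed

text \<open>In terms of growth, this is what a spectrum in [0,2t] means: boundedness above the real
  line and type 2t below it.\<close>

lemma PWs_bounds:
  assumes "F \<in> PWs t" "t \<ge> 0"
  obtains b where "b > 0" "\<And>z. Im z \<ge> 0 \<Longrightarrow> cmod (F z) \<le> b" "\<And>z. Im z \<ge> 0 \<Longrightarrow> cmod (F (cnj z)) \<le> b * exp (2 * t * Im z)"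
proof -
  define c where "c = exp (2 + 2 * t) * nsq lborel F"
  have c0: "c \<ge> 0" by (simp add: c_def)
  show ?thesis
  proof (rule that[of "sqrt c + 1"])
    show "sqrt c + 1 > 0" using c0 by (simp add: add_nonneg_pos)
    fix z assume z: "Im z \<ge> 0"
    have "(cmod (F z))\<^sup>2 \<le> c" using PWs_pointwise_bound[OF assms, of z] z by (simp add: c_def)
    then show "cmod (F z) \<le> sqrt c + 1" using real_le_rsqrt by fastforce
    have "(cmod (F (cnj z)))\<^sup>2 \<le> c * exp (2 * (2 * t * Im z))"
      using PWs_pointwise_bound[OF assms, of "cnj z"] z by (simp add: c_def mult_ac)
    also have "\<dots> = (sqrt c * exp (2 * t * Im z))\<^sup>2"
      using c0 unfolding power_mult_distrib exp_double[symmetric] by simp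
    finally have "cmod (F (cnj z)) \<le> sqrt c * exp (2 * t * Im z)"
      by (rule power2_le_imp_le) (use c0 in auto)
    also have "\<dots> \<le> (sqrt c + 1) * exp (2 * t * Im z)" by (intro mult_right_mono) auto
    finally show "cmod (F (cnj z)) \<le> (sqrt c + 1) * exp (2 * t * Im z)" .
  qed
qed

lemma PWs_L2fun_lborel: "F \<in> PWs t \<Longrightarrow> F \<in> L2fun lborel"
  by (erule PWsE) (auto intro!: L2fun_osc intro: PW_L2fun)

lemma PWs_L2fun: "PW_sampling \<nu> \<Longrightarrow> F \<in> PWs t \<Longrightarrow> t > 0 \<Longrightarrow> F \<in> L2fun \<nu>"
  by (erule PWsE) (auto intro!: L2fun_osc PW_sampling_sets intro: PW_L2fun_sampling)

text \<open>Identities that contain a division by z are checked away from one point and extended by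
  continuity, which avoids a separate computation at the removable singularity.\<close>

lemma entire_eq_off_point:
  assumes "f holomorphic_on UNIV" "g holomorphic_on UNIV" "\<And>z. z \<noteq> a \<Longrightarrow> f z = g z"
  shows "f z = g z"
proof (cases "z = a")
  case True
  have "f \<midarrow>a\<rightarrow> f a" "g \<midarrow>a\<rightarrow> g a"
    using assms(1,2)[THEN holomorphic_on_imp_continuous_on] by (simp_all add: continuous_on_def)
  moreover have "f \<midarrow>a\<rightarrow> g a \<longleftrightarrow> g \<midarrow>a\<rightarrow> g a"
    by (rule tendsto_cong) (use assms(3) in \<open>auto simp: eventually_at_filter\<close>)
  ultimately show ?thesis using True LIM_unique by blast
qed (rule assms(3))

definition bshift :: "(complex \<Rightarrow> complex) \<Rightarrow> complex \<Rightarrow> complex" where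
  "bshift F z = - \<i> * divdiff F 0 z"

lemma bshift_eq: "z \<noteq> 0 \<Longrightarrow> bshift F z = (F z - F 0) / (\<i> * z)"
  by (simp add: bshift_def divdiff_eq field_simps)

lemma bshift_holomorphic: "F holomorphic_on UNIV \<Longrightarrow> bshift F holomorphic_on UNIV"
  unfolding bshift_def[abs_def] by (intro holomorphic_intros divdiff_holomorphic)

text \<open>Without the factor exp(itz) the numerator becomes f(z) - F(0) exp(-itz). It has type t,
  is bounded on the real line and vanishes at 0, so its divided difference lies in
  \<open>PW t\<close>.\<close>

lemma bshift_PWs:
  assumes F: "F \<in> PWs t" and t: "t \<ge> 0"
  shows "bshift F \<in> PWs t"
proof -
  obtain f where f: "f \<in> PW t" "F = (\<lambda>z. osc t z * f z)" using PWsE[OF F] .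
  define g where "g = (\<lambda>z. f z - F 0 * osc (- t) z)"
  define b where "b = sqrt (exp (2 + 2 * t) * nsq lborel f) + cmod (F 0)"
  have "divdiff g 0 \<in> PW t"
  proof (rule PW_divdiff[where B = b])
    show "g holomorphic_on UNIV" unfolding g_def
      by (intro holomorphic_intros PW_holomorphic[OF f(1)] osc_holomorphic)
    have "exp_type_le t (\<lambda>z. f z + (- F 0) * osc (- t) z)"
      by (intro exp_type_le_add exp_type_le_scale PW_exp_type[OF f(1)] osc_exp_type) (use t in auto)
    then show "exp_type_le t g" by (simp add: g_def)
    fix x
    have "cmod (f (complex_of_real x)) \<le> sqrt (exp (2 + 2 * t) * nsq lborel f)"
      using PW_pointwise_bound[OF f(1) t, of "complex_of_real x"] by (intro real_le_rsqrt) simp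
    moreover have "cmod (F 0 * osc (- t) (complex_of_real x)) = cmod (F 0)" by (simp add: norm_mult norm_osc)
    ultimately show "cmod (g (complex_of_real x)) \<le> b"
      unfolding g_def b_def by (intro order_trans[OF norm_triangle_ineq4] add_mono) auto
  qed (rule t)
  then have PW: "(\<lambda>z. - \<i> * divdiff g 0 z) \<in> PW t" by (rule PW_scale)
  have "osc (- t) z * bshift F z = - \<i> * divdiff g 0 z" for z
  proof (rule entire_eq_off_point[where f = "\<lambda>z. osc (- t) z * bshift F z" and a = 0])
    show "(\<lambda>z. osc (- t) z * bshift F z) holomorphic_on UNIV"
      by (intro holomorphic_intros osc_holomorphic bshift_holomorphic PWs_holomorphic[OF F])
    show "(\<lambda>z. - \<i> * divdiff g 0 z) holomorphic_on UNIV" by (rule PW_holomorphic[OF PW])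
    fix z :: complex assume "z \<noteq> 0"
    moreover have "g 0 = 0" by (simp add: g_def f(2))
    moreover have "osc (- t) z * F z = f z" by (simp add: f(2))
    ultimately show "osc (- t) z * bshift F z = - \<i> * divdiff g 0 z"
      by (simp add: bshift_def divdiff_eq g_def algebra_simps diff_divide_distrib)
  qed
  then show ?thesis using PW by (simp add: PWs_def)
qed

text \<open>Division by exp(isz) turns the smaller space into \<open>PW s\<close> and
  \<open>F\<close> into a function of type t + (t-s), which is at most 2t. The element of least norm
  in the coset of \<open>PW s\<close> is the orthogonal component; Lebesgue measure itself serves as
  the sampling measure.\<close>

lemma PWs_projection:
  assumes F: "F \<in> PWs t" and s: "s > 0" "s < t"
  obtains R where "R \<in> PWs s" "\<And>H. H \<in> PWs s \<Longrightarrow> ip lborel (\<lambda>z. F z - R z) H = 0"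
proof -
  obtain f where f: "f \<in> PW t" "F = (\<lambda>z. osc t z * f z)" using PWsE[OF F] .
  define g where "g = (\<lambda>z. osc (t - s) z * f z)"
  have g: "g \<in> PW (2 * t)" unfolding g_def by (rule PW_osc[OF f(1)]) (use s in auto)
  have Fg: "F = (\<lambda>z. osc s z * g z)" by (simp add: f(2) g_def osc_add mult.assoc[symmetric])
  define V where "V = (\<lambda>r z. g z - r z) ` PW s"
  have zero: "(\<lambda>z. 0) \<in> PW s" using PWs_zero[of s] by (simp add: PWs_def)
  have up: "r \<in> PW (2 * t)" if "r \<in> PW s" for r by (rule PW_mono[OF that]) (use s in auto)
  obtain f0 where f0: "f0 \<in> V" "\<And>h. h \<in> V \<Longrightarrow> nsq lborel f0 \<le> nsq lborel h"
  proof (rule PW_min_norm_exists[OF PW_sampling_lborel, of "2 * t" V])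
    show "2 * t > 0" using s by simp
    show "V \<subseteq> PW (2 * t)" using g up PW_diff by (auto simp: V_def)
    show "V \<noteq> {}" using zero by (auto simp: V_def)
    show "(\<lambda>z. (a z + b z) / 2) \<in> V" if "a \<in> V" "b \<in> V" for a b
    proof -
      obtain p q where "p \<in> PW s" "q \<in> PW s" "a = (\<lambda>z. g z - p z)" "b = (\<lambda>z. g z - q z)"
        using \<open>a \<in> V\<close> \<open>b \<in> V\<close> by (auto simp: V_def)
      then have "(\<lambda>z. (1/2) * (p z + q z)) \<in> PW s"
        by (intro PW_scale PW_add)
      moreover have "(\<lambda>z. (a z + b z) / 2) = (\<lambda>z. g z - (1/2) * (p z + q z))"
        using \<open>a = _\<close> \<open>b = _\<close> by (auto simp: field_simps)
      ultimately show ?thesis unfolding V_def by (intro rev_image_eqI)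
    qed
    show "h \<in> V" if H: "\<And>n. H n \<in> V" "h \<in> PW (2 * t)" "\<And>z. (\<lambda>n. H n z) \<longlonglongrightarrow> h z"
      "(\<lambda>n. nsq lborel (\<lambda>z. H n z - h z)) \<longlonglongrightarrow> 0" for H h
    proof -
      have "\<exists>r. r \<in> PW s \<and> H n = (\<lambda>z. g z - r z)" for n using H(1)[of n] by (auto simp: V_def)
      then obtain r where r: "\<And>n. r n \<in> PW s" "\<And>n. H n = (\<lambda>z. g z - r n z)" by metis
      have Hd: "(\<lambda>z. H n z - h z) \<in> L2fun lborel" for n
        using PW_L2fun[OF PW_diff[OF PW_diff[OF g up[OF r(1)[of n]]] H(2)]] by (simp add: r(2))
      \<comment> \<open>The coset is closed: differences of the \<open>r n\<close> are, up to sign,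
        differences of the \<open>H n\<close>, so \<open>r\<close> is Cauchy and has its limit in
        \<open>PW s\<close>.\<close>
      have "\<exists>M. \<forall>m\<ge>M. \<forall>n\<ge>M. nsq lborel (\<lambda>z. r m z - r n z) \<le> e" if e: "e > 0" for e
      proof -
        obtain M where M: "\<And>n. n \<ge> M \<Longrightarrow> nsq lborel (\<lambda>z. H n z - h z) < e / 4"
          using LIMSEQ_D[OF H(4), of "e/4"] e by auto
        have "nsq lborel (\<lambda>z. r m z - r n z) \<le> e" if "m \<ge> M" "n \<ge> M" for m n
        proof -
          have "nsq lborel (\<lambda>z. (H n z - h z) + (-1) * (H m z - h z)) \<le> 2 * nsq lborel (\<lambda>z. H n z - h z) + 2 * nsq lborel (\<lambda>z. (-1) * (H m z - h z))"
            by (intro nsq_add_le L2fun_scale Hd)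
          moreover have "(\<lambda>z. (H n z - h z) + (-1) * (H m z - h z)) = (\<lambda>z. r m z - r n z)"
            by (simp add: r(2))
          moreover have "nsq lborel (\<lambda>z. (-1) * (H m z - h z)) = nsq lborel (\<lambda>z. H m z - h z)"
            unfolding nsq_scale by simp
          ultimately show ?thesis using M[OF that(1)] M[OF that(2)] by simp
        qed
        then show ?thesis by blast
      qed
      then have "\<exists>q. q \<in> PW s \<and> (\<forall>z. (\<lambda>n. r n z) \<longlonglongrightarrow> q z)"
        using PW_complete[of r s] r(1) s by (metis less_imp_le)
      then obtain q where q: "q \<in> PW s" "\<And>z. (\<lambda>n. r n z) \<longlonglongrightarrow> q z" by blast
      have "h z = g z - q z" for z
      proof (rule LIMSEQ_unique[OF H(3)])
        show "(\<lambda>n. H n z) \<longlonglongrightarrow> g z - q z" unfolding r(2) by (intro tendsto_intros q)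
      qed
      then show "h \<in> V" using q(1) unfolding V_def by blast
    qed
  qed blast
  obtain r where r: "r \<in> PW s" "f0 = (\<lambda>z. g z - r z)" using f0(1) by (auto simp: V_def)
  have orth: "ip lborel f0 h = 0" if h: "h \<in> PW s" for h
  proof (rule minimal_imp_orthogonal)
    show "f0 \<in> L2fun lborel" unfolding r(2) by (rule PW_L2fun[OF PW_diff[OF g up[OF r(1)]]])
    show "h \<in> L2fun lborel" by (rule PW_L2fun[OF h])
    fix c
    have "(\<lambda>z. f0 z - c * h z) = (\<lambda>z. g z - (r z + c * h z))" by (simp add: r(2) algebra_simps)
    then have "(\<lambda>z. f0 z - c * h z) \<in> V" unfolding V_def
      by (intro rev_image_eqI[OF PW_add[OF r(1) PW_scale[OF h, of c]]])
    then show "nsq lborel f0 \<le> nsq lborel (\<lambda>z. f0 z - c * h z)" by (rule f0(2))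
  qed
  show ?thesis
  proof (rule that[OF PWsI[OF r(1)]])
    fix H assume "H \<in> PWs s"
    then obtain h where h: "h \<in> PW s" "H = (\<lambda>z. osc s z * h z)" using PWsE by blast
    have "(\<lambda>z. F z - osc s z * r z) = (\<lambda>z. osc s z * f0 z)" by (simp add: Fg r(2) right_diff_distrib)
    then show "ip lborel (\<lambda>z. F z - osc s z * r z) H = 0" using orth[OF h(1)] by (simp add: h(2) ip_osc)
  qed
qed

text \<open>Orthogonality to spectra in [0,2s] leaves spectra above 2s, hence the rate 2s. By
  Cauchy's formula Y(w) is an inner product with the Cauchy kernel \<open>q\<close>, and (1 -
  \<open>m\<close>)\<open>q\<close> belongs to the smaller space, because 1 - \<open>m\<close>
  vanishes at the pole of \<open>q\<close>. Thus \<open>q\<close> may be replaced by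
  \<open>m\<close> times \<open>q\<close>, which is exponentially small.\<close>

lemma orthogonal_decay:
  assumes Y: "Y \<in> PWs t" and t: "t \<ge> 0" and s: "s > 0"
    and orth: "\<And>H. H \<in> PWs s \<Longrightarrow> ip lborel Y H = 0"
  obtains b where "b > 0" "\<And>w. Im w \<ge> 1 \<Longrightarrow> cmod (Y w) \<le> b * exp (- (2 * s * Im w))"
proof -
  define b where "b = sqrt (nsq lborel Y * arctan_mass) / (2 * arctan_mass) + 1"
  obtain B where B: "\<And>z. Im z \<ge> 0 \<Longrightarrow> cmod (Y z) \<le> B" using PWs_bounds[OF Y t] by metis
  note L2 = PWs_L2fun_lborel[OF Y]
  note m0 = arctan_mass_pos
  show ?thesis
  proof (rule that[of b])
    show "b > 0" using m0 by (simp add: b_def add_nonneg_pos)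
    fix w assume w1: "Im w \<ge> 1"
    then have w: "Im w > 0" by simp
    define q where "q = (\<lambda>z. 1 / (z - cnj w))"
    note q = cauchy_kernel_L2[OF w, folded q_def]
    \<comment> \<open>On the real line the modulus of \<open>m\<close> is constant, namely exp(-2s
      Im w).\<close>
    define m where "m = (\<lambda>z. osc (2 * s) (z - cnj w))"
    have nm: "cmod (m (complex_of_real x)) = exp (- (2 * s * Im w))" for x by (simp add: m_def norm_osc)
    have "(\<lambda>z. m z) holomorphic_on UNIV" unfolding m_def osc_def by (intro holomorphic_intros)
    then have mm: "(\<lambda>x. m (complex_of_real x)) \<in> borel_measurable lborel"
      using entire_measurable by auto
    have mq: "(\<lambda>z. m z * q z) \<in> L2fun lborel" "nsq lborel (\<lambda>z. m z * q z) \<le> (exp (- (2 * s * Im w)))\<^sup>2 * nsq lborel q"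
      using L2fun_mult_bounded[OF q(1) mm] nm by auto
    define d where "d = divdiff (\<lambda>z. sin (complex_of_real s * (z + - cnj w))) (cnj w)"
    have d: "d \<in> PW s" unfolding d_def
    proof (rule PW_divdiff[where B = "exp (s * Im w)"])
      show "(\<lambda>z. sin (complex_of_real s * (z + - cnj w))) holomorphic_on UNIV" by (intro holomorphic_intros)
      show "exp_type_le s (\<lambda>z. sin (complex_of_real s * (z + - cnj w)))"
        using exp_type_le_translate[OF sin_exp_type[of s], of "- cnj w"] s by simp
      show "cmod (sin (complex_of_real s * (complex_of_real x + - cnj w))) \<le> exp (s * Im w)" for x
        using sin_real_mult_bound[of s "complex_of_real x + - cnj w"] s w by simp
    qed (use s in auto)
    define c where "c = - 2 * \<i> * osc s (- cnj w)"
    have H: "(\<lambda>z. osc s z * (c * d z)) \<in> PWs s" by (intro PWsI PW_scale d)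
    \<comment> \<open>With u = s(x - cnj w), the identity 1 - exp(2iu) = -2i exp(iu) sin u exhibits
      exp(isx) times a divided difference of a sine.\<close>
    have eq: "q (complex_of_real x) - m (complex_of_real x) * q (complex_of_real x) = osc s (complex_of_real x) * (c * d (complex_of_real x))" for x
    proof -
      let ?z = "complex_of_real x - cnj w"
      have nz: "?z \<noteq> 0" using w by (auto simp: complex_eq_iff)
      have "1 - osc (2 * s) ?z = - 2 * \<i> * osc s ?z * sin (complex_of_real s * ?z)"
        unfolding osc_def sin_exp_eq by (simp add: field_simps flip: exp_add)
      moreover have "osc s ?z = osc s (complex_of_real x) * osc s (- cnj w)"
        unfolding osc_def by (simp add: algebra_simps flip: exp_add)
      moreover have "d (complex_of_real x) = sin (complex_of_real s * ?z) / ?z"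
        using nz by (simp add: d_def divdiff_eq)
      ultimately have "(1 - osc (2 * s) ?z) / ?z = osc s (complex_of_real x) * (c * d (complex_of_real x))"
        by (simp add: c_def)
      then show ?thesis by (simp add: q_def m_def diff_divide_distrib)
    qed
    have "ip lborel Y (\<lambda>z. q z - m z * q z) = ip lborel Y (\<lambda>z. osc s z * (c * d z))"
      unfolding ip_def eq ..
    then have "ip lborel Y q = ip lborel Y (\<lambda>z. m z * q z)"
      using orth[OF H] ip_diff_right[OF q(1) mq(1) L2] by simp
    then have "(cmod (ip lborel Y q))\<^sup>2 \<le> nsq lborel Y * nsq lborel (\<lambda>z. m z * q z)"
      using nsq_cauchy_schwarz[OF L2 mq(1)] by simp
    also have "\<dots> \<le> nsq lborel Y * ((exp (- (2 * s * Im w)))\<^sup>2 * arctan_mass)"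
    proof (rule mult_left_mono)
      have "arctan_mass / Im w \<le> arctan_mass / 1" using w1 m0 by (intro divide_left_mono) auto
      then have "(exp (- (2 * s * Im w)))\<^sup>2 * nsq lborel q \<le> (exp (- (2 * s * Im w)))\<^sup>2 * arctan_mass"
        unfolding q(2) by (intro mult_left_mono) auto
      then show "nsq lborel (\<lambda>z. m z * q z) \<le> (exp (- (2 * s * Im w)))\<^sup>2 * arctan_mass" using mq(2) by linarith
    qed simp
    also have "\<dots> = (sqrt (nsq lborel Y * arctan_mass) * exp (- (2 * s * Im w)))\<^sup>2"
      using m0 by (simp add: power_mult_distrib)
    finally have le: "cmod (ip lborel Y q) \<le> sqrt (nsq lborel Y * arctan_mass) * exp (- (2 * s * Im w))"
      by (rule power2_le_imp_le) (use m0 in auto)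
    have "cmod (ip lborel Y q) = 2 * arctan_mass * cmod (Y w)"
      using cauchy_formula_halfplane[OF PWs_holomorphic[OF Y] L2 B w] m0 by (simp add: q_def norm_mult)
    then have "cmod (Y w) \<le> (sqrt (nsq lborel Y * arctan_mass) / (2 * arctan_mass)) * exp (- (2 * s * Im w))"
      using le m0 by (simp add: field_simps)
    also have "\<dots> \<le> b * exp (- (2 * s * Im w))" unfolding b_def by (intro mult_right_mono) auto
    finally show "cmod (Y w) \<le> b * exp (- (2 * s * Im w))" .
  qed
qed

text \<open>Let \<open>Y\<close> be the part of jG orthogonal to the smaller space, with spectrum in
  [2s,2t]. Translating \<open>G\<close> downwards by 2(t-s) gives \<open>G'\<close> with spectrum
  below 2s, so its backward shift \<open>X\<close> is also orthogonal to \<open>Y\<close>. Hence the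
  squared norm of \<open>Y\<close> is <Y, jG - X>, and jG - X is pointwise at most 2(t-s)|G| on the
  real line.\<close>

lemma bshift_near_smaller_space:
  assumes G: "G \<in> PWs t" and s: "s > 0" "s < t"
  obtains R where "R \<in> PWs s" "nsq lborel (\<lambda>z. bshift G z - R z) \<le> (2 * (t - s))\<^sup>2 * nsq lborel G"
proof -
  define \<delta> where "\<delta> = t - s"
  have \<delta>: "\<delta> > 0" using s by (simp add: \<delta>_def)
  have t: "t \<ge> 0" using s by simp
  have jG: "bshift G \<in> PWs t" by (rule bshift_PWs[OF G t])
  obtain R where R: "R \<in> PWs s" "\<And>H. H \<in> PWs s \<Longrightarrow> ip lborel (\<lambda>z. bshift G z - R z) H = 0"
    using PWs_projection[OF jG s] by blast
  define Y where "Y = (\<lambda>z. bshift G z - R z)"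
  have Y: "Y \<in> PWs t" unfolding Y_def using s by (intro PWs_diff jG PWs_mono[OF R(1)]) auto
  obtain bY where bY: "bY > 0" "\<And>z. Im z \<ge> 0 \<Longrightarrow> cmod (Y z) \<le> bY" using PWs_bounds[OF Y t] by metis
  obtain b where b: "b > 0" "\<And>w. Im w \<ge> 1 \<Longrightarrow> cmod (Y w) \<le> b * exp (- (2 * s * Im w))"
    using orthogonal_decay[OF Y t s(1)] R(2) unfolding Y_def by blast
  obtain bG where bG: "bG > 0" "\<And>z. Im z \<ge> 0 \<Longrightarrow> cmod (G z) \<le> bG" "\<And>z. Im z \<ge> 0 \<Longrightarrow> cmod (G (cnj z)) \<le> bG * exp (2 * t * Im z)"
    using PWs_bounds[OF G t] by metis
  \<comment> \<open>The factor exp(-2i\<delta>z) lowers the top of the spectrum from 2t to 2s. It is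
    1 at 0, so the constants cancel in the difference of the two shifts.\<close>
  define G' where "G' = (\<lambda>z. osc (- (2 * \<delta>)) z * G z)"
  define X where "X = bshift G'"
  have hG: "G holomorphic_on UNIV" by (rule PWs_holomorphic[OF G])
  have hG': "G' holomorphic_on UNIV" unfolding G'_def by (intro holomorphic_intros osc_holomorphic hG)
  have hX: "X holomorphic_on UNIV" unfolding X_def by (rule bshift_holomorphic[OF hG'])
  have XL2: "X \<in> L2fun lborel"
  proof -
    obtain g where g: "g \<in> PW t" "G = (\<lambda>z. osc t z * g z)" using PWsE[OF G] .
    have "G' = (\<lambda>z. osc (t - 2 * \<delta>) z * g z)" by (simp add: G'_def g(2) osc_add mult.assoc[symmetric])
    then have "G' \<in> PW (t + \<bar>t - 2 * \<delta>\<bar>)" using PW_osc[OF g(1) order_refl] by simp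
    then have ty: "exp_type_le (t + \<bar>t - 2 * \<delta>\<bar>) G'" by (rule PW_exp_type)
    have "divdiff G' 0 \<in> PW (t + \<bar>t - 2 * \<delta>\<bar>)"
      by (rule PW_divdiff[OF hG' ty, where B = bG]) (use t bG(2) in \<open>auto simp: G'_def norm_mult norm_osc\<close>)
    then show ?thesis unfolding X_def bshift_def[abs_def] by (intro L2fun_scale PW_L2fun)
  qed
  \<comment> \<open>The function cnj(X(cnj z)) extends the conjugate of \<open>X\<close>
    holomorphically from the real line, so the integral of \<open>P\<close> over it is <Y,
    X>.\<close>
  define P where "P = (\<lambda>z. Y z * cnj (X (cnj z)))"
  have holP: "P holomorphic_on UNIV"
  proof -
    have "X holomorphic_on cnj ` UNIV" using hX by (rule holomorphic_on_subset) auto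
    from holomorphic_on_compose_cnj_cnj[OF this] have "(\<lambda>z. cnj (X (cnj z))) holomorphic_on UNIV" by (simp add: o_def)
    then show ?thesis unfolding P_def by (intro holomorphic_intros PWs_holomorphic[OF Y])
  qed
  have Xb: "cmod (X (cnj z)) \<le> 2 * bG * exp (2 * s * Im z)" if z: "Im z \<ge> 0" "cmod z \<ge> 1" for z
  proof -
    have "cnj z \<noteq> 0" using z by auto
    then have "cmod (X (cnj z)) = cmod (G' (cnj z) - G' 0) / cmod z"
      by (simp add: X_def bshift_eq norm_divide norm_mult)
    also have "\<dots> \<le> cmod (G' (cnj z) - G' 0) / 1" using z by (intro divide_left_mono) auto
    also have "\<dots> \<le> cmod (G' (cnj z)) + cmod (G' 0)" using norm_triangle_ineq4 by simp
    also have "cmod (G' (cnj z)) \<le> bG * exp (2 * s * Im z)"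
    proof -
      have "cmod (G' (cnj z)) = exp (- (2 * \<delta> * Im z)) * cmod (G (cnj z))" by (simp add: G'_def norm_mult norm_osc)
      also have "\<dots> \<le> exp (- (2 * \<delta> * Im z)) * (bG * exp (2 * t * Im z))" by (intro mult_left_mono bG z) auto
      also have "\<dots> = bG * exp (2 * s * Im z)" by (simp add: \<delta>_def algebra_simps flip: exp_add)
      finally show ?thesis .
    qed
    also have "cmod (G' 0) \<le> bG * exp (2 * s * Im z)"
    proof -
      have "cmod (G' 0) \<le> bG * 1" using bG(2)[of 0] by (simp add: G'_def)
      also have "\<dots> \<le> bG * exp (2 * s * Im z)" using bG(1) s z by (intro mult_left_mono) auto
      finally show ?thesis .
    qed
    finally show ?thesis by simp
  qed
  have "compact (P ` cball 0 1)"
    by (intro compact_continuous_image continuous_on_subset[OF holomorphic_on_imp_continuous_on[OF holP]]) auto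
  then obtain D where D: "D > 0" "\<And>z. z \<in> cball 0 1 \<Longrightarrow> cmod (P z) \<le> D"
    using compact_imp_bounded bounded_pos by (metis imageI)
  \<comment> \<open>Above height 1 the decay exp(-2s Im z) of \<open>Y\<close> exactly offsets the
    growth of \<open>X\<close> in the lower half-plane. The unit disc and the strip below height 1
    are bounded separately.\<close>
  have Pb: "cmod (P z) \<le> D + b * (2 * bG) + bY * (2 * bG * exp (2 * s))" if z: "Im z \<ge> 0" for z
  proof -
    have pos: "b * (2 * bG) \<ge> 0" "bY * (2 * bG * exp (2 * s)) \<ge> 0" using b bG bY by auto
    have n: "cmod (P z) = cmod (Y z) * cmod (X (cnj z))" by (simp add: P_def norm_mult)
    consider "cmod z \<le> 1" | "cmod z \<ge> 1" "Im z \<ge> 1" | "cmod z \<ge> 1" "Im z \<le> 1" by linarith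
    then show ?thesis
    proof cases
      case 1
      then have "cmod (P z) \<le> D" using D(2)[of z] by simp
      then show ?thesis using pos by linarith
    next
      case 2
      have "cmod (P z) \<le> (b * exp (- (2 * s * Im z))) * (2 * bG * exp (2 * s * Im z))"
        unfolding n using b(1) by (intro mult_mono b(2) Xb z 2) auto
      also have "\<dots> = b * (2 * bG)" by (simp add: exp_minus)
      finally show ?thesis using pos D by linarith
    next
      case 3
      have "2 * s * Im z \<le> 2 * s" using 3 s by simp
      then have "2 * bG * exp (2 * s * Im z) \<le> 2 * bG * exp (2 * s)" using bG by (intro mult_left_mono) auto
      then have "cmod (X (cnj z)) \<le> 2 * bG * exp (2 * s)" using Xb[OF z 3(1)] by linarith
      then have "cmod (P z) \<le> bY * (2 * bG * exp (2 * s))"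
        unfolding n using bY z by (intro mult_mono) auto
      then show ?thesis using pos D by linarith
    qed
  qed
  note YL2 = PWs_L2fun_lborel[OF Y] and GL2 = PWs_L2fun_lborel[OF G] and jL2 = PWs_L2fun_lborel[OF jG]
  have intP: "integrable lborel (\<lambda>x. P (complex_of_real x))"
    using L2fun_prod_integrable[OF YL2 XL2] by (simp add: P_def)
  have "(LINT x|lborel. P (complex_of_real x)) = 0"
    by (rule halfplane_integral_zero[of 1 P, OF _ _ Pb intP]) (auto intro: holomorphic_on_subset[OF holP])
  then have YX: "ip lborel Y X = 0" by (simp add: ip_def P_def)
  define E where "E = (\<lambda>z. bshift G z - X z)"
  have EL2: "E \<in> L2fun lborel" unfolding E_def by (intro L2fun_diff jL2 XL2)
  \<comment> \<open>Away from 0 one has E = G(1 - exp(-2i\<delta>x))/(ix), and |exp(iy) - 1| <= |y|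
    gives the factor 2\<delta>.\<close>
  have nE: "nsq lborel E \<le> (2 * \<delta>)\<^sup>2 * nsq lborel G"
    unfolding nsq_def Bochner_Integration.integral_mult_right_zero[symmetric]
  proof (rule integral_mono_AE)
    show "integrable lborel (\<lambda>x. (cmod (E (complex_of_real x)))\<^sup>2)" by (rule L2fun_integrable[OF EL2])
    show "integrable lborel (\<lambda>x. (2 * \<delta>)\<^sup>2 * (cmod (G (complex_of_real x)))\<^sup>2)"
      by (intro integrable_mult_right L2fun_integrable[OF GL2])
    have "(cmod (E (complex_of_real x)))\<^sup>2 \<le> (2 * \<delta>)\<^sup>2 * (cmod (G (complex_of_real x)))\<^sup>2" if x: "x \<noteq> 0" for x
    proof -
      have "E (complex_of_real x) = - ((osc (- (2 * \<delta>)) (complex_of_real x) - 1) * G (complex_of_real x) / (\<i> * complex_of_real x))"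
        using x by (simp add: E_def X_def bshift_eq G'_def field_simps)
      then have "cmod (E (complex_of_real x)) = cmod (osc (- (2 * \<delta>)) (complex_of_real x) - 1) * cmod (G (complex_of_real x)) / \<bar>x\<bar>"
        by (simp add: norm_mult norm_divide)
      also have "\<dots> \<le> (2 * \<delta> * \<bar>x\<bar>) * cmod (G (complex_of_real x)) / \<bar>x\<bar>"
      proof (intro divide_right_mono mult_right_mono)
        show "cmod (osc (- (2 * \<delta>)) (complex_of_real x) - 1) \<le> 2 * \<delta> * \<bar>x\<bar>"
          using cmod_exp_i_minus_one_le[of "- (2 * \<delta>) * x"] \<delta> by (simp add: osc_def abs_mult mult.assoc)
      qed auto
      also have "\<dots> = 2 * \<delta> * cmod (G (complex_of_real x))" using x by simp
      finally show ?thesis unfolding power_mult_distrib[symmetric] by (intro power_mono) auto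
    qed
    then show "AE x in lborel. (cmod (E (complex_of_real x)))\<^sup>2 \<le> (2 * \<delta>)\<^sup>2 * (cmod (G (complex_of_real x)))\<^sup>2"
      by (intro eventually_mono[OF AE_lborel_singleton[of 0]]) auto
  qed
  \<comment> \<open>\<open>Y\<close> is orthogonal to both \<open>R\<close> and \<open>X\<close>, so
    its squared norm is <Y, E>, and Cauchy-Schwarz bounds \<open>Y\<close> by
    \<open>E\<close>.\<close>
  have "complex_of_real (nsq lborel Y) = ip lborel Y (bshift G) - ip lborel Y R"
    using ip_diff_right[OF jL2 PWs_L2fun_lborel[OF R(1)] YL2] by (simp add: Y_def[symmetric] flip: ip_self)
  also have "ip lborel Y R = 0" using R by (simp add: Y_def)
  also have "ip lborel Y (bshift G) - 0 = ip lborel Y E + ip lborel Y X"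
    using ip_add_right[OF EL2 XL2 YL2] by (simp add: E_def)
  finally have "ip lborel Y E = complex_of_real (nsq lborel Y)" by (simp add: YX)
  then have "(nsq lborel Y)\<^sup>2 \<le> nsq lborel Y * nsq lborel E"
    using nsq_cauchy_schwarz[OF YL2 EL2] by simp
  then have "nsq lborel Y \<le> nsq lborel E"
  proof (cases "nsq lborel Y = 0")
    case False
    then have "nsq lborel Y > 0" using nsq_nonneg[of lborel Y] by linarith
    then show ?thesis using \<open>(nsq lborel Y)\<^sup>2 \<le> nsq lborel Y * nsq lborel E\<close> by (simp add: power2_eq_square)
  qed simp
  then show ?thesis using that[OF R(1)] nE by (simp add: Y_def \<delta>_def)
qed

text \<open>Orthogonality for \<nu> allows the subtraction of \<open>R\<close> from jG although
  \<open>R\<close> was built in the Lebesgue norm; afterwards only norms have to be compared, never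
  inner products. The comparison costs \<open>C\<close> twice, and the square of 2(t-s) supplies the
  4. As \<open>C\<close> belongs to \<open>PW T\<close>, the constant is uniform for t <= T.\<close>

lemma bshift_orthogonal_estimate:
  assumes \<nu>: "PW_sampling \<nu>" and T: "T > 0"
  obtains D where "D > 0" "\<And>s t F G. 0 < s \<Longrightarrow> s < t \<Longrightarrow> t \<le> T \<Longrightarrow> F \<in> PWs t \<Longrightarrow> G \<in> PWs t \<Longrightarrow>
     (\<And>H. H \<in> PWs s \<Longrightarrow> ip \<nu> F H = 0) \<Longrightarrow>
     (cmod (ip \<nu> F (bshift G)))\<^sup>2 \<le> D * (t - s)\<^sup>2 * nsq \<nu> F * nsq \<nu> G"
proof -
  obtain C where C: "C > 0" "\<And>f. f \<in> PW T \<Longrightarrow> nsq lborel f \<le> C * nsq \<nu> f"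
    "\<And>f. f \<in> PW T \<Longrightarrow> nsq \<nu> f \<le> C * nsq lborel f"
    using sampling_bounds[OF \<nu> T] by metis
  have C1: "nsq lborel F \<le> C * nsq \<nu> F" and C2: "nsq \<nu> F \<le> C * nsq lborel F" if "F \<in> PWs T" for F
    using that C(2)[of "\<lambda>z. osc (- T) z * F z"] C(3)[of "\<lambda>z. osc (- T) z * F z"]
    by (auto simp: PWs_def nsq_osc)
  show ?thesis
  proof (rule that[of "4 * C\<^sup>2"])
    fix s t F G
    assume a: "0 < s" "s < t" "t \<le> T" and F: "F \<in> PWs t" and G: "G \<in> PWs t"
      and orth: "\<And>H. H \<in> PWs s \<Longrightarrow> ip \<nu> F H = 0"
    obtain R where R: "R \<in> PWs s" "nsq lborel (\<lambda>z. bshift G z - R z) \<le> (2 * (t - s))\<^sup>2 * nsq lborel G"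
      using bshift_near_smaller_space[OF G a(1,2)] by blast
    define Y where "Y = (\<lambda>z. bshift G z - R z)"
    have t: "t > 0" using a by simp
    have jG: "bshift G \<in> PWs t" using bshift_PWs[OF G] t by simp
    have Rt: "R \<in> PWs t" using PWs_mono[OF R(1)] a by simp
    have Y: "Y \<in> PWs t" unfolding Y_def by (intro PWs_diff jG Rt)
    note L2 = PWs_L2fun[OF \<nu> _ t]
    have "ip \<nu> F (bshift G) = ip \<nu> F Y"
      using ip_diff_right[OF L2[OF jG] L2[OF Rt] L2[OF F]] orth[OF R(1)] by (simp add: Y_def)
    then have "(cmod (ip \<nu> F (bshift G)))\<^sup>2 \<le> nsq \<nu> F * nsq \<nu> Y"
      using nsq_cauchy_schwarz[OF L2[OF F] L2[OF Y]] by simp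
    also have "\<dots> \<le> nsq \<nu> F * (C * ((2 * (t - s))\<^sup>2 * (C * nsq \<nu> G)))"
    proof (rule mult_left_mono[OF _ nsq_nonneg])
      have "nsq \<nu> Y \<le> C * nsq lborel Y" by (rule C2[OF PWs_mono[OF Y a(3)]])
      also have "\<dots> \<le> C * ((2 * (t - s))\<^sup>2 * nsq lborel G)" using R(2) C(1) by (simp add: Y_def)
      also have "\<dots> \<le> C * ((2 * (t - s))\<^sup>2 * (C * nsq \<nu> G))"
        using C1[OF PWs_mono[OF G a(3)]] C(1) by (intro mult_left_mono) auto
      finally show "nsq \<nu> Y \<le> C * ((2 * (t - s))\<^sup>2 * (C * nsq \<nu> G))" .
    qed
    also have "\<dots> = 4 * C\<^sup>2 * (t - s)\<^sup>2 * nsq \<nu> F * nsq \<nu> G"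
      unfolding power_mult_distrib by (simp add: power2_eq_square mult_ac)
    finally show "(cmod (ip \<nu> F (bshift G)))\<^sup>2 \<le> 4 * C\<^sup>2 * (t - s)\<^sup>2 * nsq \<nu> F * nsq \<nu> G" .
  qed (use C in auto)
qed

section \<open>Absolute continuity from a grid inequality\<close>


definition gridpt :: "real \<Rightarrow> real \<Rightarrow> nat \<Rightarrow> nat \<Rightarrow> real" where
  "gridpt s t n j = s + real j * ((t - s) / real n)"

text \<open>Left-open, right-closed cells tile {s<..t} and match the intervals on which
  \<open>interval_measure\<close> is given by increments.\<close>

definition gridcell :: "real \<Rightarrow> real \<Rightarrow> nat \<Rightarrow> nat \<Rightarrow> real set" where
  "gridcell s t n j = {gridpt s t n j <.. gridpt s t n (Suc j)}"

lemma gridpt_mono: "s \<le> t \<Longrightarrow> i \<le> j \<Longrightarrow> gridpt s t n i \<le> gridpt s t n j"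
  unfolding gridpt_def by (intro add_left_mono mult_right_mono) auto

lemma gridpt_0 [simp]: "gridpt s t n 0 = s"
  by (simp add: gridpt_def)

lemma gridpt_n [simp]: "n > 0 \<Longrightarrow> gridpt s t n n = t"
  by (simp add: gridpt_def)

lemma gridpt_Suc: "gridpt s t n (Suc j) = gridpt s t n j + (t - s) / real n"
  by (simp add: gridpt_def distrib_right add_divide_distrib)

lemma gridcell_disjoint:
  assumes "s \<le> t" shows "disjoint_family_on (gridcell s t n) A"
proof -
  have "gridcell s t n i \<inter> gridcell s t n j = {}" if "i < j" for i j
    using gridpt_mono[OF assms, of "Suc i" j n] that by (auto simp: gridcell_def)
  then show ?thesis unfolding disjoint_family_on_def by (metis Int_commute nat_neq_iff)
qed

lemma gridcell_subset:
  assumes "s \<le> t" "j < n" shows "gridcell s t n j \<subseteq> {s <.. t}"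
  using gridpt_mono[OF assms(1), of 0 j n] gridpt_mono[OF assms(1), of "Suc j" n n] assms(2)
  by (auto simp: gridcell_def)

lemma gridcell_cover:
  assumes st: "s < t" and n: "n > 0" and x: "x \<in> {s <.. t}"
  obtains j where "j < n" "x \<in> gridcell s t n j"
proof -
  define j where "j = (LEAST j. x \<le> gridpt s t n j)"
  have ex: "x \<le> gridpt s t n n" using x n by simp
  have j1: "x \<le> gridpt s t n j" unfolding j_def by (rule LeastI[of _ n]) (rule ex)
  have jn: "j \<le> n" unfolding j_def by (rule Least_le) (rule ex)
  have "j \<noteq> 0" using j1 x by (metis gridpt_0 greaterThanAtMost_iff not_less)
  then obtain i where i: "j = Suc i" using not0_implies_Suc by blast
  have "\<not> x \<le> gridpt s t n i" using i not_less_Least[of i "\<lambda>j. x \<le> gridpt s t n j"] by (simp add: j_def)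
  then show ?thesis using that[of i] jn i j1 by (auto simp: gridcell_def)
qed

text \<open>The hypothesis \<open>ineq\<close> is the half \<open>K(E)/K(I) \<ge> (|E|/|I|)\<^sup>2/D\<close> of an \<open>A\<^sub>2\<close> condition, for
  unions \<open>E\<close> of grid cells of an interval \<open>I\<close>.\<close>

locale grid_doubling =
  fixes F :: "real \<Rightarrow> real" and T D :: real
  assumes mono: "\<And>x y. x \<le> y \<Longrightarrow> F x \<le> F y"
    and cont: "continuous_on UNIV F"
    and T: "T > 0" and D: "D > 0"
    and left: "\<And>x. x \<le> 0 \<Longrightarrow> F x = F 0" and right: "\<And>x. x \<ge> T \<Longrightarrow> F x = F T"
    and ineq: "\<And>s t n J. 0 \<le> s \<Longrightarrow> s < t \<Longrightarrow> t \<le> T \<Longrightarrow> n > 0 \<Longrightarrow> J \<subseteq> {..<n} \<Longrightarrow>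
       (F t - F s) * (real (card J) / real n)\<^sup>2 \<le> D * (\<Sum>j\<in>J. F (gridpt s t n (Suc j)) - F (gridpt s t n j))"
begin

abbreviation "\<nu> \<equiv> interval_measure F"

lemma right_cont: "continuous (at_right a) F"
  using cont by (auto simp: continuous_on_eq_continuous_within intro: continuous_within_subset)

lemma emeasure_Ioc: "a \<le> b \<Longrightarrow> emeasure \<nu> {a<..b} = ennreal (F b - F a)"
  by (rule emeasure_interval_measure_Ioc[OF _ mono right_cont])

lemma measure_Ioc: "a \<le> b \<Longrightarrow> measure \<nu> {a<..b} = F b - F a"
  by (rule measure_interval_measure_Ioc[OF _ mono right_cont])

lemma finite_nu: "finite_measure \<nu>"
proof
  have "(\<Union>n::nat. {- real n<..real n}) = (UNIV :: real set)"
  proof -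
    have "\<exists>n::nat. - real n < x \<and> x \<le> real n" for x :: real
      using reals_Archimedean2[of "\<bar>x\<bar>"] by (metis abs_less_iff less_imp_le minus_less_iff)
    then show ?thesis by auto
  qed
  then have "emeasure \<nu> UNIV = (SUP n. emeasure \<nu> {- real n<..real n})"
    by (subst SUP_emeasure_incseq) (auto simp: incseq_def)
  also have "\<dots> \<le> ennreal (F T - F 0)"
  proof (rule SUP_least)
    fix n :: nat
    have "F (real n) \<le> F T" using mono[of "real n" T] right[of "real n"] by (cases "real n \<le> T") auto
    moreover have "F (- real n) = F 0" by (rule left) auto
    ultimately show "emeasure \<nu> {- real n<..real n} \<le> ennreal (F T - F 0)"
      by (simp add: emeasure_Ioc ennreal_leI)
  qed
  finally show "emeasure \<nu> (space \<nu>) \<noteq> \<infinity>" by (auto simp: top_unique)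
qed

lemma measure_outside_zero: "measure \<nu> (- {0<..T}) = 0"
proof -
  interpret finite_measure \<nu> by (rule finite_nu)
  have 1: "measure \<nu> {- real n<..0} = 0" "measure \<nu> {T<..T + real n} = 0" for n :: nat
    using left[of "- real n"] right[of "T + real n"] by (simp_all add: measure_Ioc)
  have nul: "emeasure \<nu> (\<Union>n::nat. {- real n<..0} \<union> {T<..T + real n}) = 0"
  proof (rule emeasure_UN_eq_0)
    fix n :: nat
    have "emeasure \<nu> ({- real n<..0} \<union> {T<..T + real n}) \<le> emeasure \<nu> {- real n<..0} + emeasure \<nu> {T<..T + real n}"
      by (rule emeasure_subadditive) auto
    then show "emeasure \<nu> ({- real n<..0} \<union> {T<..T + real n}) = 0"
      using 1[of n] by (simp add: emeasure_eq_measure)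
  qed auto
  have "- {0<..T} \<subseteq> (\<Union>n::nat. {- real n<..0} \<union> {T<..T + real n})"
  proof
    fix x assume x: "x \<in> - {0<..T}"
    obtain n :: nat where n: "real n > \<bar>x\<bar> + \<bar>T\<bar>" using reals_Archimedean2 by blast
    have "x \<in> {- real n<..0} \<union> {T<..T + real n}" using x n T by (cases "x \<le> 0") auto
    then show "x \<in> (\<Union>n::nat. {- real n<..0} \<union> {T<..T + real n})" by blast
  qed
  then have "emeasure \<nu> (- {0<..T}) \<le> 0" unfolding nul[symmetric] by (intro emeasure_mono) auto
  then show ?thesis by (simp add: measure_def)
qed

text \<open>The cells of a fine grid that meet \<open>S\<close> lie in an open set of small Lebesgue
  measure, so the cells that avoid \<open>S\<close> make up a proportion at least 1 - e of the
  interval. The grid inequality applies to these, and e tends to 0.\<close>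

lemma interval_le_diff_null:
  assumes st: "0 \<le> s" "s < t" "t \<le> T" and S: "compact S" "emeasure lborel S = 0"
  shows "F t - F s \<le> D * measure \<nu> ({s<..t} - S)"
proof -
  interpret finite_measure \<nu> by (rule finite_nu)
  have Sb: "S \<in> sets borel" using S(1) by (simp add: borel_compact)
  have eps: "(F t - F s) * (1 - e)\<^sup>2 \<le> D * measure \<nu> ({s<..t} - S)" if e: "0 < e" "e < 1" for e
  proof -
    obtain U where U: "open U" "S \<subseteq> U" "emeasure lborel (U - S) < ennreal (e * (t - s))"
      using outer_regular_lborel[OF Sb, of "e * (t - s)"] e st by auto
    have Ue: "emeasure lborel U < ennreal (e * (t - s))"
    proof -
      have "emeasure lborel U \<le> emeasure lborel (U - S) + emeasure lborel S"
        using U(1,2) Sb by (subst emeasure_Diff_null_set[symmetric]) (auto intro!: emeasure_subadditive simp: S(2) null_sets_def)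
      then show ?thesis using U(3) S(2) by simp
    qed
    obtain d where d: "d > 0" "(\<Union>x\<in>S. ball x d) \<subseteq> U"
    proof (rule compact_subset_open_imp_ball_epsilon_subset[OF S(1) U(1,2)])
      fix d assume "d > 0" "(\<Union>x\<in>S. ball x d) \<subseteq> U" then show ?thesis by (rule that)
    qed
    \<comment> \<open>With a mesh below \<open>d\<close>, every cell that contains a point of
      \<open>S\<close> stays inside \<open>U\<close>.\<close>
    obtain n :: nat where n: "n > 0" "(t - s) / real n < d"
    proof -
      obtain m :: nat where m: "real m > (t - s) / d" using reals_Archimedean2 by blast
      have "(t - s) / d > 0" using st d by simp
      then have "m > 0" using m by (cases "m = 0") auto
      then show ?thesis using that[of m] m d by (simp add: field_simps)
    qed
    define J where "J = {j. j < n \<and> gridcell s t n j \<inter> S = {}}"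
    define J' where "J' = {..<n} - J"
    have fin: "finite J" "finite J'" "J \<subseteq> {..<n}" by (auto simp: J_def J'_def)
    have cardJ: "card J + card J' = n"
      using fin card_Diff_subset[of J "{..<n}"] card_mono[of "{..<n}" J] by (simp add: J'_def)
    have cb: "gridcell s t n j \<in> sets borel" for j by (simp add: gridcell_def)
    have "(\<Union>j\<in>J'. gridcell s t n j) \<subseteq> U"
    proof
      fix x assume "x \<in> (\<Union>j\<in>J'. gridcell s t n j)"
      then obtain j y where j: "x \<in> gridcell s t n j" "y \<in> gridcell s t n j" "y \<in> S"
        by (auto simp: J_def J'_def)
      then have "\<bar>y - x\<bar> < d" using n(2) by (auto simp: gridcell_def gridpt_Suc)
      then have "x \<in> ball y d" by (simp add: dist_real_def)
      then show "x \<in> U" using d(2) j(3) by blast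
    qed
    then have "emeasure lborel (\<Union>j\<in>J'. gridcell s t n j) \<le> emeasure lborel U"
      using U(1) by (intro emeasure_mono) auto
    moreover have "(\<Sum>j\<in>J'. emeasure lborel (gridcell s t n j)) = emeasure lborel (\<Union>j\<in>J'. gridcell s t n j)"
      using gridcell_disjoint[of s t n] st fin cb by (intro sum_emeasure) auto
    moreover have "(\<Sum>j\<in>J'. emeasure lborel (gridcell s t n j)) = ennreal (real (card J') * ((t - s) / real n))"
    proof -
      have "emeasure lborel (gridcell s t n j) = ennreal ((t - s) / real n)" for j
        using st by (simp add: gridcell_def gridpt_Suc)
      then show ?thesis
        using st by (simp add: ennreal_of_nat_eq_real_of_nat flip: ennreal_mult'')
    qed
    ultimately have "ennreal (real (card J') * ((t - s) / real n)) < ennreal (e * (t - s))"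
      using Ue by (metis le_less_trans)
    then have "real (card J') * ((t - s) / real n) < e * (t - s)" using st by (simp add: ennreal_less_iff)
    then have "(real (card J') / real n) * (t - s) < e * (t - s)" by simp
    then have "real (card J') / real n < e" using st by (simp only: mult_less_cancel_right)
    moreover have "real (card J) / real n = 1 - real (card J') / real n"
      using cardJ n(1) by (simp add: field_simps)
    ultimately have "1 - e \<le> real (card J) / real n" by linarith
    then have "(1 - e)\<^sup>2 \<le> (real (card J) / real n)\<^sup>2" using e by (intro power_mono) auto
    then have "(F t - F s) * (1 - e)\<^sup>2 \<le> (F t - F s) * (real (card J) / real n)\<^sup>2"
      using mono[of s t] st by (intro mult_left_mono) auto
    also have "\<dots> \<le> D * (\<Sum>j\<in>J. F (gridpt s t n (Suc j)) - F (gridpt s t n j))"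
      by (rule ineq[OF st n(1) fin(3)])
    also have "(\<Sum>j\<in>J. F (gridpt s t n (Suc j)) - F (gridpt s t n j)) = measure \<nu> (\<Union>j\<in>J. gridcell s t n j)"
    proof -
      have "measure \<nu> (\<Union>j\<in>J. gridcell s t n j) = (\<Sum>j\<in>J. measure \<nu> (gridcell s t n j))"
        using gridcell_disjoint[of s t n] st fin cb by (intro finite_measure_finite_Union) auto
      also have "\<dots> = (\<Sum>j\<in>J. F (gridpt s t n (Suc j)) - F (gridpt s t n j))"
        unfolding gridcell_def using st by (intro sum.cong refl measure_Ioc gridpt_mono) auto
      finally show ?thesis ..
    qed
    also have "D * measure \<nu> (\<Union>j\<in>J. gridcell s t n j) \<le> D * measure \<nu> ({s<..t} - S)"
    proof (intro mult_left_mono finite_measure_mono)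
      show "(\<Union>j\<in>J. gridcell s t n j) \<subseteq> {s<..t} - S"
        using gridcell_subset[of s t _ n] st by (fastforce simp: J_def)
    qed (use D Sb in auto)
    finally show ?thesis .
  qed
  have "((\<lambda>e. (F t - F s) * (1 - e)\<^sup>2) \<longlongrightarrow> (F t - F s) * (1 - 0)\<^sup>2) (at_right 0)"
    by (intro tendsto_intros)
  then have "(F t - F s) * (1 - 0)\<^sup>2 \<le> D * measure \<nu> ({s<..t} - S)"
    by (rule tendsto_upperbound) (use eps in \<open>auto intro!: eventually_at_rightI[of 0 1]\<close>)
  then show ?thesis by simp
qed

text \<open>On the cells of a fine grid that meet \<open>S\<close>, the preceding inequality trades
  the mass of \<open>S\<close> for that of \<open>A m\<close>, a closed neighbourhood of
  \<open>S\<close> with \<open>S\<close> removed. Since \<open>S\<close> is closed, these sets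
  decrease to the empty set, and their masses tend to 0 because the measure is finite.\<close>

lemma compact_null:
  assumes S: "compact S" "emeasure lborel S = 0"
  shows "measure \<nu> S = 0"
proof (cases "S = {}")
  case False
  interpret finite_measure \<nu> by (rule finite_nu)
  have Sb: "S \<in> sets borel" using S(1) by (simp add: borel_compact)
  define A where "A = (\<lambda>m. {x. infdist x S \<le> T / real (Suc m)} - S)"
  have Ab: "A m \<in> sets borel" for m
  proof -
    have "closed {x. infdist x S \<le> T / real (Suc m)}"
      by (intro closed_Collect_le continuous_intros)
    then show ?thesis unfolding A_def using Sb by auto
  qed
  have le: "measure \<nu> S \<le> D * measure \<nu> (A m)" for m
  proof -
    define n where "n = Suc m"
    define J where "J = {j. j < n \<and> gridcell 0 T n j \<inter> S \<noteq> {}}"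
    have fin: "finite J" by (simp add: J_def)
    have cb: "gridcell 0 T n j \<in> sets borel" for j by (simp add: gridcell_def)
    have cover: "S \<inter> {0<..T} \<subseteq> (\<Union>j\<in>J. gridcell 0 T n j)"
    proof
      fix x assume x: "x \<in> S \<inter> {0<..T}"
      then obtain j where "j < n" "x \<in> gridcell 0 T n j"
        using gridcell_cover[OF T, of n x] by (auto simp: n_def)
      then show "x \<in> (\<Union>j\<in>J. gridcell 0 T n j)" using x by (auto simp: J_def)
    qed
    \<comment> \<open>The grid covers only {0<..T}; the complement carries no mass because
      \<open>F\<close> is constant on either side.\<close>
    have "measure \<nu> S \<le> measure \<nu> ((\<Union>j\<in>J. gridcell 0 T n j) \<union> - {0<..T})"
      using cover fin cb by (intro finite_measure_mono) auto
    also have "\<dots> \<le> measure \<nu> (\<Union>j\<in>J. gridcell 0 T n j) + measure \<nu> (- {0<..T})"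
      using fin cb by (intro measure_Un_le) auto
    also have "\<dots> = measure \<nu> (\<Union>j\<in>J. gridcell 0 T n j)" by (simp add: measure_outside_zero)
    also have "\<dots> = (\<Sum>j\<in>J. measure \<nu> (gridcell 0 T n j))"
      using gridcell_disjoint[of 0 T n] T fin cb by (intro finite_measure_finite_Union) auto
    also have "\<dots> \<le> (\<Sum>j\<in>J. D * measure \<nu> (gridcell 0 T n j - S))"
    proof (rule sum_mono)
      fix j assume j: "j \<in> J"
      have jn: "Suc j \<le> n" using j by (simp add: J_def)
      have b: "0 \<le> gridpt 0 T n j" "gridpt 0 T n j < gridpt 0 T n (Suc j)" "gridpt 0 T n (Suc j) \<le> T"
      proof -
        show "0 \<le> gridpt 0 T n j" using gridpt_mono[of 0 T 0 j n] T by simp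
        show "gridpt 0 T n j < gridpt 0 T n (Suc j)" using T unfolding gridpt_Suc by (simp add: n_def)
        have "n > 0" by (simp add: n_def)
        then show "gridpt 0 T n (Suc j) \<le> T" using gridpt_mono[of 0 T "Suc j" n n] T jn by simp
      qed
      show "measure \<nu> (gridcell 0 T n j) \<le> D * measure \<nu> (gridcell 0 T n j - S)"
        using interval_le_diff_null[OF b S] b by (simp add: gridcell_def measure_Ioc)
    qed
    also have "\<dots> = D * measure \<nu> (\<Union>j\<in>J. gridcell 0 T n j - S)"
      unfolding sum_distrib_left[symmetric]
      using gridcell_disjoint[of 0 T n J] T fin cb Sb
      by (subst finite_measure_finite_Union) (auto simp: disjoint_family_on_def)
    also have "\<dots> \<le> D * measure \<nu> (A m)"
    proof (intro mult_left_mono finite_measure_mono)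
      show "(\<Union>j\<in>J. gridcell 0 T n j - S) \<subseteq> A m"
      proof
        fix x assume "x \<in> (\<Union>j\<in>J. gridcell 0 T n j - S)"
        then obtain j y where j: "x \<in> gridcell 0 T n j" "x \<notin> S" "y \<in> gridcell 0 T n j" "y \<in> S"
          by (auto simp: J_def)
        then have "dist x y \<le> T / real n" by (auto simp: gridcell_def gridpt_Suc dist_real_def)
        then have "infdist x S \<le> T / real n" using infdist_le[OF j(4), of x] by linarith
        then show "x \<in> A m" using j by (simp add: A_def n_def)
      qed
    qed (use D Ab in auto)
    finally show ?thesis .
  qed
  have "(\<lambda>m. measure \<nu> (A m)) \<longlonglongrightarrow> measure \<nu> (\<Inter>m. A m)"
  proof (rule finite_Lim_measure_decseq)
    show "range A \<subseteq> sets \<nu>" using Ab by auto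
    show "decseq A" unfolding decseq_def
    proof (intro allI impI)
      fix m n :: nat assume "m \<le> n"
      then have "T / real (Suc n) \<le> T / real (Suc m)" using T by (intro divide_left_mono) auto
      then show "A n \<subseteq> A m" by (auto simp: A_def)
    qed
  qed
  moreover have "(\<Inter>m. A m) = {}"
  proof -
    have "x \<in> S" if x: "\<And>m. infdist x S \<le> T / real (Suc m)" for x
    proof -
      have "(\<lambda>m. T * inverse (real (Suc m))) \<longlonglongrightarrow> T * 0"
        by (intro tendsto_intros LIMSEQ_inverse_real_of_nat)
      then have "infdist x S \<le> T * 0"
        by (rule tendsto_lowerbound) (use x in \<open>auto simp: inverse_eq_divide\<close>)
      then have "infdist x S = 0" using infdist_nonneg[of x S] by simp
      then show "x \<in> S" using in_closed_iff_infdist_zero[OF compact_imp_closed[OF S(1)] False] by simp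
    qed
    then show ?thesis by (auto simp: A_def)
  qed
  ultimately have "(\<lambda>m. D * measure \<nu> (A m)) \<longlonglongrightarrow> D * 0" by (intro tendsto_intros) simp
  then have "measure \<nu> S \<le> D * 0" by (rule tendsto_lowerbound) (use le in auto)
  then show ?thesis using measure_nonneg[of \<nu> S] by simp
qed simp

text \<open>Inner regularity reduces an arbitrary Lebesgue null set to its compact subsets.\<close>

lemma absolutely_continuous_nu: "absolutely_continuous lborel \<nu>"
  unfolding absolutely_continuous_def
proof
  interpret finite_measure \<nu> by (rule finite_nu)
  fix N :: "real set" assume "N \<in> null_sets lborel"
  then have N: "N \<in> sets borel" "emeasure lborel N = 0" by (auto simp: null_sets_def)
  have "emeasure \<nu> N = (SUP S\<in>{S. S \<subseteq> N \<and> compact S}. emeasure \<nu> S)"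
    using emeasure_finite[of UNIV] N by (intro inner_regular) auto
  also have "\<dots> = 0"
  proof -
    have "emeasure \<nu> S = 0" if "S \<subseteq> N" "compact S" for S
    proof -
      have "emeasure lborel S \<le> emeasure lborel N" using that N by (intro emeasure_mono) auto
      then have "measure \<nu> S = 0" using N that by (intro compact_null) auto
      then show ?thesis by (simp add: emeasure_eq_measure)
    qed
    then have "(SUP S\<in>{S. S \<subseteq> N \<and> compact S}. emeasure \<nu> S) \<le> 0" by (intro SUP_least) auto
    then show ?thesis by simp
  qed
  finally show "N \<in> null_sets \<nu>" using N by (auto simp: null_sets_def)
qed

lemma density_exists:
  obtains h where "integrable lborel h" "\<And>x. h x \<ge> (0::real)" "\<And>a b. a \<le> b \<Longrightarrow> F b - F a = integral {a..b} h"
proof -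
  interpret finite_measure \<nu> by (rule finite_nu)
  obtain g where g: "g \<in> borel_measurable lborel" "density lborel g = \<nu>"
    using sigma_finite_measure.Radon_Nikodym[OF sigma_finite_lborel absolutely_continuous_nu] by auto
  have em: "emeasure \<nu> A = (\<integral>\<^sup>+x. g x * indicator A x \<partial>lborel)" if "A \<in> sets borel" for A
    using that g(1) by (subst g(2)[symmetric]) (simp add: emeasure_density)
  have "emeasure \<nu> UNIV = (\<integral>\<^sup>+x. g x \<partial>lborel)" using em[of UNIV] by simp
  then have fin: "(\<integral>\<^sup>+x. g x \<partial>lborel) < \<infinity>" using emeasure_finite[of UNIV] by (simp add: less_top)
  then have AE: "AE x in lborel. g x \<noteq> \<infinity>" using g(1) by (intro nn_integral_noteq_infinite) auto
  \<comment> \<open>The Radon-Nikodym density is extended-valued; since the total mass is finite,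
    the conversion to real values changes it on a null set only.\<close>
  define h where "h = (\<lambda>x. enn2real (g x))"
  have gh: "AE x in lborel. g x = ennreal (h x)"
    using AE by eventually_elim (simp add: h_def less_top)
  have hm: "h \<in> borel_measurable lborel" unfolding h_def using g(1) by simp
  have h0: "h x \<ge> 0" for x by (simp add: h_def)
  have "(\<integral>\<^sup>+x. ennreal (h x) \<partial>lborel) = (\<integral>\<^sup>+x. g x \<partial>lborel)"
    using gh by (intro nn_integral_cong_AE) auto
  then have hi: "integrable lborel h" using fin hm h0 by (intro integrableI_nonneg) auto
  have "F b - F a = integral {a..b} h" if ab: "a \<le> b" for a b
  proof -
    have si: "set_integrable lborel {a..b} h"
      unfolding set_integrable_def using hi by (intro integrable_mult_indicator) auto
    have "ennreal (F b - F a) = (\<integral>\<^sup>+x. g x * indicator {a..b} x \<partial>lborel)"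
      using emeasure_interval_measure_Icc[OF ab mono cont] em[of "{a..b}"] by simp
    also have "\<dots> = (\<integral>\<^sup>+x. ennreal (indicator {a..b} x *\<^sub>R h x) \<partial>lborel)"
      by (rule nn_integral_cong_AE, use gh in eventually_elim) (auto simp: indicator_def)
    also have "\<dots> = ennreal (LINT x:{a..b}|lborel. h x)"
      using si h0 unfolding set_lebesgue_integral_def set_integrable_def
      by (intro nn_integral_eq_integral) auto
    also have "(LINT x:{a..b}|lborel. h x) = integral {a..b} h" by (rule set_borel_integral_eq_integral(2)[OF si])
    finally have "ennreal (F b - F a) = ennreal (integral {a..b} h)" .
    moreover have "integral {a..b} h \<ge> 0"
      using set_borel_integral_eq_integral(1)[OF si] h0 by (intro integral_nonneg) auto
    ultimately show ?thesis using mono[OF ab] by simp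
  qed
  then show ?thesis using that[OF hi h0] by blast
qed

end

text \<open>The differentiation theorem is used for intervals to the right of a point. Applied to
  h(-x) as well, it gives the left derivative, so the exceptional set is the union of
  \<open>N1\<close> with the reflection of \<open>N2\<close>.\<close>

lemma AE_derivative_of_integral:
  fixes F h :: "real \<Rightarrow> real"
  assumes hi: "integrable lborel h" and F: "\<And>a b. a \<le> b \<Longrightarrow> F b - F a = integral {a..b} h"
  obtains N where "negligible N" "\<And>x. x \<notin> N \<Longrightarrow> (F has_real_derivative h x) (at x)"
proof -
  have int: "h integrable_on cbox a b" for a b
  proof -
    have "set_integrable lborel {a..b} h"
      unfolding set_integrable_def using hi by (intro integrable_mult_indicator) auto
    then show ?thesis using set_borel_integral_eq_integral(1) by fastforce
  qed
  have int': "(\<lambda>x. h (- x)) integrable_on cbox a b" for a b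
    using int[of "-b" "-a"] Henstock_Kurzweil_Integration.integrable_reflect_real[where f = h and a = "-b" and b = "-a"] by simp
  obtain N1 where N1: "negligible N1" "\<And>x e. \<lbrakk>x \<notin> N1; 0 < e\<rbrakk> \<Longrightarrow>
               \<exists>d>0. \<forall>k. 0 < k \<and> k < d \<longrightarrow> norm (integral (cbox x (x + k *\<^sub>R One)) h /\<^sub>R k ^ DIM(real) - h x) < e"
    using integrable_ccontinuous_explicit[OF int] by metis
  obtain N2 where N2: "negligible N2" "\<And>x e. \<lbrakk>x \<notin> N2; 0 < e\<rbrakk> \<Longrightarrow>
               \<exists>d>0. \<forall>k. 0 < k \<and> k < d \<longrightarrow> norm (integral (cbox x (x + k *\<^sub>R One)) (\<lambda>x. h (- x)) /\<^sub>R k ^ DIM(real) - h (- x)) < e"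
    using integrable_ccontinuous_explicit[OF int'] by metis
  show ?thesis
  proof (rule that[of "N1 \<union> uminus ` N2"])
    have "negligible (uminus ` N2)"
      by (rule negligible_differentiable_image_negligible[OF _ N2(1)])
         (auto intro!: differentiable_on_minus differentiable_on_ident)
    then show "negligible (N1 \<union> uminus ` N2)" using N1(1) by simp
    fix x assume "x \<notin> N1 \<union> uminus ` N2"
    then have x1: "x \<notin> N1" and x2: "- x \<notin> N2" by (auto simp: image_iff)
    have "((\<lambda>k. (F (x + k) - F x) / k) \<longlongrightarrow> h x) (at 0)"
    proof (rule LIM_I)
      fix e :: real assume e: "e > 0"
      obtain d1 where d1: "d1 > 0" "\<And>k. 0 < k \<Longrightarrow> k < d1 \<Longrightarrow> \<bar>integral {x..x + k} h / k - h x\<bar> < e"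
        using N1(2)[OF x1 e] by (auto simp: divide_inverse mult.commute)
      obtain d2 where d2: "d2 > 0" "\<And>k. 0 < k \<Longrightarrow> k < d2 \<Longrightarrow> \<bar>integral {-x..-x + k} (\<lambda>x. h (- x)) / k - h x\<bar> < e"
        using N2(2)[OF x2 e] by (auto simp: divide_inverse mult.commute)
      have "norm ((F (x + k) - F x) / k - h x) < e" if k: "k \<noteq> 0" "norm (k - 0) < min d1 d2" for k
      proof (cases "k > 0")
        case True
        then show ?thesis using d1(2)[of k] k F[of x "x + k"] by simp
      next
        case False
        define l where "l = - k"
        have l: "l > 0" "l < d2" using False k by (auto simp: l_def)
        have "integral {-x..-x + l} (\<lambda>y. h (- y)) = integral {x - l..x} h"
          using Henstock_Kurzweil_Integration.integral_reflect_real[where a = "x - l" and b = x and f = h] by (simp add: algebra_simps)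
        also have "\<dots> = F x - F (x - l)" using F[of "x - l" x] l by simp
        finally have "\<bar>(F x - F (x - l)) / l - h x\<bar> < e" using d2(2)[OF l] by simp
        moreover have "(F (x + k) - F x) / k = (F x - F (x - l)) / l"
          by (simp add: l_def minus_divide_left[symmetric] diff_divide_distrib)
        ultimately show ?thesis by simp
      qed
      then show "\<exists>s>0. \<forall>k. k \<noteq> 0 \<and> norm (k - 0) < s \<longrightarrow> norm ((F (x + k) - F x) / k - h x) < e"
        using d1(1) d2(1) by (intro exI[of _ "min d1 d2"]) auto
    qed
    then show "(F has_real_derivative h x) (at x)" by (simp add: DERIV_def)
  qed
qed

section \<open>Absolute continuity of the kernel\<close>


lemma bshift_diff:
  assumes "F holomorphic_on UNIV" "G holomorphic_on UNIV"
  shows "bshift (\<lambda>z. F z - G z) = (\<lambda>z. bshift F z - bshift G z)"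
proof
  fix z
  show "bshift (\<lambda>z. F z - G z) z = bshift F z - bshift G z"
    by (rule entire_eq_off_point[where a = 0 and f = "bshift (\<lambda>z. F z - G z)" and g = "\<lambda>z. bshift F z - bshift G z"])
       (use assms in \<open>auto intro!: bshift_holomorphic holomorphic_intros simp: bshift_eq diff_divide_distrib\<close>)
qed

lemma bshift_sum:
  assumes "\<And>i. i \<in> A \<Longrightarrow> F i holomorphic_on UNIV"
  shows "bshift (\<lambda>z. \<Sum>i\<in>A. F i z) = (\<lambda>z. \<Sum>i\<in>A. bshift (F i) z)"
proof
  fix z
  show "bshift (\<lambda>z. \<Sum>i\<in>A. F i z) z = (\<Sum>i\<in>A. bshift (F i) z)"
    by (rule entire_eq_off_point[where a = 0 and f = "bshift (\<lambda>z. \<Sum>i\<in>A. F i z)" and g = "\<lambda>z. \<Sum>i\<in>A. bshift (F i) z"])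
       (use assms in \<open>auto intro!: bshift_holomorphic holomorphic_intros
          simp: bshift_eq sum_divide_distrib[symmetric] sum_subtractf[symmetric]\<close>)
qed

text \<open>Division by ix is skew on the real line, so the products F cnj(G) cancel and the
  integrand is (F cnj(G 0) - F 0 cnj(G))/(ix): the form sees only the pairing of each function with
  the value of the other at 0.\<close>

definition sform :: "real measure \<Rightarrow> (complex \<Rightarrow> complex) \<Rightarrow> (complex \<Rightarrow> complex) \<Rightarrow> complex" where
  "sform \<nu> F G = ip \<nu> (bshift F) G + ip \<nu> F (bshift G)"

locale sampling =
  fixes \<nu> :: "real measure"
  assumes sampling: "PW_sampling \<nu>"
begin

text \<open>Extension by 0 makes \<open>K\<close> monotone on the whole line, as an interval measure
  demands. That it also makes \<open>K\<close> continuous at 0 rests on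
  \<open>K_le_linear\<close>.\<close>

definition K :: "real \<Rightarrow> real" where
  "K t = (if t \<le> 0 then 0 else Re (PW_kernel \<nu> t 0))"

definition ker :: "real \<Rightarrow> complex \<Rightarrow> complex" where
  "ker t z = osc t z * PW_kernel \<nu> t z"

lemma kernel_at_0: "t > 0 \<Longrightarrow> PW_kernel \<nu> t 0 = complex_of_real (K t)"
  using PW_kernel_real[OF sampling, of t 0] by (simp add: K_def complex_eq_iff)

lemma ker_0: "t > 0 \<Longrightarrow> ker t 0 = complex_of_real (K t)"
  by (simp add: ker_def kernel_at_0)

lemma ker_PWs: "t > 0 \<Longrightarrow> ker t \<in> PWs t"
  unfolding ker_def[abs_def] by (intro PWsI PW_kernel_props[OF sampling])

lemma ip_ker:
  assumes "F \<in> PWs t" "t > 0" shows "ip \<nu> F (ker t) = F 0"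
proof -
  obtain f where f: "f \<in> PW t" "F = (\<lambda>z. osc t z * f z)" using PWsE[OF assms(1)] .
  then show ?thesis
    using PW_kernel_props(2)[OF sampling assms(2) f(1)] by (simp add: ker_def[abs_def] ip_osc)
qed

text \<open>The spaces are nested, so the larger kernel evaluates the smaller one at 0. Everything
  about increments follows: those over disjoint intervals are orthogonal, and their squared norms
  are increments of \<open>K\<close>.\<close>

lemma ip_ker_ker:
  assumes "0 < a" "a \<le> b"
  shows "ip \<nu> (ker a) (ker b) = complex_of_real (K a)" "ip \<nu> (ker b) (ker a) = complex_of_real (K a)"
proof -
  show 1: "ip \<nu> (ker a) (ker b) = complex_of_real (K a)"
    using ip_ker[OF PWs_mono[OF ker_PWs assms(2)]] ker_0 assms by simp
  show "ip \<nu> (ker b) (ker a) = complex_of_real (K a)" by (subst ip_commute) (simp add: 1)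
qed

lemma L2: "F \<in> PWs t \<Longrightarrow> t > 0 \<Longrightarrow> F \<in> L2fun \<nu>"
  by (rule PWs_L2fun[OF sampling])

lemma nsq_ker_diff:
  assumes "0 < a" "a \<le> b"
  shows "nsq \<nu> (\<lambda>z. ker b z - ker a z) = K b - K a"
proof -
  have "b > 0" using assms by simp
  then have k: "ker a \<in> L2fun \<nu>" "ker b \<in> L2fun \<nu>" using L2[OF ker_PWs] assms by auto
  note d = ip_diff_left[OF k(2,1)] ip_diff_right[OF k(2,1)] L2fun_diff[OF k(2,1)] k
  have "complex_of_real (nsq \<nu> (\<lambda>z. ker b z - ker a z)) = complex_of_real (K b - K a)"
    unfolding ip_self[symmetric] using d ip_ker_ker[OF assms] ip_ker_ker[of a a] ip_ker_ker[of b b] assms \<open>b > 0\<close>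
    by simp
  then show ?thesis using of_real_eq_iff by blast
qed

lemma nsq_ker: "t > 0 \<Longrightarrow> nsq \<nu> (ker t) = K t"
  using ip_ker_ker(1)[of t t] by (simp add: ip_self)

lemma K_nonneg: "K t \<ge> 0"
  using nsq_ker[of t] nsq_nonneg[of \<nu> "ker t"] by (cases "t > 0") (auto simp: K_def)

lemma K_mono: "x \<le> y \<Longrightarrow> K x \<le> K y"
  using nsq_ker_diff[of x y] nsq_nonneg[of \<nu> "\<lambda>z. ker y z - ker x z"] K_nonneg[of y]
  by (cases "x > 0") (auto simp: K_def)

text \<open>For \<open>F = ker a\<close>, \<open>G = ker b\<close> the form is \<open>\<integral> (F(x) K b - K a cnj(G(x)))/(ix) d\<nu>\<close>; its real part
  only sees \<open>sin(ax)/x\<close> and \<open>sin(bx)/x\<close>, which the kernels reproduce at \<open>0\<close>.\<close>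

lemma Re_sform_ker:
  assumes a: "a > 0" and b: "b > 0"
  shows "Re (sform \<nu> (ker a) (ker b)) = K b * a + K a * b"
proof -
  let ?\<kappa> = "PW_kernel \<nu>"
  define t where "t = max a b"
  have t: "t > 0" "a \<le> t" "b \<le> t" using a by (auto simp: t_def)
  have kP: "ker a \<in> PWs t" "ker b \<in> PWs t" using PWs_mono[OF ker_PWs] a b t by auto
  have kL: "ker a \<in> L2fun \<nu>" "ker b \<in> L2fun \<nu>" "bshift (ker a) \<in> L2fun \<nu>" "bshift (ker b) \<in> L2fun \<nu>"
    using kP bshift_PWs[OF kP(1)] bshift_PWs[OF kP(2)] L2 t(1) by auto
  define l where "l = (\<lambda>x. Re (bshift (ker a) (complex_of_real x) * cnj (ker b (complex_of_real x)))
      + Re (ker a (complex_of_real x) * cnj (bshift (ker b) (complex_of_real x))))"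
  define r where "r = (\<lambda>x. K b * Re (sinq a (complex_of_real x) * cnj (?\<kappa> a (complex_of_real x)))
      + K a * Re (sinq b (complex_of_real x) * cnj (?\<kappa> b (complex_of_real x))))"
  have cr: "continuous_on UNIV (\<lambda>x. f (complex_of_real x))" if "f holomorphic_on UNIV" for f
    by (rule continuous_on_compose2[OF holomorphic_on_imp_continuous_on[OF that]]) (auto intro!: continuous_intros)
  have hol: "ker a holomorphic_on UNIV" "ker b holomorphic_on UNIV"
    "?\<kappa> a holomorphic_on UNIV" "?\<kappa> b holomorphic_on UNIV"
    "sinq a holomorphic_on UNIV" "sinq b holomorphic_on UNIV"
    using kP PWs_holomorphic PW_holomorphic[OF PW_kernel_props(1)[OF sampling a]]
      PW_holomorphic[OF PW_kernel_props(1)[OF sampling b]] PW_holomorphic[OF sinq_PW[of a]] PW_holomorphic[OF sinq_PW[of b]] a b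
    by auto
  have cl: "continuous_on UNIV l" unfolding l_def
    by (intro continuous_intros cr hol bshift_holomorphic)
  have cr': "continuous_on UNIV r" unfolding r_def by (intro continuous_intros cr hol)
  have off: "l x = r x" if x: "x \<noteq> 0" for x
  proof -
    have real: "?\<kappa> c (complex_of_real x) = complex_of_real (Re (?\<kappa> c (complex_of_real x)))" if "c > 0" for c
      using PW_kernel_real[OF sampling that, of x] by (simp add: complex_eq_iff)
    define u v where "u = Re (?\<kappa> a (complex_of_real x))" and "v = Re (?\<kappa> b (complex_of_real x))"
    have o: "osc c (complex_of_real x) = Complex (cos (c * x)) (sin (c * x))" for c
      by (simp add: osc_def complex_eq_iff Re_exp Im_exp)
    have ka: "ker a (complex_of_real x) = Complex (u * cos (a * x)) (u * sin (a * x))"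
      unfolding ker_def o using real[OF a] by (simp add: u_def complex_eq_iff)
    have kb: "ker b (complex_of_real x) = Complex (v * cos (b * x)) (v * sin (b * x))"
      unfolding ker_def o using real[OF b] by (simp add: v_def complex_eq_iff)
    have bs: "bshift (ker c) (complex_of_real x) = Complex (Im (ker c (complex_of_real x)) / x) ((K c - Re (ker c (complex_of_real x))) / x)"
      if "c > 0" for c
      using x that by (simp add: bshift_eq ker_0 complex_eq_iff Re_divide Im_divide power2_eq_square divide_simps)
    have sq: "sinq c (complex_of_real x) = complex_of_real (sin (c * x) / x)" for c
      using x by (simp add: sinq_def divdiff_eq sin_of_real flip: of_real_mult)
    have "l x = (K a * (v * sin (b * x)) + K b * (u * sin (a * x))) / x"
      unfolding l_def bs[OF a] bs[OF b] ka kb by (simp add: field_simps x)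
    also have "\<dots> = r x" unfolding r_def sq u_def v_def by (simp add: add_divide_distrib mult_ac)
    finally show ?thesis .
  qed
  \<comment> \<open>The point 0 cannot be neglected, since \<nu> may have an atom there; the two
    sides agree at 0 by continuity.\<close>
  have "l x = r x" for x
  proof (cases "x = 0")
    case True
    have "l \<midarrow>0\<rightarrow> l 0" "r \<midarrow>0\<rightarrow> r 0" using cl cr' by (simp_all add: continuous_on_def)
    moreover have "l \<midarrow>0\<rightarrow> r 0 \<longleftrightarrow> r \<midarrow>0\<rightarrow> r 0"
      by (rule tendsto_cong) (use off in \<open>auto simp: eventually_at_filter\<close>)
    ultimately show ?thesis using True LIM_unique by blast
  qed (rule off)
  then have lr: "l = r" by blast
  have Re_ip: "Re (ip \<nu> f g) = (LINT x|\<nu>. Re (f (complex_of_real x) * cnj (g (complex_of_real x))))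
       \<and> integrable \<nu> (\<lambda>x. Re (f (complex_of_real x) * cnj (g (complex_of_real x))))"
    if "f \<in> L2fun \<nu>" "g \<in> L2fun \<nu>" for f g
    using L2fun_prod_integrable[OF that] unfolding ip_def by (metis integrable_Re integral_Re)
  have "Re (sform \<nu> (ker a) (ker b)) = (LINT x|\<nu>. l x)"
    unfolding sform_def l_def using Re_ip[OF kL(3,2)] Re_ip[OF kL(1,4)]
    by (simp only: plus_complex.sel) (subst Bochner_Integration.integral_add, auto)
  also have "\<dots> = (LINT x|\<nu>. r x)" by (simp add: lr)
  also have "\<dots> = K b * Re (ip \<nu> (sinq a) (?\<kappa> a)) + K a * Re (ip \<nu> (sinq b) (?\<kappa> b))"
  proof -
    have sL: "sinq c \<in> L2fun \<nu>" "?\<kappa> c \<in> L2fun \<nu>" if "c > 0" for c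
      using PW_L2fun_sampling[OF sampling sinq_PW] PW_L2fun_sampling[OF sampling PW_kernel_props(1)[OF sampling]] that by auto
    show ?thesis unfolding r_def using Re_ip[OF sL(1)[OF a] sL(2)[OF a]] Re_ip[OF sL(1)[OF b] sL(2)[OF b]]
      by (subst Bochner_Integration.integral_add) auto
  qed
  also have "\<dots> = K b * a + K a * b"
    using PW_kernel_props(2)[OF sampling a sinq_PW[of a]] PW_kernel_props(2)[OF sampling b sinq_PW[of b]] a b
    by (simp add: sinq_0)
  finally show ?thesis .
qed

lemma kernel_grid_inequality_pos:
  assumes T: "T > 0"
  obtains D where "D > 0" "\<And>s t n J. 0 < s \<Longrightarrow> s < t \<Longrightarrow> t \<le> T \<Longrightarrow> n > 0 \<Longrightarrow> J \<subseteq> {..<n} \<Longrightarrow>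
     (K t - K s) * (real (card J) / real n)\<^sup>2 \<le> D * (\<Sum>j\<in>J. K (gridpt s t n (Suc j)) - K (gridpt s t n j))"
proof -
  obtain D where D: "D > 0" "\<And>s t F G. 0 < s \<Longrightarrow> s < t \<Longrightarrow> t \<le> T \<Longrightarrow> F \<in> PWs t \<Longrightarrow> G \<in> PWs t \<Longrightarrow>
     (\<And>H. H \<in> PWs s \<Longrightarrow> ip \<nu> F H = 0) \<Longrightarrow>
     (cmod (ip \<nu> F (bshift G)))\<^sup>2 \<le> D * (t - s)\<^sup>2 * nsq \<nu> F * nsq \<nu> G"
    using bshift_orthogonal_estimate[OF sampling T] by metis
  show ?thesis
  proof (rule that[of "4 * D"])
    fix s t :: real and n :: nat and J :: "nat set"
    assume st: "0 < s" "s < t" "t \<le> T" and n: "n > 0" and J: "J \<subseteq> {..<n}"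
    define x where "x = gridpt s t n"
    have t: "t > 0" using st by simp
    have fin: "finite J" using J finite_subset by blast
    have xm: "i \<le> j \<Longrightarrow> x i \<le> x j" for i j using gridpt_mono[of s t i j n] st by (simp add: x_def)
    have xs: "x i > 0" "s \<le> x i" for i using xm[of 0 i] st by (auto simp: x_def)
    have xt: "x (Suc j) \<le> t" if "j \<in> J" for j using xm[of "Suc j" n] that J n by (auto simp: x_def)
    have kP: "ker (x (Suc j)) \<in> PWs t" "ker (x j) \<in> PWs t" if "j \<in> J" for j
      using PWs_mono[OF ker_PWs[OF xs(1)]] xt[OF that] xm[of j "Suc j"] by auto
    have kI: "ker t \<in> PWs t" "ker s \<in> PWs t" using PWs_mono[OF ker_PWs] st by auto
    define p where "p = (\<lambda>j z. ker (x (Suc j)) z - ker (x j) z)"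
    define P where "P = (\<lambda>z. \<Sum>j\<in>J. p j z)"
    define Q where "Q = (\<lambda>z. ker t z - ker s z)"
    have pP: "p j \<in> PWs t" if "j \<in> J" for j unfolding p_def by (intro PWs_diff kP that)
    have PP: "P \<in> PWs t" unfolding P_def by (intro PWs_sum pP)
    have QP: "Q \<in> PWs t" unfolding Q_def by (intro PWs_diff kI)
    note L = L2[OF _ t]
    \<comment> \<open>Every kernel of index at least s evaluates the functions of
      \<open>PWs s\<close> at 0, so differences of such kernels are orthogonal to this
      space.\<close>
    have orthd: "ip \<nu> (\<lambda>z. ker b z - ker a z) H = 0"
      if H: "H \<in> PWs s" and ab: "s \<le> a" "a \<le> b" "b \<le> t" for a b H
    proof -
      have pos: "a > 0" "b > 0" using ab st by auto
      have "ip \<nu> (ker c) H = cnj (H 0)" if "s \<le> c" "c > 0" for c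
        by (subst ip_commute) (use ip_ker[OF PWs_mono[OF H that(1)] that(2)] in simp)
      then have "ip \<nu> (ker b) H = ip \<nu> (ker a) H" using ab pos by simp
      moreover have "ker a \<in> L2fun \<nu>" "ker b \<in> L2fun \<nu>" "H \<in> L2fun \<nu>"
        using L2[OF ker_PWs] pos L2[OF H st(1)] by auto
      ultimately show ?thesis by (simp add: ip_diff_left)
    qed
    have orthP: "ip \<nu> P H = 0" if H: "H \<in> PWs s" for H
    proof -
      have "ip \<nu> P H = (\<Sum>j\<in>J. ip \<nu> (p j) H)"
        unfolding P_def by (intro ip_sum_left L pP L2[OF H st(1)])
      also have "\<dots> = 0" unfolding p_def by (intro sum.neutral ballI orthd[OF H] xs xm xt) auto
      finally show ?thesis .
    qed
    have orthQ: "ip \<nu> Q H = 0" if "H \<in> PWs s" for H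
      unfolding Q_def using orthd[OF that, of s t] st by simp
    have nQ: "nsq \<nu> Q = K t - K s" unfolding Q_def using nsq_ker_diff st by simp
    have pp: "ip \<nu> (p i) (p j) = (if i = j then complex_of_real (K (x (Suc j)) - K (x j)) else 0)" if ij: "i \<in> J" "j \<in> J" for i j
    proof -
      have zero: "ip \<nu> (p i) (p j) = 0" if "i < j" "i \<in> J" "j \<in> J" for i j
      proof -
        have "ip \<nu> (p i) (p j) = ip \<nu> (p i) (ker (x (Suc j))) - ip \<nu> (p i) (ker (x j))"
          unfolding p_def by (intro ip_diff_right L kP PWs_diff that)
        also have "\<dots> = 0"
        proof -
          have "p i \<in> PWs (x j)" unfolding p_def
            using xm[of "Suc i" j] xm[of i j] that by (intro PWs_diff PWs_mono[OF ker_PWs[OF xs(1)]]) auto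
          then show ?thesis using ip_ker[OF _ xs(1)] PWs_mono[of "p i" "x j" "x (Suc j)"] xm[of j "Suc j"] by simp
        qed
        finally show ?thesis .
      qed
      consider "i = j" | "i < j" | "j < i" by linarith
      then show ?thesis
      proof cases
        case 1
        then show ?thesis using nsq_ker_diff[OF xs(1)[of j] xm[of j "Suc j"]] by (simp add: ip_self p_def)
      next
        case 2 then show ?thesis using zero ij by simp
      next
        case 3 then show ?thesis using zero[of j i] ij by (subst ip_commute) simp
      qed
    qed
    have nP: "nsq \<nu> P = (\<Sum>j\<in>J. K (x (Suc j)) - K (x j))"
    proof -
      have "complex_of_real (nsq \<nu> P) = (\<Sum>i\<in>J. ip \<nu> (p i) P)"
        unfolding ip_self[symmetric] by (subst P_def) (intro ip_sum_left L pP PP)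
      also have "\<dots> = (\<Sum>i\<in>J. \<Sum>j\<in>J. ip \<nu> (p i) (p j))"
        unfolding P_def by (intro sum.cong refl ip_sum_right L pP)
      also have "\<dots> = (\<Sum>i\<in>J. complex_of_real (K (x (Suc i)) - K (x i)))"
        using fin by (intro sum.cong refl) (simp add: pp sum.delta)
      finally show ?thesis by (metis of_real_eq_iff of_real_sum)
    qed
    \<comment> \<open>Expanding a K b + b K a over both increments gives a product rule, K(I)|I_j| +
      K(I_j)|I| with I_j the j-th cell. The second summand is nonnegative and is dropped from the
      lower bound that follows.\<close>
    have Re_pQ: "Re (sform \<nu> (p j) Q) = (K t - K s) * (x (Suc j) - x j) + (K (x (Suc j)) - K (x j)) * (t - s)" if j: "j \<in> J" for j
    proof -
      have bl: "sform \<nu> (\<lambda>z. A z - A' z) G = sform \<nu> A G - sform \<nu> A' G" "sform \<nu> G (\<lambda>z. A z - A' z) = sform \<nu> G A - sform \<nu> G A'"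
        if "A \<in> PWs t" "A' \<in> PWs t" "G \<in> PWs t" for A A' G
        using that t bshift_PWs[of _ t]
        by (simp_all add: sform_def bshift_diff[OF PWs_holomorphic[of _ t] PWs_holomorphic[of _ t]] ip_diff_left ip_diff_right L)
      have "sform \<nu> (p j) Q = (sform \<nu> (ker (x (Suc j))) (ker t) - sform \<nu> (ker (x (Suc j))) (ker s))
         - (sform \<nu> (ker (x j)) (ker t) - sform \<nu> (ker (x j)) (ker s))"
        unfolding p_def Q_def using kP[OF j] kI by (simp add: bl PWs_diff)
      then have "Re (sform \<nu> (p j) Q) = (Re (sform \<nu> (ker (x (Suc j))) (ker t)) - Re (sform \<nu> (ker (x (Suc j))) (ker s)))
         - (Re (sform \<nu> (ker (x j)) (ker t)) - Re (sform \<nu> (ker (x j)) (ker s)))" by simp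
      then show ?thesis unfolding Re_sform_ker[OF xs(1) t] Re_sform_ker[OF xs(1) st(1)] by (simp add: algebra_simps)
    qed
    have "sform \<nu> P Q = (\<Sum>j\<in>J. sform \<nu> (p j) Q)"
    proof -
      have "bshift P = (\<lambda>z. \<Sum>j\<in>J. bshift (p j) z)"
        unfolding P_def by (intro bshift_sum PWs_holomorphic[OF pP])
      then have "ip \<nu> (bshift P) Q = (\<Sum>j\<in>J. ip \<nu> (bshift (p j)) Q)"
        using t by (simp add: ip_sum_left L bshift_PWs pP QP)
      moreover have "ip \<nu> P (bshift Q) = (\<Sum>j\<in>J. ip \<nu> (p j) (bshift Q))"
        unfolding P_def using t by (intro ip_sum_left L pP bshift_PWs QP) auto
      ultimately show ?thesis by (simp add: sform_def sum.distrib)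
    qed
    then have "Re (sform \<nu> P Q) = (\<Sum>j\<in>J. (K t - K s) * (x (Suc j) - x j) + (K (x (Suc j)) - K (x j)) * (t - s))"
      by (simp add: Re_pQ)
    also have "\<dots> \<ge> (\<Sum>j\<in>J. (K t - K s) * ((t - s) / real n))"
    proof (rule sum_mono)
      fix j
      have "(K (x (Suc j)) - K (x j)) * (t - s) \<ge> 0" using K_mono[OF xm[of j "Suc j"]] st by simp
      moreover have "x (Suc j) - x j = (t - s) / real n" by (simp add: x_def gridpt_Suc)
      ultimately show "(K t - K s) * ((t - s) / real n) \<le> (K t - K s) * (x (Suc j) - x j) + (K (x (Suc j)) - K (x j)) * (t - s)"
        by simp
    qed
    finally have low: "(K t - K s) * (t - s) * (real (card J) / real n) \<le> Re (sform \<nu> P Q)"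
      by (simp add: mult_ac)
    \<comment> \<open>\<open>P\<close> and \<open>Q\<close> are both orthogonal to the space of
      index s, so each half of the form is at most \<open>sqrt M\<close>.\<close>
    define M where "M = D * (t - s)\<^sup>2 * nsq \<nu> P * nsq \<nu> Q"
    have M0: "M \<ge> 0" using D by (simp add: M_def)
    have "(cmod (ip \<nu> P (bshift Q)))\<^sup>2 \<le> M" unfolding M_def by (rule D(2)[OF st PP QP orthP])
    then have 1: "cmod (ip \<nu> P (bshift Q)) \<le> sqrt M" by (rule real_le_rsqrt)
    have "(cmod (ip \<nu> Q (bshift P)))\<^sup>2 \<le> D * (t - s)\<^sup>2 * nsq \<nu> Q * nsq \<nu> P" by (rule D(2)[OF st QP PP orthQ])
    then have "(cmod (ip \<nu> (bshift P) Q))\<^sup>2 \<le> M" by (subst ip_commute) (simp add: M_def mult_ac)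
    then have 2: "cmod (ip \<nu> (bshift P) Q) \<le> sqrt M" by (rule real_le_rsqrt)
    have "Re (sform \<nu> P Q) \<le> cmod (sform \<nu> P Q)" by (rule complex_Re_le_cmod)
    also have "\<dots> \<le> 2 * sqrt M" unfolding sform_def using norm_triangle_ineq[of "ip \<nu> (bshift P) Q" "ip \<nu> P (bshift Q)"] 1 2 by linarith
    finally have "(K t - K s) * (t - s) * (real (card J) / real n) \<le> 2 * sqrt M" using low by linarith
    moreover have "K t - K s \<ge> 0" using K_mono[of s t] st by simp
    \<comment> \<open>After squaring, the inequality reads K(I)^2 |E|^2 <= 4D |I|^2 K(E) K(I), with
      |E| in units of |I|: the factor (t-s)^2 and then one factor K(I) are cancelled, the case K(I)
      = 0 being trivial.\<close>
    ultimately have "((K t - K s) * (t - s) * (real (card J) / real n))\<^sup>2 \<le> (2 * sqrt M)\<^sup>2"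
      using st by (intro power_mono) auto
    moreover have "((K t - K s) * (t - s) * (real (card J) / real n))\<^sup>2
        = (t - s)\<^sup>2 * ((K t - K s) * ((K t - K s) * (real (card J) / real n)\<^sup>2))"
      by (simp only: power2_eq_square mult_ac)
    moreover have "(2 * sqrt M)\<^sup>2 = 4 * M" using M0 by simp
    moreover have "4 * M = (t - s)\<^sup>2 * ((K t - K s) * (4 * D * nsq \<nu> P))"
      unfolding M_def nQ by (simp only: mult_ac)
    ultimately have "(t - s)\<^sup>2 * ((K t - K s) * ((K t - K s) * (real (card J) / real n)\<^sup>2)) \<le> (t - s)\<^sup>2 * ((K t - K s) * (4 * D * nsq \<nu> P))"
      by simp
    then have "(K t - K s) * ((K t - K s) * (real (card J) / real n)\<^sup>2) \<le> (K t - K s) * (4 * D * nsq \<nu> P)"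
      using st by (subst (asm) mult_le_cancel_left_pos) auto
    then have "(K t - K s) * (real (card J) / real n)\<^sup>2 \<le> 4 * D * nsq \<nu> P"
    proof (cases "K t - K s = 0")
      case False
      then have "K t - K s > 0" using \<open>K t - K s \<ge> 0\<close> by simp
      then show ?thesis using \<open>(K t - K s) * ((K t - K s) * (real (card J) / real n)\<^sup>2) \<le> (K t - K s) * (4 * D * nsq \<nu> P)\<close>
        by (subst (asm) mult_le_cancel_left_pos)
    qed (use D in simp)
    then show "(K t - K s) * (real (card J) / real n)\<^sup>2 \<le> 4 * D * (\<Sum>j\<in>J. K (gridpt s t n (Suc j)) - K (gridpt s t n j))"
      by (simp add: nP x_def)
  qed (use D in simp)
qed

text \<open>Dilation turns the kernel of index t into a function of type 1 whose squared Lebesgue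
  norm carries an extra factor t. The pointwise bound at 0 for type 1, with constant exp 4, and
  sampling on the one space \<open>PW 1\<close> bound the square of K t by a multiple of t K
  t.\<close>

lemma K_le_linear:
  obtains c where "c > 0" "\<And>t. 0 < t \<Longrightarrow> t \<le> 1 \<Longrightarrow> K t \<le> c * t"
proof -
  obtain C where C: "C > 0" "\<And>f. f \<in> PW 1 \<Longrightarrow> nsq lborel f \<le> C * nsq \<nu> f"
    using sampling_bounds[OF sampling, of 1] by (metis zero_less_one)
  show ?thesis
  proof (rule that[of "exp 4 * C"])
    fix t :: real assume t: "0 < t" "t \<le> 1"
    let ?k = "PW_kernel \<nu> t"
    have k: "?k \<in> PW t" by (rule PW_kernel_props[OF sampling t(1)])
    define g where "g = (\<lambda>z. ?k (z / complex_of_real t))"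
    have hk: "?k holomorphic_on UNIV" by (rule PW_holomorphic[OF k])
    let ?q = "\<lambda>x. (cmod (?k (complex_of_real x)))\<^sup>2"
    have qg: "?q (0 + (1 / t) * x) = (cmod (g (complex_of_real x)))\<^sup>2" for x by (simp add: g_def)
    have gint: "integrable lborel (\<lambda>x. (cmod (g (complex_of_real x)))\<^sup>2)"
      unfolding qg[symmetric] using lborel_integrable_real_affine_iff[of "1/t" ?q 0] L2fun_integrable[OF PW_L2fun[OF k]] t by simp
    have hg: "g holomorphic_on UNIV" unfolding g_def
    proof -
      have "(\<lambda>z. z / complex_of_real t) holomorphic_on UNIV" using t by (intro holomorphic_intros) auto
      from holomorphic_on_compose_gen[OF this hk] show "(\<lambda>z. ?k (z / complex_of_real t)) holomorphic_on UNIV"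
        by (simp add: o_def)
    qed
    have "exp_type_le 1 g" unfolding exp_type_le_def
    proof (intro allI impI)
      fix \<epsilon> :: real assume e: "\<epsilon> > 0"
      obtain A where A: "A > 0" "\<And>z. cmod (?k z) \<le> A * exp ((t + \<epsilon> * t) * cmod z)"
        using exp_type_leD[OF PW_exp_type[OF k], of "\<epsilon> * t"] e t by auto
      have "cmod (g z) \<le> A * exp ((1 + \<epsilon>) * cmod z)" for z
      proof -
        have "(t + \<epsilon> * t) * cmod (z / complex_of_real t) = (1 + \<epsilon>) * cmod z"
          using t by (simp add: norm_divide field_simps)
        then show ?thesis using A(2)[of "z / complex_of_real t"] by (simp add: g_def)
      qed
      then show "\<exists>C. \<forall>z. cmod (g z) \<le> C * exp ((1 + \<epsilon>) * cmod z)" by blast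
    qed
    moreover have "g \<in> L2fun lborel" using gint entire_measurable[OF hg] by (intro L2funI) auto
    ultimately have g: "g \<in> PW 1" using hg by (intro PWI)
    have "nsq lborel ?k = (1 / t) * nsq lborel g"
      using lborel_integral_real_affine[of "1/t" ?q 0] t unfolding qg nsq_def by simp
    then have ng: "nsq lborel g = t * nsq lborel ?k" using t by simp
    have "(K t)\<^sup>2 = (cmod (g 0))\<^sup>2" using kernel_at_0[OF t(1)] by (simp add: g_def)
    also have "\<dots> \<le> exp 4 * nsq lborel g" using PW_pointwise_bound[OF g, of 0] by simp
    also have "\<dots> \<le> exp 4 * (t * (C * nsq \<nu> ?k))" unfolding ng
      using C(2)[OF PW_mono[OF k t(2)]] t by (intro mult_left_mono) auto
    also have "nsq \<nu> ?k = K t" using nsq_ker[OF t(1)] by (simp add: ker_def[abs_def] nsq_osc)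
    finally have "K t * K t \<le> (exp 4 * C * t) * K t" by (simp add: power2_eq_square mult_ac)
    then show "K t \<le> exp 4 * C * t"
      using K_nonneg[of t] C t by (cases "K t = 0") auto
  qed (use C in simp)
qed

text \<open>At a point x > 0 the grid inequality itself excludes a jump: halving an interval about x
  shrinks the increment of \<open>K\<close> by a fixed factor below 1. At 0 the linear bound takes
  over.\<close>

lemma K_continuous: "continuous_on UNIV K"
proof -
  have "isCont K x" for x
  proof -
    consider "x < 0" | "x = 0" | "x > 0" by linarith
    then show ?thesis
    proof cases
      case 1
      have "continuous_on {..<0} K \<longleftrightarrow> continuous_on {..<0} (\<lambda>x::real. 0::real)"
        by (rule continuous_on_cong) (auto simp: K_def)
      then show ?thesis using 1 by (simp add: continuous_on_eq_continuous_at)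
    next
      case 2
      obtain c where c: "c > 0" "\<And>t. 0 < t \<Longrightarrow> t \<le> 1 \<Longrightarrow> K t \<le> c * t" using K_le_linear by blast
      have "K \<midarrow>0\<rightarrow> 0"
      proof (rule Lim_null_comparison)
        have "((\<lambda>y. c * \<bar>y\<bar>) \<longlongrightarrow> c * \<bar>0\<bar>) (at (0::real))" by (intro tendsto_intros)
        then show "((\<lambda>y. c * \<bar>y\<bar>) \<longlongrightarrow> 0) (at (0::real))" by simp
        have "norm (K y) \<le> c * \<bar>y\<bar>" if "y < 1" for y
          using c(2)[of y] K_nonneg[of y] that c(1) by (cases "y > 0") (auto simp: K_def intro!: mult_nonneg_nonpos)
        then show "\<forall>\<^sub>F y in at 0. norm (K y) \<le> c * \<bar>y\<bar>"
          by (intro eventually_mono[OF order_tendstoD(2)[OF tendsto_ident_at, of 0 1]]) auto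
      qed
      then show ?thesis using 2 by (simp add: isCont_def K_def)
    next
      case 3
      obtain D where D: "D > 0" "\<And>s t n J. 0 < s \<Longrightarrow> s < t \<Longrightarrow> t \<le> 2 * x \<Longrightarrow> n > 0 \<Longrightarrow> J \<subseteq> {..<n} \<Longrightarrow>
         (K t - K s) * (real (card J) / real n)\<^sup>2 \<le> D * (\<Sum>j\<in>J. K (gridpt s t n (Suc j)) - K (gridpt s t n j))"
        using kernel_grid_inequality_pos[of "2 * x"] 3 by auto
      \<comment> \<open>The largest interval is [x/2, 3x/2], inside (0, 2x], so one constant
        \<open>D\<close> serves all n.\<close>
      define d where "d = (\<lambda>n::nat. x / 2 / 2 ^ n)"
      define w where "w = (\<lambda>n. K (x + d n) - K (x - d n))"
      \<comment> \<open>The maximum with 0 covers \<open>D\<close> below 1/4, where the contraction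
        factor would be negative and its powers of no use.\<close>
      define q where "q = max 0 (1 - 1 / (4 * D))"
      have q: "0 \<le> q" "q < 1" using D(1) by (auto simp: q_def)
      have d: "0 < d n" "d n < x" "d (Suc n) = d n / 2" for n
      proof -
        have "x / 2 / 2 ^ n \<le> x / 2 / 1" using 3 by (intro divide_left_mono) auto
        then show "0 < d n" "d n < x" "d (Suc n) = d n / 2" using 3 by (auto simp: d_def)
      qed
      have w0: "w n \<ge> 0" for n unfolding w_def using K_mono[of "x - d n" "x + d n"] d(1)[of n] by simp
      have step: "w (Suc n) \<le> q * w n" for n
      proof -
        \<comment> \<open>Of four equal cells the outer two, 0 and 3, make up half the length, so
          their share of the increment is at least 1/(4D); what remains is the increment over the
          halved interval.\<close>
        let ?g = "gridpt (x - d n) (x + d n) 4"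
        have g: "?g 0 = x - d n" "?g 1 = x - d (Suc n)" "?g 3 = x + d (Suc n)" "?g 4 = x + d n"
          by (simp_all add: gridpt_def d(3) field_simps)
        have "w n * (real (card {0, 3::nat}) / real 4)\<^sup>2 \<le> D * (\<Sum>j\<in>{0,3}. K (?g (Suc j)) - K (?g j))"
          unfolding w_def by (rule D(2)) (use d[of n] in auto)
        also have "(\<Sum>j\<in>{0,3}. K (?g (Suc j)) - K (?g j)) = w n - w (Suc n)"
          using g by (simp add: w_def numeral_eq_Suc)
        finally have "w n / 4 \<le> D * (w n - w (Suc n))" by (simp add: power2_eq_square)
        then have "w (Suc n) \<le> (1 - 1 / (4 * D)) * w n" using D(1) by (simp add: field_simps)
        also have "\<dots> \<le> q * w n" using w0[of n] by (intro mult_right_mono) (auto simp: q_def)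
        finally show ?thesis .
      qed
      have wn: "w n \<le> q ^ n * w 0" for n
      proof (induction n)
        case (Suc n)
        have "w (Suc n) \<le> q * (q ^ n * w 0)" using step[of n] mult_left_mono[OF Suc q(1)] by linarith
        then show ?case by (simp add: mult.assoc)
      qed simp
      show ?thesis
        unfolding continuous_at_eps_delta
      proof (intro allI impI)
        fix e :: real assume e: "e > 0"
        have "(\<lambda>n. q ^ n * w 0) \<longlonglongrightarrow> 0 * w 0" using q by (intro tendsto_intros LIMSEQ_realpow_zero)
        then have "\<forall>\<^sub>F n in sequentially. q ^ n * w 0 < e" using e by (intro order_tendstoD(2)) auto
        then obtain n where n: "q ^ n * w 0 < e" using eventually_happens'[OF sequentially_bot] by blast
        have "dist (K y) (K x) < e" if "dist y x < d n" for y
        proof -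
          have "x - d n \<le> y" "y \<le> x + d n" using that by (auto simp: dist_real_def)
          then have "K (x - d n) \<le> K y" "K y \<le> K (x + d n)" "K (x - d n) \<le> K x" "K x \<le> K (x + d n)"
            using d(1)[of n] by (auto intro!: K_mono)
          then have "\<bar>K y - K x\<bar> \<le> w n" unfolding w_def by (simp add: abs_le_iff)
          then show ?thesis using wn[of n] n by (simp add: dist_real_def)
        qed
        then show "\<exists>r>0. \<forall>y. dist y x < r \<longrightarrow> dist (K y) (K x) < e" using d(1) by blast
      qed
    qed
  qed
  then show ?thesis by (simp add: continuous_at_imp_continuous_on)
qed

text \<open>The kernel spaces give the inequality for s > 0. With n and \<open>J\<close> fixed, both
  sides are continuous in s, so s may decrease to 0.\<close>

lemma kernel_grid_inequality:
  assumes T: "T > 0"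
  obtains D where "D > 0" "\<And>s t n J. 0 \<le> s \<Longrightarrow> s < t \<Longrightarrow> t \<le> T \<Longrightarrow> n > 0 \<Longrightarrow> J \<subseteq> {..<n} \<Longrightarrow>
     (K t - K s) * (real (card J) / real n)\<^sup>2 \<le> D * (\<Sum>j\<in>J. K (gridpt s t n (Suc j)) - K (gridpt s t n j))"
proof -
  obtain D where D: "D > 0" "\<And>s t n J. 0 < s \<Longrightarrow> s < t \<Longrightarrow> t \<le> T \<Longrightarrow> n > 0 \<Longrightarrow> J \<subseteq> {..<n} \<Longrightarrow>
     (K t - K s) * (real (card J) / real n)\<^sup>2 \<le> D * (\<Sum>j\<in>J. K (gridpt s t n (Suc j)) - K (gridpt s t n j))"
    using kernel_grid_inequality_pos[OF T] by blast
  have cK: "continuous_on A (\<lambda>u. K (f u))" if "continuous_on A f" for f :: "real \<Rightarrow> real" and A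
    by (rule continuous_on_compose2[OF K_continuous that]) auto
  show ?thesis
  proof (rule that[OF D(1)])
    fix s t :: real and n :: nat and J
    assume a: "0 \<le> s" "s < t" "t \<le> T" "n > 0" "J \<subseteq> {..<n}"
    define l where "l = (\<lambda>s. (K t - K s) * (real (card J) / real n)\<^sup>2)"
    define r where "r = (\<lambda>s. D * (\<Sum>j\<in>J. K (gridpt s t n (Suc j)) - K (gridpt s t n j)))"
    have "continuous_on UNIV l" unfolding l_def by (intro continuous_intros cK)
    moreover have "continuous_on UNIV r" unfolding r_def gridpt_def using a(4) by (intro continuous_intros cK) auto
    ultimately have "(l \<longlongrightarrow> l s) (at_right s)" "(r \<longlongrightarrow> r s) (at_right s)"
      by (auto simp: continuous_on_def intro: tendsto_within_subset)
    moreover have "\<forall>\<^sub>F u in at_right s. l u \<le> r u"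
      using a D(2) by (auto simp: l_def r_def intro!: eventually_at_rightI[of s t])
    ultimately have "l s \<le> r s" using tendsto_le[OF trivial_limit_at_right_real] by blast
    then show "(K t - K s) * (real (card J) / real n)\<^sup>2 \<le> D * (\<Sum>j\<in>J. K (gridpt s t n (Suc j)) - K (gridpt s t n j))"
      by (simp add: l_def r_def)
  qed
qed

lemma K_derivative:
  assumes T: "T > 0"
  obtains h N where "integrable lborel h" "negligible N"
    "\<And>t. 0 < t \<Longrightarrow> t < T \<Longrightarrow> t \<notin> N \<Longrightarrow> (K has_real_derivative h t) (at t)"
    "\<And>t. 0 \<le> t \<Longrightarrow> t < T \<Longrightarrow> integral {0..t} h = K t"
proof -
  obtain D where D: "D > 0" "\<And>s t n J. 0 \<le> s \<Longrightarrow> s < t \<Longrightarrow> t \<le> T \<Longrightarrow> n > 0 \<Longrightarrow> J \<subseteq> {..<n} \<Longrightarrow>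
     (K t - K s) * (real (card J) / real n)\<^sup>2 \<le> D * (\<Sum>j\<in>J. K (gridpt s t n (Suc j)) - K (gridpt s t n j))"
    using kernel_grid_inequality[OF T] by blast
  define F where "F = (\<lambda>x. K (min x T))"
  have FK: "F x = K x" if "x \<le> T" for x using that by (simp add: F_def)
  interpret grid_doubling F T D
  proof
    show "F x \<le> F y" if "x \<le> y" for x y unfolding F_def by (rule K_mono) (use that in auto)
    show "continuous_on UNIV F" unfolding F_def
      by (rule continuous_on_compose2[OF K_continuous]) (auto intro!: continuous_intros)
    show "F x = F 0" if "x \<le> 0" for x using that T by (simp add: F_def K_def)
    show "F x = F T" if "x \<ge> T" for x using that by (simp add: F_def)
    fix s t :: real and n :: nat and J
    assume a: "0 \<le> s" "s < t" "t \<le> T" "n > 0" "J \<subseteq> {..<n}"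
    have g: "gridpt s t n j \<le> T" if "j \<le> n" for j
      using gridpt_mono[of s t j n n] that a by simp
    have "(\<Sum>j\<in>J. F (gridpt s t n (Suc j)) - F (gridpt s t n j)) = (\<Sum>j\<in>J. K (gridpt s t n (Suc j)) - K (gridpt s t n j))"
      using a(5) by (intro sum.cong refl) (auto simp: FK g)
    then show "(F t - F s) * (real (card J) / real n)\<^sup>2 \<le> D * (\<Sum>j\<in>J. F (gridpt s t n (Suc j)) - F (gridpt s t n j))"
      using D(2)[OF a] a by (simp add: FK)
  qed (use T D in auto)
  obtain h where h: "integrable lborel h" "\<And>a b. a \<le> b \<Longrightarrow> F b - F a = integral {a..b} h"
    using density_exists by metis
  obtain N where N: "negligible N" "\<And>x. x \<notin> N \<Longrightarrow> (F has_real_derivative h x) (at x)"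
    using AE_derivative_of_integral[OF h] by metis
  show ?thesis
  proof (rule that[OF h(1) N(1)])
    show "(K has_real_derivative h t) (at t)" if "0 < t" "t < T" "t \<notin> N" for t
      by (rule has_field_derivative_transform_within_open[OF N(2)[OF that(3)], of "{..<T}"]) (use that FK in auto)
    show "integral {0..t} h = K t" if "0 \<le> t" "t < T" for t
      using h(2)[OF that(1)] FK[of t] FK[of 0] that T by (simp add: K_def)
  qed
qed

end

section \<open>Adding a point mass\<close>


lemma sets_add_point_mass [simp]: "sets (add_point_mass \<nu> c) = sets borel"
  using sets_measure_of[of "sets borel" UNIV] by (simp add: add_point_mass_def sets.sigma_sets_eq[of borel, simplified])

lemma space_add_point_mass [simp]: "space (add_point_mass \<nu> c) = UNIV"
  by (simp add: add_point_mass_def)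

lemma emeasure_add_point_mass:
  assumes "sets \<nu> = sets borel" "A \<in> sets borel"
  shows "emeasure (add_point_mass \<nu> c) A = emeasure \<nu> A + ennreal c * indicator A 0"
proof (rule emeasure_measure_of[OF add_point_mass_def[of \<nu> c]])
  let ?m = "\<lambda>A. emeasure \<nu> A + ennreal c * indicator A 0"
  show "positive (sets (add_point_mass \<nu> c)) ?m" by (simp add: positive_def)
  show "countably_additive (sets (add_point_mass \<nu> c)) ?m"
  proof (rule countably_additiveI)
    fix A :: "nat \<Rightarrow> real set"
    assume A: "range A \<subseteq> sets (add_point_mass \<nu> c)" "disjoint_family A"
    have "(\<Sum>i. ?m (A i)) = (\<Sum>i. emeasure \<nu> (A i)) + ennreal c * (\<Sum>i. indicator (A i) 0)"
      by (simp add: suminf_add[symmetric])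
    also have "\<dots> = ?m (\<Union>i. A i)"
      using A assms(1) by (simp add: suminf_emeasure suminf_indicator)
    finally show "(\<Sum>i. ?m (A i)) = ?m (\<Union>i. A i)" .
  qed
qed (use assms in auto)

lemma nn_integral_add_point_mass:
  assumes \<nu>: "sets \<nu> = sets borel" and f: "f \<in> borel_measurable borel"
  shows "(\<integral>\<^sup>+x. f x \<partial>add_point_mass \<nu> c) = (\<integral>\<^sup>+x. f x \<partial>\<nu>) + ennreal c * f 0"
  using f
proof (induction rule: borel_measurable_induct)
  case (cong f g)
  then show ?case by simp
next
  case (set A)
  then show ?case by (simp add: \<nu> emeasure_add_point_mass)
next
  case (mult u a)
  have [measurable]: "u \<in> borel_measurable \<nu>" "u \<in> borel_measurable (add_point_mass \<nu> c)"
    using mult(2) measurable_cong_sets[OF \<nu> refl] measurable_cong_sets[OF sets_add_point_mass refl] by blast+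
  show ?case using mult by (simp add: nn_integral_cmult distrib_left mult.left_commute)
next
  case (add u v)
  have [measurable]: "u \<in> borel_measurable \<nu>" "u \<in> borel_measurable (add_point_mass \<nu> c)"
    "v \<in> borel_measurable \<nu>" "v \<in> borel_measurable (add_point_mass \<nu> c)"
    using add measurable_cong_sets[OF \<nu> refl] measurable_cong_sets[OF sets_add_point_mass refl] by blast+
  show ?case using add by (simp add: nn_integral_add distrib_left ac_simps)
next
  case (seq U)
  have [measurable]: "U i \<in> borel_measurable \<nu>" "U i \<in> borel_measurable (add_point_mass \<nu> c)" for i
    using seq measurable_cong_sets[OF \<nu> refl] measurable_cong_sets[OF sets_add_point_mass refl] by blast+
  have inc: "incseq (\<lambda>i. \<integral>\<^sup>+x. U i x \<partial>\<nu>)" "incseq (\<lambda>i. U i 0)"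
    using seq by (auto simp: incseq_def le_fun_def intro!: nn_integral_mono)
  have S: "(SUP i. U i) x = (SUP i. U i x)" for x by (rule SUP_apply)
  have "(\<integral>\<^sup>+x. (SUP i. U i) x \<partial>add_point_mass \<nu> c) = (SUP i. \<integral>\<^sup>+x. U i x \<partial>add_point_mass \<nu> c)"
    unfolding S using seq by (intro nn_integral_monotone_convergence_SUP) auto
  also have "\<dots> = (SUP i. (\<integral>\<^sup>+x. U i x \<partial>\<nu>) + ennreal c * U i 0)" by (simp add: seq)
  also have "\<dots> = (SUP i. \<integral>\<^sup>+x. U i x \<partial>\<nu>) + (SUP i. ennreal c * U i 0)"
    using inc by (intro ennreal_SUP_add) (auto simp: incseq_def intro!: mult_left_mono)
  also have "(SUP i. \<integral>\<^sup>+x. U i x \<partial>\<nu>) = (\<integral>\<^sup>+x. (SUP i. U i) x \<partial>\<nu>)"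
    unfolding S using seq by (intro nn_integral_monotone_convergence_SUP[symmetric]) auto
  also have "(SUP i. ennreal c * U i 0) = ennreal c * (SUP i. U i) 0"
    unfolding S by (simp add: SUP_mult_left_ennreal)
  finally show ?case .
qed

lemma point_mass_L2:
  assumes \<nu>: "sets \<nu> = sets borel" and c: "c \<ge> 0" and f: "f \<in> L2fun \<nu>"
  shows "f \<in> L2fun (add_point_mass \<nu> c)" "nsq (add_point_mass \<nu> c) f = nsq \<nu> f + c * (cmod (f 0))\<^sup>2"
proof -
  have m: "(\<lambda>x. f (complex_of_real x)) \<in> borel_measurable borel"
    using L2fun_measurable[OF f] measurable_cong_sets[OF \<nu> refl] by blast
  then have m': "(\<lambda>x. f (complex_of_real x)) \<in> borel_measurable (add_point_mass \<nu> c)"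
    using measurable_cong_sets[OF sets_add_point_mass refl] by blast
  have "L2sq (add_point_mass \<nu> c) f = L2sq \<nu> f + ennreal c * ennreal ((cmod (f 0))\<^sup>2)"
    unfolding L2sq_def using m by (subst nn_integral_add_point_mass[OF \<nu>]) auto
  also have "\<dots> = ennreal (nsq \<nu> f + c * (cmod (f 0))\<^sup>2)"
    using c by (simp add: L2sq_eq_nsq[OF f] ennreal_mult)
  finally have L: "L2sq (add_point_mass \<nu> c) f = ennreal (nsq \<nu> f + c * (cmod (f 0))\<^sup>2)" .
  show 1: "f \<in> L2fun (add_point_mass \<nu> c)" using L by (simp add: L2fun_iff_L2sq[OF m'])
  have "ennreal (nsq (add_point_mass \<nu> c) f) = ennreal (nsq \<nu> f + c * (cmod (f 0))\<^sup>2)"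
    using L L2sq_eq_nsq[OF 1] by simp
  then show "nsq (add_point_mass \<nu> c) f = nsq \<nu> f + c * (cmod (f 0))\<^sup>2"
    using c by (subst (asm) ennreal_inj) auto
qed

text \<open>Polarization: the norm identity for f + g gives the real part, and replacing
  \<open>f\<close> by -\<i>f gives the imaginary part.\<close>

lemma point_mass_ip:
  assumes \<nu>: "sets \<nu> = sets borel" and c: "c \<ge> 0" and f: "f \<in> L2fun \<nu>" and g: "g \<in> L2fun \<nu>"
  shows "ip (add_point_mass \<nu> c) f g = ip \<nu> f g + complex_of_real c * (f 0 * cnj (g 0))"
proof -
  let ?m = "add_point_mass \<nu> c"
  have re: "Re (ip ?m f g) = Re (ip \<nu> f g) + c * Re (f 0 * cnj (g 0))" if f: "f \<in> L2fun \<nu>" for f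
  proof -
    note P = point_mass_L2[OF \<nu> c]
    have "(cmod (f 0 + g 0))\<^sup>2 = (cmod (f 0))\<^sup>2 + 2 * Re (f 0 * cnj (g 0)) + (cmod (g 0))\<^sup>2"
      unfolding cmod_power2 by (simp add: power2_eq_square algebra_simps)
    then have "c * (cmod (f 0 + g 0))\<^sup>2 = c * (cmod (f 0))\<^sup>2 + 2 * (c * Re (f 0 * cnj (g 0))) + c * (cmod (g 0))\<^sup>2"
      by (simp add: algebra_simps)
    then show ?thesis
      using nsq_add[OF f g] nsq_add[OF P(1)[OF f] P(1)[OF g]] P(2)[OF f] P(2)[OF g] P(2)[OF L2fun_add[OF f g]] by linarith
  qed
  have "Re (ip ?m (\<lambda>z. - \<i> * f z) g) = Re (ip \<nu> (\<lambda>z. - \<i> * f z) g) + c * Re ((- \<i> * f 0) * cnj (g 0))"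
    by (rule re[OF L2fun_scale[OF f]])
  then have "Im (ip ?m f g) = Im (ip \<nu> f g) + c * Im (f 0 * cnj (g 0))"
    unfolding ip_scale_left by (simp add: algebra_simps)
  with re[OF f] show ?thesis by (simp add: complex_eq_iff)
qed

text \<open>The squared norm grows by c |f 0|^2, which the pointwise bound at 0 controls by the
  Lebesgue norm. The definition squares its constant, hence \<open>sqrt E\<close>.\<close>

lemma PW_sampling_add_point_mass:
  assumes \<nu>: "PW_sampling \<nu>" and c: "c \<ge> 0"
  shows "PW_sampling (add_point_mass \<nu> c)"
  unfolding PW_sampling_def
proof (intro conjI allI impI)
  fix a :: real assume a: "a > 0"
  obtain C where C: "C > 0" and L2: "\<And>f. f \<in> PW a \<Longrightarrow> f \<in> L2fun \<nu>"
    and C1: "\<And>f. f \<in> PW a \<Longrightarrow> nsq lborel f \<le> C * nsq \<nu> f"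
    and C2: "\<And>f. f \<in> PW a \<Longrightarrow> nsq \<nu> f \<le> C * nsq lborel f"
    using sampling_bounds[OF \<nu> a] by blast
  define E where "E = C + c * exp (2 + 2 * a)"
  have E: "E > 0" "E \<ge> C" using C c by (auto simp: E_def add_pos_nonneg)
  show "\<exists>C>0. \<forall>f\<in>PW a. ennreal (inverse (C\<^sup>2)) * L2sq lborel f \<le> L2sq (add_point_mass \<nu> c) f \<and>
        L2sq (add_point_mass \<nu> c) f \<le> ennreal (C\<^sup>2) * L2sq lborel f"
  proof (intro exI[of _ "sqrt E"] conjI ballI)
    show "sqrt E > 0" using E by simp
    fix f assume f: "f \<in> PW a"
    note P = point_mass_L2[OF PW_sampling_sets[OF \<nu>] c L2[OF f]]
    have f0: "(cmod (f 0))\<^sup>2 \<le> exp (2 + 2 * a) * nsq lborel f" using PW_pointwise_bound[OF f, of 0] a by simp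
    have "nsq lborel f \<le> E * nsq \<nu> f"
      using C1[OF f] mult_right_mono[OF E(2) nsq_nonneg[of \<nu> f]] by linarith
    also have "\<dots> \<le> E * nsq (add_point_mass \<nu> c) f" using E c by (simp add: P(2))
    finally have "inverse E * nsq lborel f \<le> nsq (add_point_mass \<nu> c) f"
      using E by (simp add: field_simps)
    then show "ennreal (inverse ((sqrt E)\<^sup>2)) * L2sq lborel f \<le> L2sq (add_point_mass \<nu> c) f"
      using E by (simp add: L2sq_eq_nsq[OF P(1)] L2sq_eq_nsq[OF PW_L2fun[OF f]] flip: ennreal_mult')
    have "nsq (add_point_mass \<nu> c) f \<le> C * nsq lborel f + c * (exp (2 + 2 * a) * nsq lborel f)"
      unfolding P(2) using C2[OF f] f0 c by (intro add_mono mult_left_mono)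
    also have "\<dots> = E * nsq lborel f" by (simp add: E_def algebra_simps)
    finally show "L2sq (add_point_mass \<nu> c) f \<le> ennreal ((sqrt E)\<^sup>2) * L2sq lborel f"
      using E by (simp add: L2sq_eq_nsq[OF P(1)] L2sq_eq_nsq[OF PW_L2fun[OF f]] flip: ennreal_mult')
  qed
qed simp

text \<open>Paired with a real multiple s of the old kernel, the enlarged inner product returns s (1
  + c K t) f(0), which determines s.\<close>

lemma PW_kernel_add_point_mass:
  assumes \<nu>: "PW_sampling \<nu>" and c: "c \<ge> 0" and t: "t > 0"
  shows "Re (PW_kernel (add_point_mass \<nu> c) t 0) = Re (PW_kernel \<nu> t 0) / (1 + c * Re (PW_kernel \<nu> t 0))"
proof -
  interpret sampling \<nu> by unfold_locales (rule \<nu>)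
  let ?k = "PW_kernel \<nu> t"
  have k: "?k \<in> PW t" by (rule PW_kernel_props[OF \<nu> t])
  have k0: "?k 0 = complex_of_real (K t)" by (rule kernel_at_0[OF t])
  have pos: "1 + c * K t > 0" using c K_nonneg[of t] by (simp add: add_pos_nonneg)
  define s where "s = complex_of_real (1 / (1 + c * K t))"
  have "PW_kernel (add_point_mass \<nu> c) t = (\<lambda>z. s * ?k z)"
  proof (rule PW_kernel_eqI[OF PW_sampling_add_point_mass[OF \<nu> c] t PW_scale[OF k]])
    fix f assume f: "f \<in> PW t"
    note L = PW_L2fun_sampling[OF \<nu> _ t]
    have "ip (add_point_mass \<nu> c) f (\<lambda>z. s * ?k z) = ip \<nu> f (\<lambda>z. s * ?k z) + complex_of_real c * (f 0 * cnj (s * ?k 0))"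
      by (rule point_mass_ip[OF PW_sampling_sets[OF \<nu>] c L[OF f] L[OF PW_scale[OF k]]])
    also have "\<dots> = s * f 0 + complex_of_real c * (f 0 * (s * complex_of_real (K t)))"
      unfolding ip_scale_right PW_kernel_props(2)[OF \<nu> t f] k0 by (simp add: s_def)
    also have "\<dots> = f 0 * (s * complex_of_real (1 + c * K t))" by (simp add: algebra_simps)
    also have "s * complex_of_real (1 + c * K t) = 1" unfolding s_def of_real_mult[symmetric] using pos by simp
    finally show "f 0 = ip (add_point_mass \<nu> c) f (\<lambda>z. s * ?k z)" by simp
  qed
  then show ?thesis by (simp add: k0 s_def)
qed

theorem mainTheorem19:
  fixes \<mu> :: "real measure" and r :: real
  assumes "PW_sampling \<mu>" and "r \<ge> 0"
  shows "AE t in lborel. t > 0 \<longrightarrow>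
           h_fun (add_point_mass \<mu> (r * pi)) t =
             h_fun \<mu> t / (1 + r * (LINT s:{0..t}|lebesgue. h_fun \<mu> s))\<^sup>2"
proof -
  interpret sampling \<mu> by unfold_locales (rule assms(1))
  let ?P = "\<lambda>t. t > 0 \<longrightarrow> h_fun (add_point_mass \<mu> (r * pi)) t =
             h_fun \<mu> t / (1 + r * (LINT s:{0..t}|lebesgue. h_fun \<mu> s))\<^sup>2"
  have c: "r * pi \<ge> 0" using assms(2) by simp
  \<comment> \<open>The density supplied by \<open>K_derivative\<close> depends on \<open>T\<close>,
    so the identity is shown below each \<open>T\<close> and then combined over T = n + 1.\<close>
  have main: "AE t in lebesgue. t < T \<longrightarrow> ?P t" if T: "T > 0" for T
  proof -
    obtain h N where h: "integrable lborel h" "negligible N"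
      "\<And>t. 0 < t \<Longrightarrow> t < T \<Longrightarrow> t \<notin> N \<Longrightarrow> (K has_real_derivative h t) (at t)"
      "\<And>t. 0 \<le> t \<Longrightarrow> t < T \<Longrightarrow> integral {0..t} h = K t"
      using K_derivative[OF T] by blast
    have hf: "h_fun \<mu> t = pi * h t" if t: "0 < t" "t < T" "t \<notin> N" for t
    proof -
      have "((\<lambda>s. Re (PW_kernel \<mu> s 0)) has_real_derivative h t) (at t)"
        by (rule has_field_derivative_transform_within_open[OF h(3)[OF t], of "{0<..}"]) (use t in \<open>auto simp: K_def\<close>)
      then show ?thesis by (simp add: h_fun_def DERIV_imp_deriv)
    qed
    \<comment> \<open>\<open>h_fun \<mu>\<close> is defined as a pointwise derivative; it agrees
      with pi times \<open>h\<close> off a negligible set, to which 0 is added because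
      \<open>hf\<close> speaks of t > 0, and integrability is transferred across that set.\<close>
    have int: "(LINT s:{0..t}|lebesgue. h_fun \<mu> s) = pi * K t" if t: "0 < t" "t < T" for t
    proof -
      have "set_integrable lborel {0..t} h"
        unfolding set_integrable_def using h(1) by (intro integrable_mult_indicator) auto
      then have "h absolutely_integrable_on {0..t}"
        unfolding set_integrable_def by (intro integrable_completion[THEN iffD2] borel_measurable_integrable)
      then have ai: "(\<lambda>s. pi * h s) absolutely_integrable_on {0..t}"
        by (rule set_integrable_mult_right)
      have ng: "negligible (insert 0 N)" using h(2) by simp
      have eq: "h_fun \<mu> s = pi * h s" if "s \<in> {0..t} - insert 0 N" for s
        using that t by (intro hf) auto
      have "h_fun \<mu> absolutely_integrable_on {0..t}"
        by (rule absolutely_integrable_spike[OF ai ng]) (use eq in auto)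
      then have "(LINT s:{0..t}|lebesgue. h_fun \<mu> s) = integral {0..t} (h_fun \<mu>)"
        by (rule set_lebesgue_integral_eq_integral(2))
      also have "\<dots> = integral {0..t} (\<lambda>s. pi * h s)"
        by (rule integral_spike[OF ng]) (use eq in auto)
      also have "\<dots> = pi * K t" using h(4)[of t] t by simp
      finally show ?thesis .
    qed
    have P: "?P t" if t: "t < T" "t \<notin> N" for t
    proof
      assume t0: "t > 0"
      have pos: "1 + r * pi * K s > 0" for s
        using mult_nonneg_nonneg[OF c K_nonneg[of s]] by linarith
      \<comment> \<open>With c = r pi, the derivative of K/(1 + cK) is K'/(1 + cK)^2, and the pi in
        c is the one that makes pi K the integral of \<open>h_fun \<mu>\<close>.\<close>
      have "((\<lambda>s. K s / (1 + r * pi * K s)) has_real_derivative h t / (1 + r * pi * K t)\<^sup>2) (at t)"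
        using h(3)[OF t0 t] pos[of t]
        by (auto intro!: derivative_eq_intros simp: power2_eq_square algebra_simps)
      then have "((\<lambda>s. Re (PW_kernel (add_point_mass \<mu> (r * pi)) s 0)) has_real_derivative h t / (1 + r * pi * K t)\<^sup>2) (at t)"
        by (rule has_field_derivative_transform_within_open[of _ _ _ "{0<..}"])
           (use t0 in \<open>auto simp: PW_kernel_add_point_mass[OF assms(1) c] K_def\<close>)
      then have "h_fun (add_point_mass \<mu> (r * pi)) t = pi * (h t / (1 + r * pi * K t)\<^sup>2)"
        unfolding h_fun_def by (simp add: DERIV_imp_deriv)
      also have "\<dots> = h_fun \<mu> t / (1 + r * (LINT s:{0..t}|lebesgue. h_fun \<mu> s))\<^sup>2"
        using int[OF t0 t(1)] hf[OF t0 t] by (simp add: mult.assoc)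
      finally show "h_fun (add_point_mass \<mu> (r * pi)) t =
             h_fun \<mu> t / (1 + r * (LINT s:{0..t}|lebesgue. h_fun \<mu> s))\<^sup>2" .
    qed
    have "N \<in> null_sets lebesgue" using h(2) by (simp add: negligible_iff_null_sets)
    then show ?thesis by (rule AE_I') (use P in auto)
  qed
  have "AE t in lebesgue. \<forall>n::nat. t < real (Suc n) \<longrightarrow> ?P t"
    unfolding AE_all_countable using main by simp
  then have "AE t in lebesgue. ?P t"
  proof eventually_elim
    case (elim t)
    obtain n :: nat where "t < real n" using reals_Archimedean2 by blast
    then have "t < real (Suc n)" by simp
    then show ?case using elim by blast
  qed
  then show ?thesis by (simp add: AE_completion_iff)
qed

end
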